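(* Let $\sigma\in S^{1/2}_{1/2}(\mathbb{R}^d)$, i.e. $\sigma\in\mathcal{C}^\infty(\mathbb{R}^d)$ and there are constants $C_0,\varepsilon_0>0$ such that $|\partial^\alpha_\xi\sigma(\xi)|\le C_0^{|\alpha|+1}(\alpha!)^{1/2}e^{-\varepsilon_0|\xi|^2}$ for all $\xi\in\mathbb{R}^d$ and $\alpha\in\mathbb{N}^d$. Then the Wigner kernel of $\sigma(D_x)$ is given by $$k_W(z,w)=\delta(\xi-\eta)\,a(x-y,\xi),\qquad z=(x,\xi),\ w=(y,\eta)\in\mathbb{R}^{2d},$$ where $a\in\mathcal{C}^\infty(\mathbb{R}^{2d})$ satisfies $$|a(s,\xi)|\le Ce^{-\varepsilon|\xi|^2}e^{-\varepsilon|s|^2},\qquad s,\xi\in\mathbb{R}^d,$$ for some $C>0$ and $\varepsilon>0$.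
   Context: Fourier transform: $\widehat f(\xi)=\mathcal{F}f(\xi)=\int f(x)e^{-2\pi i x\cdot\xi}dx$; $\sigma(D_x)f=\mathcal{F}^{-1}(\sigma\widehat f)$. Cross-Wigner distribution: $W(f,g)(x,\xi)=\int_{\mathbb{R}^d}f(x+\frac y2)\overline{g(x-\frac y2)}e^{-2\pi i y\cdot\xi}dy$. The Wigner kernel of a continuous linear $T:\mathcal{S}(\mathbb{R}^d)\to\mathcal{S}'(\mathbb{R}^d)$ is the unique $k_W\in\mathcal{S}'(\mathbb{R}^{4d})$ with $W(Tf,Tg)(z)=\int_{\mathbb{R}^{2d}}k_W(z,w)W(f,g)(w)\,dw$ for all $f,g\in\mathcal{S}(\mathbb{R}^d)$, in the distributional sense. $\delta(\xi-\eta)a(x-y,\xi)$ denotes the tempered distribution $\Phi\mapsto\iiint a(x-y,\xi)\Phi(x,\xi,y,\xi)\,dx\,dy\,d\xi$. *)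

theory Defs
  imports "HOL-Analysis.Analysis"
begin

(* Throughout, an arbitrary Euclidean space 'a plays the role of R^d, with the coordinates given by
   Basis. Products 'a * 'a are again Euclidean spaces (R^{2d}), with the Euclidean norm and the
   product Lebesgue measure lborel. *)

definition partial_deriv :: "'a::euclidean_space \<Rightarrow> ('a \<Rightarrow> complex) \<Rightarrow> 'a \<Rightarrow> complex" where
  "partial_deriv b f x = vector_derivative (\<lambda>t. f (x + t *\<^sub>R b)) (at 0)"

(* C^infinity: all iterated partial derivatives are (Frechet) differentiable, hence continuous. *)
definition smooth :: "('a::euclidean_space \<Rightarrow> complex) \<Rightarrow> bool" where
  "smooth f \<longleftrightarrow>
     (\<forall>bs. set bs \<subseteq> Basis \<longrightarrow> (\<forall>x. foldr partial_deriv bs f differentiable (at x)))"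

definition basis_list :: "'a::euclidean_space list" where
  "basis_list = (SOME bs. distinct bs \<and> set bs = Basis)"

(* A multi-index in N^d is a function 'a => nat of which only the values on Basis matter.
   For smooth functions the enumeration basis_list chosen in multi_deriv is irrelevant. *)
definition multi_deriv :: "('a::euclidean_space \<Rightarrow> nat) \<Rightarrow> ('a \<Rightarrow> complex) \<Rightarrow> 'a \<Rightarrow> complex" where
  "multi_deriv \<alpha> f = foldr (\<lambda>b. partial_deriv b ^^ \<alpha> b) basis_list f"

definition multi_order :: "('a::euclidean_space \<Rightarrow> nat) \<Rightarrow> nat" where
  "multi_order \<alpha> = (\<Sum>b\<in>Basis. \<alpha> b)"

definition multi_fact :: "('a::euclidean_space \<Rightarrow> nat) \<Rightarrow> real" where
  "multi_fact \<alpha> = (\<Prod>b\<in>Basis. fact (\<alpha> b))"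

definition gelfand_shilov_half :: "('a::euclidean_space \<Rightarrow> complex) \<Rightarrow> bool" where
  "gelfand_shilov_half \<sigma> \<longleftrightarrow> smooth \<sigma> \<and>
     (\<exists>C0>0. \<exists>\<epsilon>0>0. \<forall>\<xi> \<alpha>.
        cmod (multi_deriv \<alpha> \<sigma> \<xi>)
          \<le> C0 ^ (multi_order \<alpha> + 1) * multi_fact \<alpha> powr (1/2) * exp (- \<epsilon>0 * (norm \<xi>)\<^sup>2))"

definition schwartz :: "('a::euclidean_space \<Rightarrow> complex) set" where
  "schwartz = {f. smooth f \<and>
     (\<forall>N \<alpha>. bounded (range (\<lambda>x. (1 + norm x) ^ N *\<^sub>R multi_deriv \<alpha> f x)))}"

definition schwartz_norm :: "nat \<Rightarrow> ('a::euclidean_space \<Rightarrow> complex) \<Rightarrow> real" where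
  "schwartz_norm N f =
     (SUP (\<alpha>, x) \<in> {\<alpha>. multi_order \<alpha> \<le> N} \<times> UNIV. (1 + norm x) ^ N * cmod (multi_deriv \<alpha> f x))"

(* Distributions are functionals of which only the values on schwartz matter; the pairing with
   test functions is bilinear. *)
definition tempered_dist :: "(('a::euclidean_space \<Rightarrow> complex) \<Rightarrow> complex) \<Rightarrow> bool" where
  "tempered_dist u \<longleftrightarrow>
     (\<forall>\<phi>\<in>schwartz. \<forall>\<psi>\<in>schwartz. u (\<lambda>x. \<phi> x + \<psi> x) = u \<phi> + u \<psi>) \<and>
     (\<forall>c. \<forall>\<phi>\<in>schwartz. u (\<lambda>x. c * \<phi> x) = c * u \<phi>) \<and>
     (\<exists>C N. \<forall>\<phi>\<in>schwartz. cmod (u \<phi>) \<le> C * schwartz_norm N \<phi>)"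

definition regular_dist :: "('a::euclidean_space \<Rightarrow> complex) \<Rightarrow> ('a \<Rightarrow> complex) \<Rightarrow> complex" where
  "regular_dist u \<phi> = (LINT x|lborel. u x * \<phi> x)"

(* Continuous linear T : S -> S', where S' carries the weak-* topology: f |-> <T f, phi> is a
   continuous linear functional on S for every test function phi. *)
definition continuous_linear_op ::
    "(('a::euclidean_space \<Rightarrow> complex) \<Rightarrow> ('a \<Rightarrow> complex) \<Rightarrow> complex) \<Rightarrow> bool" where
  "continuous_linear_op T \<longleftrightarrow>
     (\<forall>f\<in>schwartz. tempered_dist (T f)) \<and> (\<forall>\<phi>\<in>schwartz. tempered_dist (\<lambda>f. T f \<phi>))"

definition fourier :: "('a::euclidean_space \<Rightarrow> complex) \<Rightarrow> 'a \<Rightarrow> complex" where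
  "fourier f \<xi> = (LINT x|lborel. f x * cis (- 2 * pi * (x \<bullet> \<xi>)))"

definition inv_fourier :: "('a::euclidean_space \<Rightarrow> complex) \<Rightarrow> 'a \<Rightarrow> complex" where
  "inv_fourier f x = (LINT \<xi>|lborel. f \<xi> * cis (2 * pi * (x \<bullet> \<xi>)))"

definition fourier_multiplier ::
    "('a::euclidean_space \<Rightarrow> complex) \<Rightarrow> ('a \<Rightarrow> complex) \<Rightarrow> 'a \<Rightarrow> complex" where
  "fourier_multiplier \<sigma> f = inv_fourier (\<lambda>\<xi>. \<sigma> \<xi> * fourier f \<xi>)"

definition cross_wigner ::
    "('a::euclidean_space \<Rightarrow> complex) \<Rightarrow> ('a \<Rightarrow> complex) \<Rightarrow> 'a \<times> 'a \<Rightarrow> complex" where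
  "cross_wigner f g = (\<lambda>(x, \<xi>).
     LINT y|lborel. f (x + y /\<^sub>R 2) * cnj (g (x - y /\<^sub>R 2)) * cis (- 2 * pi * (y \<bullet> \<xi>)))"

(* The cross-Wigner distribution of u, v in S'. For functions, the substitution p = x + y/2,
   q = x - y/2 (so x = (p+q)/2, y = p - q, with Jacobian 1) gives
     <W(u,v), Phi> = int int u(p) cnj(v(q)) K(p,q) dp dq,
     K(p,q) = int Phi((p+q)/2, xi) e^{-2 pi i (p-q).xi} dxi,
   and the right-hand side is the pairing of K with the tensor product of u and cnj v, where
   <cnj v, psi> = cnj <v, cnj psi>. *)
definition wigner_pullback ::
    "('a::euclidean_space \<times> 'a \<Rightarrow> complex) \<Rightarrow> 'a \<Rightarrow> 'a \<Rightarrow> complex" where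
  "wigner_pullback \<Phi> p q =
     (LINT \<xi>|lborel. \<Phi> ((p + q) /\<^sub>R 2, \<xi>) * cis (- 2 * pi * ((p - q) \<bullet> \<xi>)))"

definition cross_wigner_dist ::
    "(('a::euclidean_space \<Rightarrow> complex) \<Rightarrow> complex) \<Rightarrow> (('a \<Rightarrow> complex) \<Rightarrow> complex)
      \<Rightarrow> ('a \<times> 'a \<Rightarrow> complex) \<Rightarrow> complex" where
  "cross_wigner_dist u v \<Phi> = u (\<lambda>p. cnj (v (\<lambda>q. cnj (wigner_pullback \<Phi> p q))))"

(* W(Tf,Tg)(z) = int k(z,w) W(f,g)(w) dw, tested against Phi(z). *)
definition wigner_represents ::
    "(('a::euclidean_space \<Rightarrow> complex) \<Rightarrow> ('a \<Rightarrow> complex) \<Rightarrow> complex)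
      \<Rightarrow> ((('a \<times> 'a) \<times> ('a \<times> 'a) \<Rightarrow> complex) \<Rightarrow> complex) \<Rightarrow> bool" where
  "wigner_represents T k \<longleftrightarrow>
     (\<forall>f\<in>schwartz. \<forall>g\<in>schwartz. \<forall>\<Phi>\<in>schwartz.
        cross_wigner_dist (T f) (T g) \<Phi> = k (\<lambda>(z, w). \<Phi> z * cross_wigner f g w))"

definition is_wigner_kernel ::
    "(('a::euclidean_space \<Rightarrow> complex) \<Rightarrow> ('a \<Rightarrow> complex) \<Rightarrow> complex)
      \<Rightarrow> ((('a \<times> 'a) \<times> ('a \<times> 'a) \<Rightarrow> complex) \<Rightarrow> complex) \<Rightarrow> bool" where
  "is_wigner_kernel T k \<longleftrightarrow>
     continuous_linear_op T \<and> tempered_dist k \<and> wigner_represents T k \<and>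
     (\<forall>k'. tempered_dist k' \<and> wigner_represents T k' \<longrightarrow> (\<forall>\<Psi>\<in>schwartz. k' \<Psi> = k \<Psi>))"

definition delta_kernel ::
    "('a::euclidean_space \<times> 'a \<Rightarrow> complex) \<Rightarrow> (('a \<times> 'a) \<times> ('a \<times> 'a) \<Rightarrow> complex) \<Rightarrow> complex" where
  "delta_kernel a \<Phi> =
     (LINT (x, y, \<xi>)|lborel. a (x - y, \<xi>) * \<Phi> ((x, \<xi>), (y, \<xi>)))"

end

theory Submission
  imports Defs "HOL-Probability.Probability"
begin

text \<open>
  Let \<open>\<rho>\<close> be the inverse Fourier transform of \<open>\<sigma>\<close>, so that \<open>\<sigma>(D)\<close> is the convolution with \<open>\<rho>\<close>. Expanding
  the product of two such convolutions and substituting midpoint and difference of the two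
  convolution variables shows that the Wigner distribution of the images is a convolution in the
  position variable alone,
  \<open>W(\<sigma>(D)f, \<sigma>(D)g)(x, \<xi>) = \<integral> W(\<rho>, \<rho>)(x - y, \<xi>) W(f, g)(y, \<xi>) dy\<close>
  (\<open>cross_wigner_convolution\<close>). Hence \<open>\<delta>(\<xi> - \<eta>) a(x - y, \<xi>)\<close> with \<open>a = W(\<rho>, \<rho>)\<close> is a Wigner kernel.

  The decay of \<open>a\<close> comes from two formulas. Integrating by parts \<open>n\<close> times in one coordinate, the
  derivative bounds on \<open>\<sigma>\<close> show that the \<open>n\<close>-th power of this coordinate times \<open>\<rho>\<close> is
  bounded by a constant times \<open>C^n sqrt(n!)\<close>; summing against the exponential series gives a
  Gaussian bound on \<open>\<rho>\<close> (\<open>inv_fourier_gaussian_decay\<close>), and the parallelogram law makes it a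
  Gaussian bound on \<open>a\<close> in \<open>s\<close>. By Fourier inversion, \<open>a\<close> is also an integral over products
  \<open>\<sigma>(\<eta>) cnj \<sigma>(2\<xi> - \<eta>)\<close> (\<open>cross_wigner_inv_fourier\<close>), which gives a Gaussian bound in \<open>\<xi>\<close>. The geometric
  mean of the two bounds is the assertion. Smoothness of \<open>a\<close> holds because derivatives of cross-Wigner
  distributions of Schwartz functions are combinations of such distributions
  (\<open>smooth_cross_wigner\<close>).

  For uniqueness, the difference \<open>k\<close> of two kernels vanishes on \<open>\<Phi>(z) W(f, g)(w)\<close>. As \<open>\<Phi>\<close>, \<open>f\<close> and \<open>g\<close> vary
  over translated and modulated Gaussians, this tensor product runs, up to constant factors, through
  all coherent states, that is, translated and modulated copies of one fixed Gaussian
  (\<open>coherent_state_cross_wigner\<close>). Averaging coherent states over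
  their frequency yields narrower Gaussians, and averaging these over their centre yields mollified
  test functions, which converge to the given test function. Thus \<open>k\<close> vanishes
  (\<open>coherent_states_total\<close>). That \<open>k\<close> may be interchanged with these averages is
  \<open>tempered_dist_superposition\<close>.

  The closure properties of the Schwartz space are proved by coinduction: it suffices to exhibit a class of
  rapidly decreasing differentiable functions whose partial derivatives are linear combinations of
  members of the class (\<open>schwartz_coinduct\<close>).
\<close>

section \<open>Iterated partial derivatives and the Schwartz space\<close>

text \<open>
  Lists of directions compose by append and admit induction from either end, which multi-indices
  do not. \<open>foldr_eq_multi_deriv\<close> passes from one to the other.
\<close>

abbreviation derivs :: "'a::euclidean_space list \<Rightarrow> ('a \<Rightarrow> complex) \<Rightarrow> 'a \<Rightarrow> complex" where
  "derivs \<equiv> foldr partial_deriv"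

lemma partial_deriv_eq:
  assumes "(f has_derivative f') (at x)"
  shows "partial_deriv b f x = f' b"
proof -
  have f: "(f has_derivative f') (at (x + 0 *\<^sub>R b))" using assms by simp
  have "((\<lambda>t. x + t *\<^sub>R b) has_derivative (\<lambda>t. t *\<^sub>R b)) (at 0)"
    by (auto intro!: derivative_eq_intros)
  from has_derivative_compose[OF this f]
  have "((\<lambda>t. f (x + t *\<^sub>R b)) has_derivative (\<lambda>t. f' (t *\<^sub>R b))) (at 0)" .
  moreover have "(\<lambda>t. f' (t *\<^sub>R b)) = (\<lambda>t. t *\<^sub>R f' b)"
    using has_derivative_bounded_linear[OF assms] by (auto simp: linear_simps)
  ultimately show ?thesis
    unfolding partial_deriv_def by (intro vector_derivative_at) (simp add: has_vector_derivative_def)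
qed

lemma has_derivative_partial_deriv:
  fixes f :: "'a::euclidean_space \<Rightarrow> complex"
  assumes "f differentiable (at x)"
  shows "(f has_derivative (\<lambda>v. \<Sum>b\<in>Basis. (v \<bullet> b) *\<^sub>R partial_deriv b f x)) (at x)"
proof -
  obtain f' where f': "(f has_derivative f') (at x)"
    using assms unfolding differentiable_def by blast
  interpret bounded_linear f' using has_derivative_bounded_linear[OF f'] .
  have "f' v = (\<Sum>b\<in>Basis. (v \<bullet> b) *\<^sub>R partial_deriv b f x)" for v
  proof -
    have "f' v = f' (\<Sum>b\<in>Basis. (v \<bullet> b) *\<^sub>R b)" by (simp add: euclidean_representation)
    also have "\<dots> = (\<Sum>b\<in>Basis. (v \<bullet> b) *\<^sub>R f' b)" by (simp add: sum scaleR)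
    finally show ?thesis by (simp add: partial_deriv_eq[OF f'])
  qed
  then have "f' = (\<lambda>v. \<Sum>b\<in>Basis. (v \<bullet> b) *\<^sub>R partial_deriv b f x)" by auto
  with f' show ?thesis by simp
qed

lemma has_vector_derivative_line:
  fixes f :: "'a::euclidean_space \<Rightarrow> complex"
  assumes "f differentiable (at (y + s *\<^sub>R b))"
  shows "((\<lambda>t. f (y + t *\<^sub>R b)) has_vector_derivative partial_deriv b f (y + s *\<^sub>R b)) (at s within S)"
proof -
  obtain f' where f': "(f has_derivative f') (at (y + s *\<^sub>R b))"
    using assms unfolding differentiable_def by blast
  have "((\<lambda>t. y + t *\<^sub>R b) has_derivative (\<lambda>t. t *\<^sub>R b)) (at s)"
    by (auto intro!: derivative_eq_intros)
  from has_derivative_compose[OF this f']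
  have "((\<lambda>t. f (y + t *\<^sub>R b)) has_derivative (\<lambda>t. f' (t *\<^sub>R b))) (at s)" .
  moreover have "(\<lambda>t. f' (t *\<^sub>R b)) = (\<lambda>t. t *\<^sub>R f' b)"
    using has_derivative_bounded_linear[OF f'] by (auto simp: linear_simps)
  ultimately show ?thesis
    by (simp add: has_vector_derivative_def partial_deriv_eq[OF f'] has_derivative_at_withinI)
qed

text \<open>
  The difference quotient is symmetric in the two directions, so this limit contains the symmetry of
  mixed derivatives. The mean value inequality is applied to the first difference in the
  direction \<open>b\<close>, whose derivative along \<open>a\<close> is controlled by the differentiability of the partial
  derivative at the single point \<open>x\<close>.
\<close>

lemma second_difference_tendsto:
  fixes f :: "'a::euclidean_space \<Rightarrow> complex"
  assumes f: "\<And>y. f differentiable (at y)"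
    and g: "partial_deriv a f differentiable (at x)"
  shows "((\<lambda>h. (f (x + h *\<^sub>R a + h *\<^sub>R b) - f (x + h *\<^sub>R a) - f (x + h *\<^sub>R b) + f x) /\<^sub>R h\<^sup>2)
            \<longlongrightarrow> partial_deriv b (partial_deriv a f) x) (at_right 0)"
proof -
  define g where "g = partial_deriv a f"
  obtain g' where g': "(g has_derivative g') (at x)"
    using g unfolding differentiable_def g_def by blast
  interpret g': bounded_linear g' using has_derivative_bounded_linear[OF g'] .
  define K where "K = norm a + norm b + 1"
  have K: "K > 0" "norm a + norm b \<le> K" by (auto simp: K_def intro: add_nonneg_pos)
  have gb: "partial_deriv b (partial_deriv a f) x = g' b"
    using partial_deriv_eq[OF g'] by (simp add: g_def)
  show ?thesis unfolding gb
  proof (rule tendstoI)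
    fix e :: real assume e: "e > 0"
    \<comment> \<open>Two remainders, each at most e' h K, enter; the factor 4 makes their sum strictly less than e.\<close>
    define e' where "e' = e / (4 * K)"
    have e': "e' > 0" using e K by (simp add: e'_def)
    obtain d where d: "d > 0" and dd: "\<And>y. norm (y - x) < d \<Longrightarrow> norm (g y - g x - g' (y - x)) \<le> e' * norm (y - x)"
      using g'[unfolded has_derivative_at_alt] e' by metis
    have "dist ((f (x + h *\<^sub>R a + h *\<^sub>R b) - f (x + h *\<^sub>R a) - f (x + h *\<^sub>R b) + f x) /\<^sub>R h\<^sup>2) (g' b) < e"
      if h: "h > 0" "h < d / K" for h
    proof -
      define \<phi> where "\<phi> s = f (x + h *\<^sub>R b + s *\<^sub>R a) - f (x + s *\<^sub>R a) - s *\<^sub>R (h *\<^sub>R g' b)" for s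
      have hK: "h * K < d" using h K by (simp add: field_simps)
      have "norm (\<phi> h - \<phi> 0) \<le> (2 * e' * K * h) * norm (h - 0)"
      proof (rule differentiable_bound[where S = "{0..h}"])
        fix s assume s: "s \<in> {0..h}"
        show "(\<phi> has_derivative (\<lambda>t. t *\<^sub>R (g (x + h *\<^sub>R b + s *\<^sub>R a) - g (x + s *\<^sub>R a) - h *\<^sub>R g' b))) (at s within {0..h})"
          unfolding \<phi>_def g_def has_vector_derivative_def[symmetric]
          by (intro has_vector_derivative_diff has_vector_derivative_line f)
             (auto simp: has_vector_derivative_def intro!: derivative_eq_intros)
        have n1: "norm (s *\<^sub>R a) \<le> h * norm a" using s by (auto intro!: mult_right_mono)
        have n2: "norm (h *\<^sub>R b + s *\<^sub>R a) \<le> h * K"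
        proof -
          have "norm (h *\<^sub>R b + s *\<^sub>R a) \<le> h * norm b + h * norm a"
            using n1 h norm_triangle_ineq[of "h *\<^sub>R b" "s *\<^sub>R a"] by simp
          also have "\<dots> \<le> h * K" using h by (simp add: K_def algebra_simps)
          finally show ?thesis .
        qed
        have n3: "norm (s *\<^sub>R a) \<le> h * K"
          using n1 h K by (smt (verit) mult_left_mono norm_ge_zero)
        have "norm (g (x + h *\<^sub>R b + s *\<^sub>R a) - g (x + s *\<^sub>R a) - h *\<^sub>R g' b)
            = norm ((g (x + (h *\<^sub>R b + s *\<^sub>R a)) - g x - g' (h *\<^sub>R b + s *\<^sub>R a)) - (g (x + s *\<^sub>R a) - g x - g' (s *\<^sub>R a)))"
          by (simp add: g'.add g'.scaleR algebra_simps)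
        also have "\<dots> \<le> e' * (h * K) + e' * (h * K)"
        proof -
          have "norm (g (x + (h *\<^sub>R b + s *\<^sub>R a)) - g x - g' (h *\<^sub>R b + s *\<^sub>R a)) \<le> e' * (h * K)"
            using dd[of "x + (h *\<^sub>R b + s *\<^sub>R a)"] n2 hK e' by simp (smt (verit) mult_left_mono)
          moreover have "norm (g (x + s *\<^sub>R a) - g x - g' (s *\<^sub>R a)) \<le> e' * (h * K)"
            using dd[of "x + s *\<^sub>R a"] n3 hK e' by simp (smt (verit) mult_left_mono)
          ultimately show ?thesis by (rule norm_triangle_le_diff[OF add_mono])
        qed
        finally have *: "norm (g (x + h *\<^sub>R b + s *\<^sub>R a) - g (x + s *\<^sub>R a) - h *\<^sub>R g' b) \<le> 2 * e' * K * h"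
          by (simp add: algebra_simps)
        show "onorm (\<lambda>t. t *\<^sub>R (g (x + h *\<^sub>R b + s *\<^sub>R a) - g (x + s *\<^sub>R a) - h *\<^sub>R g' b)) \<le> 2 * e' * K * h"
          using * by (intro onorm_le) (simp add: mult.commute mult_left_mono)
      qed (use h in auto)
      then have 1: "norm (\<phi> h - \<phi> 0) \<le> 2 * e' * K * h\<^sup>2" using h by (simp add: power2_eq_square)
      have 2: "(f (x + h *\<^sub>R a + h *\<^sub>R b) - f (x + h *\<^sub>R a) - f (x + h *\<^sub>R b) + f x) /\<^sub>R h\<^sup>2 - g' b = (\<phi> h - \<phi> 0) /\<^sub>R h\<^sup>2"
        using h by (simp add: \<phi>_def scaleR_right_diff_distrib algebra_simps power2_eq_square)
      have "norm ((\<phi> h - \<phi> 0) /\<^sub>R h\<^sup>2) \<le> 2 * e' * K"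
        using 1 h unfolding norm_scaleR by (simp add: field_simps)
      also have "\<dots> < e" using e K by (simp add: e'_def)
      finally show ?thesis unfolding dist_norm 2 .
    qed
    moreover have "eventually (\<lambda>h. h > 0 \<and> h < d / K) (at_right (0::real))"
      using d K by (intro eventually_conj eventually_at_right_less)
        (auto simp: eventually_at_right_field intro!: exI[of _ "d/K"])
    ultimately show "\<forall>\<^sub>F h in at_right 0. dist ((f (x + h *\<^sub>R a + h *\<^sub>R b) - f (x + h *\<^sub>R a) - f (x + h *\<^sub>R b) + f x) /\<^sub>R h\<^sup>2) (g' b) < e"
      by (auto elim: eventually_mono)
  qed
qed

lemma partial_deriv_commute:
  fixes f :: "'a::euclidean_space \<Rightarrow> complex"
  assumes f: "\<And>y. f differentiable (at y)"
    and a: "partial_deriv a f differentiable (at x)" and b: "partial_deriv b f differentiable (at x)"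
  shows "partial_deriv a (partial_deriv b f) x = partial_deriv b (partial_deriv a f) x"
proof (rule tendsto_unique)
  show "((\<lambda>h. (f (x + h *\<^sub>R a + h *\<^sub>R b) - f (x + h *\<^sub>R a) - f (x + h *\<^sub>R b) + f x) /\<^sub>R h\<^sup>2)
            \<longlongrightarrow> partial_deriv b (partial_deriv a f) x) (at_right 0)"
    by (rule second_difference_tendsto[OF f a])
  show "((\<lambda>h. (f (x + h *\<^sub>R a + h *\<^sub>R b) - f (x + h *\<^sub>R a) - f (x + h *\<^sub>R b) + f x) /\<^sub>R h\<^sup>2)
            \<longlongrightarrow> partial_deriv a (partial_deriv b f) x) (at_right 0)"
    using second_difference_tendsto[OF f b, of a]
    by (rule tendsto_eq_rhs[THEN tendsto_cong[THEN iffD1, rotated]])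
       (auto intro!: always_eventually simp: algebra_simps)
qed simp

lemma smooth_differentiable: "smooth f \<Longrightarrow> f differentiable (at x)"
  unfolding smooth_def by (elim allE[of _ "[]"]) simp

lemma smooth_foldr:
  assumes "smooth f" "set bs \<subseteq> Basis"
  shows "smooth (derivs bs f)"
  unfolding smooth_def
proof (intro allI impI)
  fix cs x assume "set cs \<subseteq> (Basis :: 'a set)"
  then have "set (cs @ bs) \<subseteq> Basis" using assms by simp
  then have "derivs (cs @ bs) f differentiable (at x)"
    using assms(1) unfolding smooth_def by blast
  then show "derivs cs (derivs bs f) differentiable (at x)" by simp
qed

lemma smooth_partial_deriv: "smooth f \<Longrightarrow> b \<in> Basis \<Longrightarrow> smooth (partial_deriv b f)"
  using smooth_foldr[of f "[b]"] by simp

lemma partial_deriv_foldr: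
  assumes "smooth f" "set bs \<subseteq> Basis" "b \<in> Basis"
  shows "partial_deriv b (derivs bs f) = derivs bs (partial_deriv b f)"
  using assms(2)
proof (induction bs)
  case (Cons c bs)
  have s: "smooth (derivs bs f)" using Cons.prems assms by (intro smooth_foldr) auto
  have "partial_deriv b (partial_deriv c (derivs bs f))
      = partial_deriv c (partial_deriv b (derivs bs f))"
    using s Cons.prems assms
    by (intro ext partial_deriv_commute) (auto intro!: smooth_differentiable smooth_partial_deriv)
  then show ?case using Cons by simp
qed simp

text \<open>
  A multi-index derivative applies the directions in one fixed order, whereas differentiating
  a derivative produces arbitrary orders. This lemma identifies them.
\<close>

lemma foldr_partial_deriv_cong_mset:
  assumes "smooth f" "set bs \<subseteq> Basis" "mset bs = mset cs"
  shows "derivs bs f = derivs cs f"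
  using assms(2,3)
proof (induction bs arbitrary: cs)
  case (Cons b bs)
  have "b \<in> set cs" using Cons.prems(2) by (metis list.set_intros(1) set_mset_mset)
  then obtain c1 c2 where cs: "cs = c1 @ b # c2" by (meson split_list)
  have sub: "set c1 \<subseteq> Basis" "set c2 \<subseteq> Basis" "b \<in> Basis"
    using Cons.prems cs by (metis set_mset_mset set_append list.set(2) Un_subset_iff insert_subset)+
  have IH: "derivs bs f = derivs (c1 @ c2) f"
    using Cons.prems cs by (intro Cons.IH) auto
  have "derivs cs f = derivs c1 (partial_deriv b (derivs c2 f))"
    by (simp add: cs)
  also have "\<dots> = partial_deriv b (derivs c1 (derivs c2 f))"
    using sub assms by (intro partial_deriv_foldr[symmetric] smooth_foldr)
  finally show ?case using IH by simp
qed simp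

lemma basis_list: "distinct (basis_list :: 'a::euclidean_space list)" "set basis_list = (Basis :: 'a set)"
proof -
  have "\<exists>bs :: 'a list. distinct bs \<and> set bs = Basis"
    using finite_distinct_list[OF finite_Basis] by blast
  from someI_ex[OF this]
  show "distinct (basis_list :: 'a::euclidean_space list)" "set basis_list = (Basis :: 'a set)"
    unfolding basis_list_def by auto
qed

definition multi_index_list :: "('a::euclidean_space \<Rightarrow> nat) \<Rightarrow> 'a list" where
  "multi_index_list \<alpha> = concat (map (\<lambda>b. replicate (\<alpha> b) b) basis_list)"

lemma set_multi_index_list: "set (multi_index_list \<alpha>) \<subseteq> Basis"
  unfolding multi_index_list_def by (auto simp: basis_list)

lemma multi_deriv_eq_foldr: "multi_deriv \<alpha> f = derivs (multi_index_list \<alpha>) f"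
proof -
  have "foldr (\<lambda>b. partial_deriv b ^^ \<alpha> b) bs f
      = derivs (concat (map (\<lambda>b. replicate (\<alpha> b) b) bs)) f" for bs
  proof (induction bs)
    case (Cons b bs)
    have "derivs (replicate n b) g = (partial_deriv b ^^ n) g" for n and g :: "'a \<Rightarrow> complex"
      by (induction n) auto
    then show ?case using Cons by simp
  qed simp
  then show ?thesis by (simp add: multi_deriv_def multi_index_list_def)
qed

lemma length_multi_index_list: "length (multi_index_list \<alpha>) = multi_order \<alpha>"
proof -
  have "length (multi_index_list \<alpha>) = sum_list (map \<alpha> basis_list)"
    by (simp add: multi_index_list_def length_concat comp_def)
  also have "\<dots> = (\<Sum>b\<in>Basis. \<alpha> b)"
    using sum_list_distinct_conv_sum_set[OF basis_list(1), of \<alpha>] by (simp add: basis_list)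
  finally show ?thesis by (simp add: multi_order_def)
qed

lemma mset_multi_index_list:
  assumes "set bs \<subseteq> Basis"
  shows "mset (multi_index_list (count (mset bs))) = mset bs"
proof (rule multiset_eqI)
  fix b
  have "count (mset (concat (map (\<lambda>b. replicate (\<alpha> b) b) cs))) b = (if b \<in> set cs then \<alpha> b else 0)"
    if "distinct cs" for cs and \<alpha> :: "'a \<Rightarrow> nat"
    using that by (induction cs) (auto simp: )
  from this[OF basis_list(1), of "count (mset bs)"]
  show "count (mset (multi_index_list (count (mset bs)))) b = count (mset bs) b"
    using assms by (auto simp: multi_index_list_def basis_list not_in_iff[symmetric])
qed

lemma foldr_eq_multi_deriv:
  assumes "smooth f" "set bs \<subseteq> Basis"
  shows "derivs bs f = multi_deriv (count (mset bs)) f"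
  unfolding multi_deriv_eq_foldr using assms
  by (intro foldr_partial_deriv_cong_mset) (auto simp: mset_multi_index_list)

definition rapidly_decreasing :: "('a::real_normed_vector \<Rightarrow> complex) \<Rightarrow> bool" where
  "rapidly_decreasing f \<longleftrightarrow> (\<forall>N. \<exists>B. \<forall>x. (1 + norm x) ^ N * cmod (f x) \<le> B)"

text \<open>
  With bounds for all orders of the directions, closure under differentiation becomes immediate.
\<close>

lemma schwartz_iff:
  "f \<in> schwartz \<longleftrightarrow> smooth f \<and> (\<forall>bs. set bs \<subseteq> Basis \<longrightarrow> rapidly_decreasing (derivs bs f))"
    (is "?L \<longleftrightarrow> ?R")
proof
  assume L: ?L
  show ?R
  proof (intro conjI allI impI)
    show s: "smooth f" using L by (simp add: schwartz_def)
    fix bs :: "'a list" assume bs: "set bs \<subseteq> Basis"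
    show "rapidly_decreasing (derivs bs f)"
      using L unfolding rapidly_decreasing_def foldr_eq_multi_deriv[OF s bs] schwartz_def bounded_iff
      by (auto simp: abs_mult)
  qed
next
  assume R: ?R
  show ?L unfolding schwartz_def bounded_iff mem_Collect_eq
  proof (intro conjI allI)
    show "smooth f" using R by simp
    fix N and \<alpha> :: "'a \<Rightarrow> nat"
    have "rapidly_decreasing (multi_deriv \<alpha> f)"
      unfolding multi_deriv_eq_foldr using R set_multi_index_list by blast
    then show "\<exists>a. \<forall>x\<in>range (\<lambda>x. (1 + norm x) ^ N *\<^sub>R multi_deriv \<alpha> f x). norm x \<le> a"
      unfolding rapidly_decreasing_def by (auto simp: abs_mult)
  qed
qed

lemma schwartz_smooth: "f \<in> schwartz \<Longrightarrow> smooth f"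
  by (simp add: schwartz_iff)

lemma schwartz_differentiable: "f \<in> schwartz \<Longrightarrow> f differentiable (at x)"
  by (simp add: schwartz_iff smooth_differentiable)

lemma schwartz_foldr: "f \<in> schwartz \<Longrightarrow> set bs \<subseteq> Basis \<Longrightarrow> derivs bs f \<in> schwartz"
  unfolding schwartz_iff using smooth_foldr
  by (metis Un_subset_iff foldr_append comp_apply set_append)

lemma schwartz_partial_deriv: "f \<in> schwartz \<Longrightarrow> b \<in> Basis \<Longrightarrow> partial_deriv b f \<in> schwartz"
  using schwartz_foldr[of f "[b]"] by simp

lemma schwartz_rapidly_decreasing: "f \<in> schwartz \<Longrightarrow> rapidly_decreasing f"
  unfolding schwartz_iff by (elim conjE allE[of _ "[]"]) simp

lemma smooth_continuous_on: "smooth f \<Longrightarrow> continuous_on UNIV f"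
  by (meson continuous_at_imp_continuous_on differentiable_imp_continuous_within smooth_differentiable)

lemma rapidly_decreasing_add:
  assumes "rapidly_decreasing f" "rapidly_decreasing g"
  shows "rapidly_decreasing (\<lambda>x. f x + g x)"
  unfolding rapidly_decreasing_def
proof
  fix N
  obtain A B where "\<And>x. (1 + norm x) ^ N * cmod (f x) \<le> A" "\<And>x. (1 + norm x) ^ N * cmod (g x) \<le> B"
    using assms unfolding rapidly_decreasing_def by meson
  then have "(1 + norm x) ^ N * cmod (f x + g x) \<le> A + B" for x
    by (smt (verit) norm_triangle_ineq distrib_left mult_left_mono norm_ge_zero zero_le_power)
  then show "\<exists>B. \<forall>x. (1 + norm x) ^ N * cmod (f x + g x) \<le> B" by blast
qed

lemma rapidly_decreasing_mult:
  assumes "rapidly_decreasing f" "\<And>x. cmod (g x) \<le> K * (1 + norm x) ^ k"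
  shows "rapidly_decreasing (\<lambda>x. g x * f x)"
  unfolding rapidly_decreasing_def
proof
  fix N
  have K: "0 \<le> K" using assms(2)[of 0] by simp (smt (verit) norm_ge_zero)
  obtain B where B: "\<And>x. (1 + norm x) ^ (N + k) * cmod (f x) \<le> B"
    using assms unfolding rapidly_decreasing_def by meson
  have "(1 + norm x) ^ N * cmod (g x * f x) \<le> K * B" for x
  proof -
    have "(1 + norm x) ^ N * cmod (g x * f x) \<le> (1 + norm x) ^ N * ((K * (1 + norm x) ^ k) * cmod (f x))"
      unfolding norm_mult by (intro mult_left_mono mult_right_mono assms) auto
    also have "\<dots> = K * ((1 + norm x) ^ (N + k) * cmod (f x))" by (simp add: power_add)
    also have "\<dots> \<le> K * B" by (intro mult_left_mono B K)
    finally show ?thesis .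
  qed
  then show "\<exists>B. \<forall>x. (1 + norm x) ^ N * cmod (g x * f x) \<le> B" by blast
qed

lemma rapidly_decreasing_cmult: "rapidly_decreasing f \<Longrightarrow> rapidly_decreasing (\<lambda>x. c * f x)"
  using rapidly_decreasing_mult[of f "\<lambda>_. c" "cmod c" 0] by simp

section \<open>Proving membership in the Schwartz space by coinduction\<close>

text \<open>
  The derivative of a typical element of a class, for instance of a product, is not an element but
  a sum of elements of that class. The linear span absorbs such sums in coinductive arguments.
\<close>

inductive lin_span :: "(('a \<Rightarrow> complex) \<Rightarrow> bool) \<Rightarrow> ('a \<Rightarrow> complex) \<Rightarrow> bool" for P where
  base: "P f \<Longrightarrow> lin_span P f"
| add: "lin_span P f \<Longrightarrow> lin_span P g \<Longrightarrow> lin_span P (\<lambda>x. f x + g x)"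
| scale: "lin_span P f \<Longrightarrow> lin_span P (\<lambda>x. c * f x)"

lemma partial_deriv_add:
  assumes "f differentiable (at x)" "g differentiable (at x)"
  shows "partial_deriv b (\<lambda>x. f x + g x) x = partial_deriv b f x + partial_deriv b g x"
proof -
  obtain f' g' where "(f has_derivative f') (at x)" "(g has_derivative g') (at x)"
    using assms unfolding differentiable_def by blast
  then show ?thesis
    using partial_deriv_eq[OF has_derivative_add[of f f' "at x" g g']] by (simp add: partial_deriv_eq)
qed

lemma partial_deriv_mult:
  assumes "f differentiable (at x)" "g differentiable (at x)"
  shows "partial_deriv b (\<lambda>x. f x * g x) x = partial_deriv b f x * g x + f x * partial_deriv b g x"
proof -
  obtain f' g' where "(f has_derivative f') (at x)" "(g has_derivative g') (at x)"
    using assms unfolding differentiable_def by blast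
  then show ?thesis
    using partial_deriv_eq[OF has_derivative_mult[of f f' x UNIV g g']] by (simp add: partial_deriv_eq)
qed

lemma partial_deriv_const: "partial_deriv b (\<lambda>x. c) x = 0"
  by (rule partial_deriv_eq[OF has_derivative_const])

lemma partial_deriv_cmult:
  "f differentiable (at x) \<Longrightarrow> partial_deriv b (\<lambda>x. c * f x) x = c * partial_deriv b f x"
  by (subst partial_deriv_mult) (auto simp: partial_deriv_const)

text \<open>
  A class of differentiable functions that is closed under differentiation up to linear
  combinations consists of smooth functions, and a property of its members that survives linear
  combinations passes to all their derivatives. Taking rapid decrease for the property gives a
  criterion for Schwartz functions; taking a trivial property gives a criterion for smoothness.
\<close>

lemma derivs_coinduct:
  assumes P: "P f"
    and diff: "\<And>f x. P f \<Longrightarrow> f differentiable (at x)"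
    and Q: "\<And>f. P f \<Longrightarrow> Q f"
    and deriv: "\<And>f b. P f \<Longrightarrow> b \<in> Basis \<Longrightarrow> lin_span P (partial_deriv b f)"
    and Qadd: "\<And>f g. Q f \<Longrightarrow> Q g \<Longrightarrow> Q (\<lambda>x. f x + g x)"
    and Qscale: "\<And>f c. Q f \<Longrightarrow> Q (\<lambda>x. c * f x)"
  shows "smooth f" "set bs \<subseteq> Basis \<Longrightarrow> Q (derivs bs f)"
proof -
  have span: "(\<forall>x. f differentiable (at x)) \<and> Q f \<and> (\<forall>b\<in>Basis. lin_span P (partial_deriv b f))"
    if "lin_span P f" for f
    using that
  proof induction
    case (base f)
    then show ?case using diff Q deriv by blast
  next
    case (add f g)
    then have "partial_deriv b (\<lambda>x. f x + g x) = (\<lambda>x. partial_deriv b f x + partial_deriv b g x)" for b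
      by (intro ext partial_deriv_add) auto
    with add show ?case by (auto intro!: Qadd lin_span.add)
  next
    case (scale f c)
    then have "partial_deriv b (\<lambda>x. c * f x) = (\<lambda>x. c * partial_deriv b f x)" for b
      by (intro ext partial_deriv_cmult) auto
    with scale show ?case by (auto intro!: Qscale lin_span.scale)
  qed
  have foldr: "lin_span P (derivs bs f)" if "set bs \<subseteq> Basis" for bs
    using that by (induction bs) (auto intro: lin_span.base P dest: span)
  show "smooth f" unfolding smooth_def using span foldr by blast
  show "set bs \<subseteq> Basis \<Longrightarrow> Q (derivs bs f)" using span foldr by blast
qed

lemma schwartz_coinduct:
  assumes "P f"
    and "\<And>f x. P f \<Longrightarrow> f differentiable (at x)"
    and "\<And>f. P f \<Longrightarrow> rapidly_decreasing f"
    and "\<And>f b. P f \<Longrightarrow> b \<in> Basis \<Longrightarrow> lin_span P (partial_deriv b f)"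
  shows "f \<in> schwartz"
  unfolding schwartz_iff
  by (intro conjI allI impI; rule derivs_coinduct[of P f rapidly_decreasing])
     (use assms rapidly_decreasing_add rapidly_decreasing_cmult in auto)

section \<open>Closure properties of the Schwartz space\<close>

lemma one_plus_norm_add_le: "1 + norm (x + y) \<le> (1 + norm x) * (1 + norm y)"
  for x y :: "'a::real_normed_vector"
proof -
  have "0 \<le> norm x * norm y" by simp
  then show ?thesis
    using norm_triangle_ineq[of x y] unfolding distrib_left distrib_right mult_1_left mult_1_right by linarith
qed

lemma one_plus_norm_le_shift: "1 + norm x \<le> (1 + norm (x + y)) * (1 + norm y)"
  for x y :: "'a::real_normed_vector"
  using one_plus_norm_add_le[of "x + y" "- y"] by simp

lemma schwartz_bound:
  assumes "f \<in> schwartz"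
  obtains B where "B > 0" "\<And>x. (1 + norm x) ^ N * cmod (f x) \<le> B"
proof -
  obtain B where "\<And>x. (1 + norm x) ^ N * cmod (f x) \<le> B"
    using schwartz_rapidly_decreasing[OF assms] unfolding rapidly_decreasing_def by blast
  then have "\<And>x. (1 + norm x) ^ N * cmod (f x) \<le> max B 1" by (simp add: le_max_iff_disj)
  then show ?thesis by (intro that[of "max B 1"]) auto
qed

text \<open>
  Extends multiplication by a fixed function from a class to its span.
\<close>

lemma lin_span_mult:
  assumes "lin_span P f" "\<And>f. P f \<Longrightarrow> P (\<lambda>x. g x * f x)"
  shows "lin_span P (\<lambda>x. g x * f x)"
  using assms(1)
proof induction
  case (add f h)
  then show ?case using lin_span.add by (fastforce simp: distrib_left)
next
  case (scale f c)
  then show ?case using lin_span.scale[of P "\<lambda>x. g x * f x" c] by (simp add: mult.left_commute)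
qed (auto intro: lin_span.base assms)

lemma schwartz_add:
  assumes "f \<in> schwartz" "g \<in> schwartz"
  shows "(\<lambda>x. f x + g x) \<in> schwartz"
proof (rule schwartz_coinduct[where P = "\<lambda>h. \<exists>f\<in>schwartz. \<exists>g\<in>schwartz. h = (\<lambda>x. f x + g x)"])
  fix h :: "'a \<Rightarrow> complex" and b :: 'a
  assume "\<exists>f\<in>schwartz. \<exists>g\<in>schwartz. h = (\<lambda>x. f x + g x)" and b: "b \<in> Basis"
  then obtain f g where fg: "f \<in> schwartz" "g \<in> schwartz" "h = (\<lambda>x. f x + g x)" by blast
  then have "partial_deriv b h = (\<lambda>x. partial_deriv b f x + partial_deriv b g x)"
    by (auto intro!: ext partial_deriv_add schwartz_differentiable)
  with fg b show "lin_span (\<lambda>h. \<exists>f\<in>schwartz. \<exists>g\<in>schwartz. h = (\<lambda>x. f x + g x)) (partial_deriv b h)"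
    by (auto intro!: lin_span.base schwartz_partial_deriv)
qed (use assms in \<open>auto intro!: differentiable_add rapidly_decreasing_add
       intro: schwartz_differentiable schwartz_rapidly_decreasing\<close>)

lemma schwartz_cmult:
  assumes "f \<in> schwartz"
  shows "(\<lambda>x. c * f x) \<in> schwartz"
proof (rule schwartz_coinduct[where P = "\<lambda>h. \<exists>f\<in>schwartz. h = (\<lambda>x. c * f x)"])
  fix h :: "'a \<Rightarrow> complex" and b :: 'a
  assume "\<exists>f\<in>schwartz. h = (\<lambda>x. c * f x)" and b: "b \<in> Basis"
  then obtain f where f: "f \<in> schwartz" "h = (\<lambda>x. c * f x)" by blast
  then have "partial_deriv b h = (\<lambda>x. c * partial_deriv b f x)"
    by (auto intro!: ext partial_deriv_cmult schwartz_differentiable)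
  with f b show "lin_span (\<lambda>h. \<exists>f\<in>schwartz. h = (\<lambda>x. c * f x)) (partial_deriv b h)"
    by (auto intro!: lin_span.base schwartz_partial_deriv)
qed (use assms in \<open>auto intro!: differentiable_mult rapidly_decreasing_cmult
       intro: schwartz_differentiable schwartz_rapidly_decreasing\<close>)

lemma schwartz_sum:
  assumes "finite I" "\<And>i. i \<in> I \<Longrightarrow> f i \<in> schwartz" "I \<noteq> {}"
  shows "(\<lambda>x. \<Sum>i\<in>I. f i x) \<in> schwartz"
  using assms(1,3,2)
proof (induction rule: finite_ne_induct)
  case (insert i I)
  then show ?case by (simp add: schwartz_add)
qed simp

lemma schwartz_mult:
  assumes "f \<in> schwartz" "g \<in> schwartz"
  shows "(\<lambda>x. f x * g x) \<in> schwartz"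
proof (rule schwartz_coinduct[where P = "\<lambda>h. \<exists>f\<in>schwartz. \<exists>g\<in>schwartz. h = (\<lambda>x. f x * g x)"])
  fix h :: "'a \<Rightarrow> complex" and b :: 'a
  assume "\<exists>f\<in>schwartz. \<exists>g\<in>schwartz. h = (\<lambda>x. f x * g x)" and b: "b \<in> Basis"
  then obtain f g where fg: "f \<in> schwartz" "g \<in> schwartz" "h = (\<lambda>x. f x * g x)" by blast
  then have "partial_deriv b h = (\<lambda>x. partial_deriv b f x * g x + f x * partial_deriv b g x)"
    by (auto intro!: ext partial_deriv_mult schwartz_differentiable)
  with fg b show "lin_span (\<lambda>h. \<exists>f\<in>schwartz. \<exists>g\<in>schwartz. h = (\<lambda>x. f x * g x)) (partial_deriv b h)"
    by (simp, intro lin_span.add; intro lin_span.base) (blast intro: schwartz_partial_deriv)+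
next
  fix h :: "'a \<Rightarrow> complex"
  assume "\<exists>f\<in>schwartz. \<exists>g\<in>schwartz. h = (\<lambda>x. f x * g x)"
  then obtain f g where fg: "f \<in> schwartz" "g \<in> schwartz" "h = (\<lambda>x. f x * g x)" by blast
  obtain B where "\<And>x. (1 + norm x) ^ 0 * cmod (f x) \<le> B" using schwartz_bound[OF fg(1)] by metis
  then show "rapidly_decreasing h" unfolding fg(3)
    using fg(2) by (intro rapidly_decreasing_mult[where k = 0 and K = B] schwartz_rapidly_decreasing) auto
qed (use assms in \<open>auto intro!: differentiable_mult intro: schwartz_differentiable\<close>)

lemma partial_deriv_inner:
  "partial_deriv b (\<lambda>x. complex_of_real (x \<bullet> c)) x = of_real (b \<bullet> c)"
  by (rule partial_deriv_eq) (auto intro!: derivative_eq_intros)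

lemma differentiable_inner_of_real: "(\<lambda>x. complex_of_real (x \<bullet> c)) differentiable (at x)"
  unfolding differentiable_def by (rule exI) (auto intro!: derivative_eq_intros)

lemma cmod_inner_le: "cmod (of_real (x \<bullet> c)) \<le> norm c * (1 + norm x) ^ 1"
proof -
  have "cmod (of_real (x \<bullet> c)) \<le> norm x * norm c" by (simp add: Cauchy_Schwarz_ineq2)
  then show ?thesis by (simp add: algebra_simps add_nonneg_nonneg add_increasing)
qed

lemma schwartz_inner_mult:
  assumes "f \<in> schwartz"
  shows "(\<lambda>x. complex_of_real (x \<bullet> c) * f x) \<in> schwartz"
proof (rule schwartz_coinduct[where P = "\<lambda>h. h \<in> schwartz \<or> (\<exists>f\<in>schwartz. h = (\<lambda>x. complex_of_real (x \<bullet> c) * f x))"])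
  fix h :: "'a \<Rightarrow> complex" and b :: 'a
  assume h: "h \<in> schwartz \<or> (\<exists>f\<in>schwartz. h = (\<lambda>x. complex_of_real (x \<bullet> c) * f x))" and b: "b \<in> Basis"
  show "lin_span (\<lambda>h. h \<in> schwartz \<or> (\<exists>f\<in>schwartz. h = (\<lambda>x. complex_of_real (x \<bullet> c) * f x))) (partial_deriv b h)"
  proof (cases "h \<in> schwartz")
    case True
    then show ?thesis using b by (intro lin_span.base) (simp add: schwartz_partial_deriv)
  next
    case False
    then obtain f where f: "f \<in> schwartz" "h = (\<lambda>x. complex_of_real (x \<bullet> c) * f x)" using h by blast
    then have "partial_deriv b h = (\<lambda>x. of_real (b \<bullet> c) * f x + complex_of_real (x \<bullet> c) * partial_deriv b f x)"
      by (auto intro!: ext simp: partial_deriv_mult schwartz_differentiable differentiable_inner_of_real partial_deriv_inner)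
    with f b show ?thesis
      by (simp, intro lin_span.add; intro lin_span.base) (blast intro: schwartz_partial_deriv schwartz_cmult)+
  qed
qed (use assms in \<open>auto intro!: differentiable_mult differentiable_inner_of_real rapidly_decreasing_mult[OF _ cmod_inner_le]
     intro: schwartz_differentiable schwartz_rapidly_decreasing\<close>)

lemma partial_deriv_affine:
  assumes "f differentiable (at (r *\<^sub>R x + m))"
  shows "partial_deriv b (\<lambda>x. f (r *\<^sub>R x + m)) x = r *\<^sub>R partial_deriv b f (r *\<^sub>R x + m)"
    "(\<lambda>x. f (r *\<^sub>R x + m)) differentiable (at x)"
proof -
  obtain f' where f': "(f has_derivative f') (at (r *\<^sub>R x + m))"
    using assms unfolding differentiable_def by blast
  have "((\<lambda>x. r *\<^sub>R x + m) has_derivative (\<lambda>v. r *\<^sub>R v)) (at x)"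
    by (auto intro!: derivative_eq_intros)
  from has_derivative_compose[OF this f']
  have *: "((\<lambda>x. f (r *\<^sub>R x + m)) has_derivative (\<lambda>v. f' (r *\<^sub>R v))) (at x)" .
  show "partial_deriv b (\<lambda>x. f (r *\<^sub>R x + m)) x = r *\<^sub>R partial_deriv b f (r *\<^sub>R x + m)"
    using partial_deriv_eq[OF *, of b] partial_deriv_eq[OF f', of b] has_derivative_bounded_linear[OF f']
    by (simp add: linear_simps)
  show "(\<lambda>x. f (r *\<^sub>R x + m)) differentiable (at x)"
    using * by (rule differentiableI)
qed

lemma schwartz_affine:
  fixes f :: "'a::euclidean_space \<Rightarrow> complex"
  assumes "f \<in> schwartz" "r \<noteq> 0"
  shows "(\<lambda>x. f (r *\<^sub>R x + m)) \<in> schwartz"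
proof (rule schwartz_coinduct[where P = "\<lambda>h. \<exists>f\<in>schwartz. h = (\<lambda>x. f (r *\<^sub>R x + m))"])
  fix h :: "'a \<Rightarrow> complex" and b :: 'a
  assume "\<exists>f\<in>schwartz. h = (\<lambda>x. f (r *\<^sub>R x + m))" and b: "b \<in> Basis"
  then obtain f where f: "f \<in> schwartz" "h = (\<lambda>x. f (r *\<^sub>R x + m))" by blast
  then have "partial_deriv b h = (\<lambda>x. of_real r * partial_deriv b f (r *\<^sub>R x + m))"
    by (auto simp: partial_deriv_affine schwartz_differentiable scaleR_conv_of_real)
  moreover have "lin_span (\<lambda>h. \<exists>f\<in>schwartz. h = (\<lambda>x. f (r *\<^sub>R x + m))) (\<lambda>x. partial_deriv b f (r *\<^sub>R x + m))"
    using f b schwartz_partial_deriv by (intro lin_span.base) blast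
  ultimately show "lin_span (\<lambda>h. \<exists>f\<in>schwartz. h = (\<lambda>x. f (r *\<^sub>R x + m))) (partial_deriv b h)"
    by (simp add: lin_span.scale)
next
  fix h :: "'a \<Rightarrow> complex"
  assume "\<exists>f\<in>schwartz. h = (\<lambda>x. f (r *\<^sub>R x + m))"
  then obtain f where f: "f \<in> schwartz" "h = (\<lambda>x. f (r *\<^sub>R x + m))" by blast
  show "rapidly_decreasing h" unfolding rapidly_decreasing_def
  proof
    fix N
    obtain B where B: "B > 0" "\<And>x. (1 + norm x) ^ N * cmod (f x) \<le> B" by (rule schwartz_bound[OF f(1)]) blast
    define K where "K = (1 + 1 / \<bar>r\<bar>) * (1 + norm m)"
    have K: "1 + norm x \<le> K * (1 + norm (r *\<^sub>R x + m))" for x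
    proof -
      have "norm x = norm (r *\<^sub>R x) / \<bar>r\<bar>" using assms by simp
      then have "1 + norm x \<le> (1 + 1 / \<bar>r\<bar>) * (1 + norm (r *\<^sub>R x))" by (simp add: algebra_simps)
      also have "\<dots> \<le> (1 + 1 / \<bar>r\<bar>) * ((1 + norm (r *\<^sub>R x + m)) * (1 + norm m))"
        by (intro mult_left_mono one_plus_norm_le_shift) auto
      finally show ?thesis by (simp add: K_def mult_ac)
    qed
    have "(1 + norm x) ^ N * cmod (h x) \<le> K ^ N * B" for x
    proof -
      have "(1 + norm x) ^ N * cmod (h x) \<le> (K * (1 + norm (r *\<^sub>R x + m))) ^ N * cmod (h x)"
        by (intro mult_right_mono power_mono K) auto
      also have "\<dots> = K ^ N * ((1 + norm (r *\<^sub>R x + m)) ^ N * cmod (f (r *\<^sub>R x + m)))"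
        by (simp add: f(2) power_mult_distrib)
      also have "\<dots> \<le> K ^ N * B" by (intro mult_left_mono B) (auto simp: K_def)
      finally show ?thesis .
    qed
    then show "\<exists>B. \<forall>x. (1 + norm x) ^ N * cmod (h x) \<le> B" by blast
  qed
qed (use assms in \<open>auto intro!: partial_deriv_affine(2) intro: schwartz_differentiable\<close>)

lemma has_derivative_cis_inner:
  "((\<lambda>x. cis (r * (x \<bullet> u))) has_derivative (\<lambda>v. (\<i> * of_real (r * (v \<bullet> u))) * cis (r * (x \<bullet> u)))) (at x)"
proof -
  have "((\<lambda>x. \<i> * of_real (r * (x \<bullet> u))) has_derivative (\<lambda>v. \<i> * of_real (r * (v \<bullet> u)))) (at x)"
    by (intro derivative_eq_intros) auto
  from has_derivative_compose[OF this DERIV_exp[unfolded has_field_derivative_def]] show ?thesis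
    unfolding cis_conv_exp by (simp only: mult.commute[of "exp _"] of_real_mult mult.assoc)
qed

lemma differentiable_cis_inner: "(\<lambda>x. cis (r * (x \<bullet> u))) differentiable (at x)"
  using has_derivative_cis_inner by (rule differentiableI)

lemma partial_deriv_cis_inner:
  "partial_deriv b (\<lambda>x. cis (r * (x \<bullet> u))) x = (\<i> * of_real (r * (b \<bullet> u))) * cis (r * (x \<bullet> u))"
  by (rule partial_deriv_eq[OF has_derivative_cis_inner])

lemma partial_deriv_modulation:
  assumes "f \<in> schwartz"
  shows "partial_deriv b (\<lambda>x. f x * cis (r * (x \<bullet> u)))
    = (\<lambda>x. partial_deriv b f x * cis (r * (x \<bullet> u)) + (\<i> * of_real (r * (b \<bullet> u))) * (f x * cis (r * (x \<bullet> u))))"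
  using assms by (intro ext)
    (auto simp: partial_deriv_mult schwartz_differentiable differentiable_cis_inner partial_deriv_cis_inner mult_ac)

lemma schwartz_modulation:
  assumes "f \<in> schwartz"
  shows "(\<lambda>x. f x * cis (r * (x \<bullet> u))) \<in> schwartz"
proof (rule schwartz_coinduct[where P = "\<lambda>h. \<exists>f\<in>schwartz. h = (\<lambda>x. f x * cis (r * (x \<bullet> u)))"])
  fix h :: "'a \<Rightarrow> complex" and b :: 'a
  assume "\<exists>f\<in>schwartz. h = (\<lambda>x. f x * cis (r * (x \<bullet> u)))" and b: "b \<in> Basis"
  then obtain f where f: "f \<in> schwartz" "h = (\<lambda>x. f x * cis (r * (x \<bullet> u)))" by blast
  from f b show "lin_span (\<lambda>h. \<exists>f\<in>schwartz. h = (\<lambda>x. f x * cis (r * (x \<bullet> u)))) (partial_deriv b h)"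
    unfolding f(2) partial_deriv_modulation[OF f(1)]
    by (intro lin_span.add lin_span.scale; intro lin_span.base) (auto intro: schwartz_partial_deriv)
next
  fix h :: "'a \<Rightarrow> complex"
  assume "\<exists>f\<in>schwartz. h = (\<lambda>x. f x * cis (r * (x \<bullet> u)))"
  then obtain f where f: "f \<in> schwartz" "h = (\<lambda>x. f x * cis (r * (x \<bullet> u)))" by blast
  then show "rapidly_decreasing h"
    using schwartz_rapidly_decreasing[OF f(1)] by (simp add: rapidly_decreasing_def norm_mult)
qed (use assms in \<open>auto intro!: differentiable_mult differentiable_cis_inner intro: schwartz_differentiable\<close>)

text \<open>
  The growing factor is compared with a single term of the exponential series of \<open>c r\<^sup>2\<close>.
\<close>

lemma rapidly_decreasing_gaussian:
  assumes "c > 0"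
  shows "rapidly_decreasing (\<lambda>x. complex_of_real (exp (- c * (norm x)\<^sup>2)))"
  unfolding rapidly_decreasing_def
proof
  fix N :: nat
  have "(1 + r) ^ N * exp (- c * r\<^sup>2) \<le> 2 ^ N * (1 + fact N / c ^ N)" if "r \<ge> 0" for r :: real
  proof -
    have "(1 + r) ^ N \<le> (2 * max 1 r) ^ N" using that by (intro power_mono) auto
    also have "\<dots> = 2 ^ N * max 1 r ^ N" by (simp add: power_mult_distrib)
    also have "\<dots> \<le> 2 ^ N * (1 + (r\<^sup>2) ^ N)"
    proof (intro mult_left_mono)
      show "max 1 r ^ N \<le> 1 + (r\<^sup>2) ^ N"
      proof (cases "r \<le> 1")
        case False
        then have "r ^ N \<le> (r\<^sup>2) ^ N" by (intro power_mono) (auto simp: power2_eq_square)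
        with False show ?thesis by (simp add: max_def)
      qed (simp add: max_def)
    qed auto
    finally have 1: "(1 + r) ^ N \<le> 2 ^ N * (1 + (r\<^sup>2) ^ N)" .
    have "(c * r\<^sup>2) ^ N / fact N \<le> exp (c * r\<^sup>2)"
    proof -
      have "(\<Sum>n\<in>{N}. (c * r\<^sup>2) ^ n /\<^sub>R fact n) \<le> (\<Sum>n. (c * r\<^sup>2) ^ n /\<^sub>R fact n)"
        using assms by (intro sum_le_suminf summable_exp_generic) auto
      then show ?thesis by (simp add: exp_def divide_inverse mult.commute)
    qed
    then have 2: "(r\<^sup>2) ^ N \<le> fact N / c ^ N * exp (c * r\<^sup>2)"
      using assms by (simp add: field_simps)
    have "(1 + r) ^ N * exp (- c * r\<^sup>2) \<le> 2 ^ N * (1 + fact N / c ^ N * exp (c * r\<^sup>2)) * exp (- c * r\<^sup>2)"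
      using 1 2 by (intro mult_right_mono order_trans[OF 1] mult_left_mono) auto
    also have "\<dots> = 2 ^ N * (exp (- c * r\<^sup>2) + fact N / c ^ N)"
      by (simp add: algebra_simps exp_minus)
    also have "\<dots> \<le> 2 ^ N * (1 + fact N / c ^ N)"
      using assms by (intro mult_left_mono) auto
    finally show ?thesis .
  qed
  from this[OF norm_ge_zero]
  show "\<exists>B. \<forall>x. (1 + norm x) ^ N * cmod (complex_of_real (exp (- c * (norm x)\<^sup>2))) \<le> B"
    by (intro exI allI) (simp only: norm_of_real abs_exp_cancel)
qed

text \<open>
  The derivatives of a Gaussian are combinations of Gaussians times monomials, so the monomials
  have to belong to the class on which the coinduction runs.
\<close>

inductive hermite_term :: "real \<Rightarrow> ('a::euclidean_space \<Rightarrow> complex) \<Rightarrow> bool" for c where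
  gaussian: "hermite_term c (\<lambda>x. of_real (exp (- c * (norm x)\<^sup>2)))"
| mult: "hermite_term c f \<Longrightarrow> hermite_term c (\<lambda>x. of_real (x \<bullet> b) * f x)"

lemma has_derivative_gaussian:
  "((\<lambda>x. complex_of_real (exp (- c * (norm x)\<^sup>2))) has_derivative
     (\<lambda>v. of_real (- 2 * c * (x \<bullet> v)) * of_real (exp (- c * (norm x)\<^sup>2)))) (at x)"
  unfolding power2_norm_eq_inner by (auto intro!: derivative_eq_intros simp: inner_commute mult_ac)

lemma schwartz_gaussian:
  assumes "c > 0"
  shows "(\<lambda>x::'a::euclidean_space. complex_of_real (exp (- c * (norm x)\<^sup>2))) \<in> schwartz"
proof (rule schwartz_coinduct[where P = "hermite_term c"])
  fix f :: "'a \<Rightarrow> complex"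
  assume "hermite_term c f"
  then have *: "(\<forall>x. f differentiable (at x)) \<and> rapidly_decreasing f \<and> (\<forall>b\<in>Basis. lin_span (hermite_term c) (partial_deriv b f))"
  proof induction
    case gaussian
    have "lin_span (hermite_term c) (partial_deriv b (\<lambda>x. of_real (exp (- c * (norm x)\<^sup>2))))" for b :: 'a
    proof -
      have "partial_deriv b (\<lambda>x. of_real (exp (- c * (norm x)\<^sup>2)))
         = (\<lambda>x. of_real (- 2 * c) * (of_real (x \<bullet> b) * complex_of_real (exp (- c * (norm x)\<^sup>2))))"
        by (subst partial_deriv_eq[OF has_derivative_gaussian, abs_def]) (auto simp: mult_ac)
      then show ?thesis
        by (simp only:) (intro lin_span.scale lin_span.base hermite_term.intros)
    qed
    then show ?case
      using has_derivative_gaussian rapidly_decreasing_gaussian[OF assms] differentiableI by blast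
  next
    case (mult f b')
    have "lin_span (hermite_term c) (partial_deriv b (\<lambda>x. of_real (x \<bullet> b') * f x))" if "b \<in> Basis" for b :: 'a
    proof -
      have "partial_deriv b (\<lambda>x. of_real (x \<bullet> b') * f x)
         = (\<lambda>x. of_real (b \<bullet> b') * f x + of_real (x \<bullet> b') * partial_deriv b f x)"
        using mult by (intro ext) (simp add: partial_deriv_mult differentiable_inner_of_real partial_deriv_inner)
      then show ?thesis using mult that
        by (auto intro!: lin_span.add lin_span.scale[of _ f] lin_span_mult[of _ "partial_deriv b f"]
             intro: lin_span.base hermite_term.mult)
    qed
    then show ?case using mult
      by (auto intro!: differentiable_mult differentiable_inner_of_real rapidly_decreasing_mult[OF _ cmod_inner_le])
  qed
  show "f differentiable (at x)" for x using * by blast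
  show "rapidly_decreasing f" using * by blast
  show "lin_span (hermite_term c) (partial_deriv b f)" if "b \<in> Basis" for b using * that by blast
qed (rule hermite_term.gaussian)

text \<open>
  Integration by parts yields decay in one coordinate at a time. At every point the largest
  coordinate controls the norm up to the dimension.
\<close>

lemma rapidly_decreasing_coordI:
  fixes f :: "'a::euclidean_space \<Rightarrow> complex"
  assumes "\<And>n b. b \<in> Basis \<Longrightarrow> \<exists>B. \<forall>x. \<bar>x \<bullet> b\<bar> ^ n * cmod (f x) \<le> B"
  shows "rapidly_decreasing f"
  unfolding rapidly_decreasing_def
proof
  fix N
  obtain B where B: "\<And>n b x. b \<in> Basis \<Longrightarrow> \<bar>x \<bullet> b\<bar> ^ n * cmod (f x) \<le> B n b"
  proof -
    have "\<forall>n b. \<exists>B. b \<in> Basis \<longrightarrow> (\<forall>x. \<bar>x \<bullet> b\<bar> ^ n * cmod (f x) \<le> B)" using assms by blast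
    then obtain B where "\<forall>n b. b \<in> Basis \<longrightarrow> (\<forall>x. \<bar>x \<bullet> b\<bar> ^ n * cmod (f x) \<le> B n b)" by metis
    then show ?thesis by (intro that) blast
  qed
  define d where "d = real DIM('a)"
  have "(1 + norm x) ^ N * cmod (f x) \<le> (1 + d) ^ N * (\<Sum>b\<in>Basis. B 0 b + B N b)" for x
  proof -
    have ne: "(\<lambda>b. \<bar>x \<bullet> b\<bar>) ` Basis \<noteq> {}" by auto
    obtain b where b: "b \<in> Basis" "Max ((\<lambda>b. \<bar>x \<bullet> b\<bar>) ` Basis) = \<bar>x \<bullet> b\<bar>"
      using Max_in[OF _ ne] by (metis (no_types, lifting) finite_Basis finite_imageI imageE)
    then have le: "\<And>b'. b' \<in> Basis \<Longrightarrow> \<bar>x \<bullet> b'\<bar> \<le> \<bar>x \<bullet> b\<bar>" by (metis Max_ge finite_Basis finite_imageI imageI)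
    have "norm x \<le> (\<Sum>b\<in>Basis. \<bar>x \<bullet> b\<bar>)" by (rule norm_le_l1)
    also have "\<dots> \<le> d * \<bar>x \<bullet> b\<bar>" using sum_bounded_above[OF le, of Basis] by (simp add: d_def)
    finally have "1 + norm x \<le> (1 + d) * max 1 \<bar>x \<bullet> b\<bar>"
    proof -
      assume a: "norm x \<le> d * \<bar>x \<bullet> b\<bar>"
      have "d * \<bar>x \<bullet> b\<bar> \<le> d * max 1 \<bar>x \<bullet> b\<bar>" by (intro mult_left_mono) (auto simp: d_def)
      then show ?thesis using a by (simp add: algebra_simps)
    qed
    then have "(1 + norm x) ^ N * cmod (f x) \<le> ((1 + d) * max 1 \<bar>x \<bullet> b\<bar>) ^ N * cmod (f x)"
      by (intro mult_right_mono power_mono) auto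
    also have "\<dots> = (1 + d) ^ N * (max 1 \<bar>x \<bullet> b\<bar> ^ N * cmod (f x))" by (simp add: power_mult_distrib)
    also have "max 1 \<bar>x \<bullet> b\<bar> ^ N * cmod (f x) \<le> B 0 b + B N b"
      using B[OF b(1), of x 0] B[OF b(1), of x N] order_trans[OF _ B[OF b(1), of x 0]] order_trans[OF _ B[OF b(1), of x N]]
      by (auto simp: max_def add_increasing add_increasing2)
    also have "B 0 b + B N b \<le> (\<Sum>b\<in>Basis. B 0 b + B N b)"
      using b(1)
    proof (intro member_le_sum)
      fix b' assume "b' \<in> Basis - {b}"
      then show "0 \<le> B 0 b' + B N b'"
        using order_trans[OF _ B[of b' 0 0]] order_trans[OF _ B[of b' 0 N]] by (auto intro!: add_nonneg_nonneg)
    qed auto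
    finally show ?thesis by (simp add: d_def mult_left_mono)
  qed
  then show "\<exists>B. \<forall>x. (1 + norm x) ^ N * cmod (f x) \<le> B" by blast
qed

section \<open>Integrability and differentiation under the integral sign\<close>

text \<open>
  The square of \<open>1 + norm x\<close> dominates \<open>1 + (x \<bullet> b)\<^sup>2\<close> for each of the coordinates, and the
  product of the functions \<open>1 / (1 + (x \<bullet> b)\<^sup>2)\<close> is integrable by Tonelli.
\<close>

lemma integrable_inverse_one_plus_norm:
  "integrable lborel (\<lambda>x::'a::euclidean_space. 1 / (1 + norm x) ^ (2 * DIM('a)))"
proof (rule integrableI_bounded)
  have le: "norm (1 / (1 + norm x) ^ (2 * DIM('a))) \<le> (\<Prod>b\<in>Basis. inverse (1 + (x \<bullet> b)\<^sup>2))" for x :: 'a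
  proof -
    have "(\<Prod>b\<in>Basis. 1 + (x \<bullet> b)\<^sup>2) \<le> (\<Prod>b\<in>(Basis::'a set). (1 + norm x)\<^sup>2)"
    proof (intro prod_mono conjI)
      fix b :: 'a assume "b \<in> Basis"
      then have "(x \<bullet> b)\<^sup>2 \<le> (norm x)\<^sup>2"
        using Basis_le_norm[of b x] by (metis abs_ge_zero power2_abs power_mono)
      then show "1 + (x \<bullet> b)\<^sup>2 \<le> (1 + norm x)\<^sup>2"
        using norm_ge_zero[of x] unfolding power2_sum one_power2 by linarith
    qed (simp add: add_nonneg_nonneg)
    also have "\<dots> = (1 + norm x) ^ (2 * DIM('a))" by (simp add: power_mult)
    finally have *: "(\<Prod>b\<in>Basis. 1 + (x \<bullet> b)\<^sup>2) \<le> (1 + norm x) ^ (2 * DIM('a))" .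
    have "inverse ((1 + norm x) ^ (2 * DIM('a))) \<le> inverse (\<Prod>b\<in>Basis. 1 + (x \<bullet> b)\<^sup>2)"
      by (rule le_imp_inverse_le[OF *]) (auto intro!: prod_pos add_pos_nonneg)
    then show ?thesis by (simp add: prod_inversef[symmetric] comp_def divide_inverse)
  qed
  have "(\<integral>\<^sup>+(x::'a). norm (1 / (1 + norm x) ^ (2 * DIM('a))) \<partial>lborel)
     \<le> (\<integral>\<^sup>+(x::'a). ennreal (\<Prod>b\<in>Basis. inverse (1 + (x \<bullet> b)\<^sup>2)) \<partial>lborel)"
    by (intro nn_integral_mono ennreal_leI le)
  also have "\<dots> = (\<integral>\<^sup>+(x::'a). (\<Prod>b\<in>Basis. ennreal (inverse (1 + (x \<bullet> b)\<^sup>2))) \<partial>lborel)"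
    by (intro nn_integral_cong prod_ennreal[symmetric]) (auto intro!: add_nonneg_nonneg)
  also have "\<dots> = (\<Prod>b\<in>(Basis::'a set). \<integral>\<^sup>+x. ennreal (inverse (1 + x\<^sup>2)) \<partial>lborel)"
    by (subst nn_integral_lborel_prod) auto
  also have "\<dots> < \<infinity>"
  proof -
    have "integrable lborel (\<lambda>x::real. inverse (1 + x\<^sup>2))"
      using integrable_inverse_1_plus_square by (simp add: set_integrable_def)
    then have "(\<integral>\<^sup>+(x::real). ennreal (inverse (1 + x\<^sup>2)) \<partial>lborel) < \<infinity>"
      by (simp add: integrable_iff_bounded)
    then show ?thesis by (simp add: power_less_top_ennreal)
  qed
  finally show "(\<integral>\<^sup>+(x::'a). norm (1 / (1 + norm x) ^ (2 * DIM('a))) \<partial>lborel) < \<infinity>" .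
qed simp

lemma integrable_polynomial_decay:
  fixes f :: "'a::euclidean_space \<Rightarrow> complex"
  assumes "f \<in> borel_measurable borel" "\<And>x. (1 + norm x) ^ (2 * DIM('a)) * cmod (f x) \<le> B"
  shows "integrable lborel f"
    "(LINT x|lborel. cmod (f x)) \<le> B * (LINT x::'a|lborel. 1 / (1 + norm x) ^ (2 * DIM('a)))"
proof -
  have le: "cmod (f x) \<le> B * (1 / (1 + norm x) ^ (2 * DIM('a)))" for x
    using assms(2)[of x] by (subst mult.commute) (simp add: field_simps add_pos_nonneg)
  have int: "integrable lborel (\<lambda>x::'a. B * (1 / (1 + norm x) ^ (2 * DIM('a))))"
    using integrable_inverse_one_plus_norm by (rule integrable_mult_right)
  show f: "integrable lborel f"
    using assms(1) le by (intro Bochner_Integration.integrable_bound[OF int])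
      (simp, intro always_eventually allI, simp only: real_norm_def, rule order_trans[OF le abs_ge_self])
  show "(LINT x|lborel. cmod (f x)) \<le> B * (LINT x::'a|lborel. 1 / (1 + norm x) ^ (2 * DIM('a)))"
    unfolding integral_mult_right_zero[symmetric] using f le
    by (intro integral_mono int) auto
qed

lemma integrable_rapidly_decreasing:
  fixes f :: "'a::euclidean_space \<Rightarrow> complex"
  assumes "f \<in> borel_measurable borel" "rapidly_decreasing f"
  shows "integrable lborel f"
proof -
  obtain B where "\<And>x. (1 + norm x) ^ (2 * DIM('a)) * cmod (f x) \<le> B"
    using assms(2) unfolding rapidly_decreasing_def by metis
  with assms(1) show ?thesis by (rule integrable_polynomial_decay)
qed

lemma borel_measurable_schwartz: "f \<in> schwartz \<Longrightarrow> f \<in> borel_measurable borel"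
  by (intro borel_measurable_continuous_onI smooth_continuous_on schwartz_smooth)

lemma integrable_schwartz: "f \<in> schwartz \<Longrightarrow> integrable lborel f"
  by (intro integrable_rapidly_decreasing borel_measurable_schwartz schwartz_rapidly_decreasing)

lemma lborel_integral_affine:
  fixes f :: "'a::euclidean_space \<Rightarrow> 'b::{banach, second_countable_topology}"
  assumes [measurable]: "f \<in> borel_measurable borel" and c: "c \<noteq> 0"
  shows "(LINT x|lborel. f (t + c *\<^sub>R x)) = (1 / \<bar>c\<bar> ^ DIM('a)) *\<^sub>R (LINT x|lborel. f x)"
    and "integrable lborel f \<Longrightarrow> integrable lborel (\<lambda>x. f (t + c *\<^sub>R x))"
proof -
  have "(LINT x|lborel. f x) = (\<bar>c\<bar> ^ DIM('a)) *\<^sub>R (LINT x|lborel. f (t + c *\<^sub>R x))"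
    by (subst lborel_affine[OF c, of t]) (simp add: integral_density integral_distr)
  then show "(LINT x|lborel. f (t + c *\<^sub>R x)) = (1 / \<bar>c\<bar> ^ DIM('a)) *\<^sub>R (LINT x|lborel. f x)"
    using c by simp
  assume "integrable lborel f"
  then have "integrable (density (distr lborel borel (\<lambda>x. t + c *\<^sub>R x)) (\<lambda>_. ennreal (\<bar>c\<bar> ^ DIM('a)))) f"
    using lborel_affine[OF c, of t] by simp
  then show "integrable lborel (\<lambda>x. f (t + c *\<^sub>R x))"
    using c integrable_scaleR_right[of "inverse (\<bar>c\<bar> ^ DIM('a))" lborel "\<lambda>x. \<bar>c\<bar> ^ DIM('a) *\<^sub>R f (t + c *\<^sub>R x)"]
    by (simp add: integrable_density integrable_distr_eq)
qed

lemma lborel_integral_translate: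
  fixes f :: "'a::euclidean_space \<Rightarrow> 'b::{banach, second_countable_topology}"
  assumes [measurable]: "f \<in> borel_measurable borel"
  shows "(LINT x|lborel. f (x + t)) = (LINT x|lborel. f x)"
    and "integrable lborel f \<Longrightarrow> integrable lborel (\<lambda>x. f (x + t))"
  using lborel_integral_affine[OF assms, of 1 t] by (simp_all add: add.commute)

lemma lborel_integral_reflect:
  fixes f :: "'a::euclidean_space \<Rightarrow> 'b::{banach, second_countable_topology}"
  assumes [measurable]: "f \<in> borel_measurable borel"
  shows "(LINT x|lborel. f (t - x)) = (LINT x|lborel. f x)"
    and "integrable lborel f \<Longrightarrow> integrable lborel (\<lambda>x. f (t - x))"
  using lborel_integral_affine[OF assms, of "-1" t] by simp_all

text \<open>
  By the mean value inequality the first-order remainders, divided by the increment, are dominated by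
  \<open>2 g\<close>, so dominated convergence applies along every sequence tending to \<open>x\<close>. The derivative is measurable in the
  integration variable because it is a limit of difference quotients.
\<close>

lemma has_derivative_integral:
  fixes f :: "'b \<Rightarrow> 'a::euclidean_space \<Rightarrow> complex"
  assumes int: "\<And>y. y \<in> ball x 1 \<Longrightarrow> integrable M (\<lambda>t. f t y)"
    and deriv: "\<And>t y. y \<in> ball x 1 \<Longrightarrow> (f t has_derivative f' t y) (at y)"
    and bound: "\<And>t y v. y \<in> ball x 1 \<Longrightarrow> cmod (f' t y v) \<le> g t * norm v"
    and g: "integrable M g"
  shows "((\<lambda>x. LINT t|M. f t x) has_derivative (\<lambda>v. LINT t|M. f' t x v)) (at x)"
    and "integrable M (\<lambda>t. f' t x v)"
proof -
  have x: "x \<in> ball x 1" by simp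
  have bl: "bounded_linear (f' t x)" for t using deriv[OF x] by (rule has_derivative_bounded_linear)
  have meas: "(\<lambda>t. f' t x v) \<in> borel_measurable M" for v
  proof (cases "v = 0")
    case True
    then show ?thesis using bl by (simp add: linear_simps)
  next
    case False
    \<comment> \<open>The offset 2 keeps every step inside the unit ball in which the derivative is controlled.\<close>
    define h where "h n = 1 / (norm v * (real n + 2))" for n
    have h: "h n > 0" "norm (h n *\<^sub>R v) < 1" for n
    proof -
      show "h n > 0" using False by (simp add: h_def)
      have "norm (h n *\<^sub>R v) = 1 / (real n + 2)" using False by (simp add: h_def)
      then show "norm (h n *\<^sub>R v) < 1" by simp
    qed
    have h0: "h \<longlonglongrightarrow> 0" unfolding h_def using False by real_asymp
    show ?thesis
    proof (rule borel_measurable_LIMSEQ_metric)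
      show "(\<lambda>t. (f t (x + h n *\<^sub>R v) - f t x) /\<^sub>R h n) \<in> borel_measurable M" for n
        using int[OF x] int[of "x + h n *\<^sub>R v"] h[of n]
        by (intro borel_measurable_scaleR borel_measurable_diff borel_measurable_const)
           (auto simp: dist_norm)
      fix t
      have "((\<lambda>s. x + s *\<^sub>R v) has_derivative (\<lambda>s. s *\<^sub>R v)) (at 0)"
        by (auto intro!: derivative_eq_intros)
      from has_derivative_compose[OF this, of "f t" "f' t x"] deriv[OF x]
      have "((\<lambda>s. f t (x + s *\<^sub>R v)) has_derivative (\<lambda>s. f' t x (s *\<^sub>R v))) (at 0)" by simp
      moreover have "(\<lambda>s. f' t x (s *\<^sub>R v)) = (\<lambda>s. s *\<^sub>R f' t x v)"
        using bl by (simp add: linear_simps)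
      ultimately have "((\<lambda>s. f t (x + s *\<^sub>R v)) has_vector_derivative f' t x v) (at 0)"
        by (simp add: has_vector_derivative_def)
      then have "((\<lambda>s. norm (f t (x + s *\<^sub>R v) - f t x - s *\<^sub>R f' t x v) / norm s) \<longlongrightarrow> 0) (at 0)"
        unfolding has_vector_derivative_def has_derivative_at by simp
      then have "((\<lambda>s. norm ((f t (x + s *\<^sub>R v) - f t x) /\<^sub>R s - f' t x v)) \<longlongrightarrow> 0) (at 0)"
      proof (rule Lim_transform_eventually)
        have "norm (f t (x + s *\<^sub>R v) - f t x - s *\<^sub>R f' t x v) / norm s
            = norm ((f t (x + s *\<^sub>R v) - f t x) /\<^sub>R s - f' t x v)" if "s \<noteq> 0" for s
        proof -
          have "(f t (x + s *\<^sub>R v) - f t x) /\<^sub>R s - f' t x v = (f t (x + s *\<^sub>R v) - f t x - s *\<^sub>R f' t x v) /\<^sub>R s"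
            using that by (simp add: scaleR_diff_right)
          then show ?thesis by (simp add: divide_inverse mult.commute)
        qed
        then show "\<forall>\<^sub>F s in at 0. norm (f t (x + s *\<^sub>R v) - f t x - s *\<^sub>R f' t x v) / norm s
            = norm ((f t (x + s *\<^sub>R v) - f t x) /\<^sub>R s - f' t x v)"
          by (auto simp: eventually_at_filter)
      qed
      then have "((\<lambda>s. (f t (x + s *\<^sub>R v) - f t x) /\<^sub>R s) \<longlongrightarrow> f' t x v) (at 0)"
        by (rule LIM_zero_cancel[OF tendsto_norm_zero_cancel])
      moreover have "filterlim h (at 0) sequentially"
        using h0 h(1) by (auto simp: filterlim_at less_imp_neq[symmetric] intro!: always_eventually)
      ultimately show "(\<lambda>n. (f t (x + h n *\<^sub>R v) - f t x) /\<^sub>R h n) \<longlonglongrightarrow> f' t x v"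
        by (rule filterlim_compose)
    qed
  qed
  show intf': "integrable M (\<lambda>t. f' t x v)" for v
  proof (rule Bochner_Integration.integrable_bound)
    show "integrable M (\<lambda>t. g t * norm v)" using g by simp
    show "AE t in M. norm (f' t x v) \<le> norm (g t * norm v)"
      using bound[OF x] by (intro always_eventually allI) (smt (verit) real_norm_def)
  qed (rule meas)
  show "((\<lambda>x. LINT t|M. f t x) has_derivative (\<lambda>v. LINT t|M. f' t x v)) (at x)"
    unfolding has_derivative_iff_norm
  proof
    show "bounded_linear (\<lambda>v. LINT t|M. f' t x v)"
    proof (rule bounded_linear_intro[where K = "LINT t|M. g t"])
      show "norm (LINT t|M. f' t x v) \<le> norm v * (LINT t|M. g t)" for v
      proof -
        have "norm (LINT t|M. f' t x v) \<le> (LINT t|M. g t * norm v)"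
          by (intro integral_norm_bound[THEN order_trans] integral_mono integrable_norm intf' integrable_mult_left g bound[OF x])
        then show ?thesis by (simp add: mult.commute)
      qed
      show "(LINT t|M. f' t x (v + w)) = (LINT t|M. f' t x v) + (LINT t|M. f' t x w)" for v w
        unfolding bounded_linear.axioms(1)[OF bl, THEN linear_add] by (intro Bochner_Integration.integral_add intf')
      show "(LINT t|M. f' t x (r *\<^sub>R v)) = r *\<^sub>R (LINT t|M. f' t x v)" for r v
        unfolding bounded_linear.axioms(1)[OF bl, THEN linear_cmul] by (rule integral_scaleR_right)
    qed
    show "((\<lambda>y. norm ((LINT t|M. f t y) - (LINT t|M. f t x) - (LINT t|M. f' t x (y - x))) / norm (y - x)) \<longlongrightarrow> 0) (at x)"
      unfolding tendsto_at_iff_sequentially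
    proof (intro allI impI)
      fix X :: "nat \<Rightarrow> 'a" assume X: "\<forall>i. X i \<in> UNIV - {x}" "X \<longlonglongrightarrow> x"
      obtain N where N: "\<And>n. n \<ge> N \<Longrightarrow> X n \<in> ball x 1"
        using X(2)[THEN LIMSEQ_D, of 1] by (auto simp: dist_norm norm_minus_commute)
      define Y where "Y n = X (n + N)" for n
      have Y: "Y n \<noteq> x" "Y n \<in> ball x 1" for n using X(1) N by (auto simp: Y_def)
      have Yx: "Y \<longlonglongrightarrow> x" unfolding Y_def using X(2) by (rule LIMSEQ_ignore_initial_segment)
      define R where "R n t = (f t (Y n) - f t x - f' t x (Y n - x)) /\<^sub>R norm (Y n - x)" for n t
      have R_int: "integrable M (R n)" for n
        unfolding R_def using int Y x intf' by (intro integrable_scaleR_right integrable_diff) auto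
      have "(\<lambda>n. LINT t|M. R n t) \<longlonglongrightarrow> (LINT t|M. 0)"
      proof (rule integral_dominated_convergence)
        show "R n \<in> borel_measurable M" for n using R_int by (rule borel_measurable_integrable)
        show "integrable M (\<lambda>t. 2 * g t)" using g by simp
        show "AE t in M. (\<lambda>n. R n t) \<longlonglongrightarrow> 0"
        proof (intro always_eventually allI)
          fix t
          have "((\<lambda>y. norm (f t y - f t x - f' t x (y - x)) / norm (y - x)) \<longlongrightarrow> 0) (at x)"
            using deriv[OF x, of t] unfolding has_derivative_iff_norm by blast
          moreover have "filterlim Y (at x) sequentially"
            using Yx Y(1) by (auto simp: filterlim_at intro!: always_eventually)
          ultimately have "(\<lambda>n. norm (f t (Y n) - f t x - f' t x (Y n - x)) / norm (Y n - x)) \<longlonglongrightarrow> 0"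
            by (rule filterlim_compose)
          then show "(\<lambda>n. R n t) \<longlonglongrightarrow> 0"
            by (intro tendsto_norm_zero_cancel[of "\<lambda>n. R n t"]) (simp add: R_def divide_inverse mult.commute)
        qed
        show "AE t in M. norm (R n t) \<le> 2 * g t" for n
        proof (intro always_eventually allI)
          fix t
          have "norm (f t (Y n) - f t x) \<le> g t * norm (Y n - x)"
            by (rule differentiable_bound[of "ball x 1" _ "f' t"],
                 rule convex_ball, rule has_derivative_at_withinI, rule deriv, assumption,
                 rule onorm_le, rule bound, assumption, rule Y, rule x)
          then have "norm (f t (Y n) - f t x - f' t x (Y n - x)) \<le> 2 * g t * norm (Y n - x)"
            using bound[OF x, of t "Y n - x"] norm_triangle_ineq4[of "f t (Y n) - f t x" "f' t x (Y n - x)"]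
            by linarith
          then show "norm (R n t) \<le> 2 * g t"
            using Y(1)[of n] unfolding R_def norm_scaleR by (simp add: field_simps)
        qed
      qed simp
      then have "(\<lambda>n. norm (LINT t|M. R n t)) \<longlonglongrightarrow> 0" by (simp add: tendsto_norm_zero)
      moreover have "norm (LINT t|M. R n t) = norm ((LINT t|M. f t (Y n)) - (LINT t|M. f t x) - (LINT t|M. f' t x (Y n - x))) / norm (Y n - x)" for n
      proof -
        have "(LINT t|M. R n t) = (LINT t|M. f t (Y n) - f t x - f' t x (Y n - x)) /\<^sub>R norm (Y n - x)"
          unfolding R_def by (rule integral_scaleR_right)
        also have "(LINT t|M. f t (Y n) - f t x - f' t x (Y n - x))
            = (LINT t|M. f t (Y n)) - (LINT t|M. f t x) - (LINT t|M. f' t x (Y n - x))"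
          using int[OF x] int[OF Y(2)[of n]] intf'[of "Y n - x"] by (simp add: Bochner_Integration.integral_diff)
        finally show ?thesis by (simp add: divide_inverse mult.commute)
      qed
      ultimately show "((\<lambda>y. norm ((LINT t|M. f t y) - (LINT t|M. f t x) - (LINT t|M. f' t x (y - x))) / norm (y - x)) \<circ> X) \<longlonglongrightarrow> 0"
        by - (rule LIMSEQ_offset[of _ N], simp add: comp_def Y_def)
    qed
  qed
qed

section \<open>Fubini, the midpoint substitution and Gaussian integrals\<close>

lemma integrable_lborel_prodI:
  fixes f :: "'a::euclidean_space \<times> 'b::euclidean_space \<Rightarrow> complex"
  assumes "f \<in> borel_measurable borel"
    and "\<And>x. integrable lborel (\<lambda>y. f (x, y))"
    and "integrable lborel (\<lambda>x. LINT y|lborel. cmod (f (x, y)))"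
  shows "integrable lborel f"
  using assms by (intro lborel_pair.Fubini_integrable[of f, unfolded lborel_prod]) auto

lemma integral_lborel_prod:
  fixes f :: "'a::euclidean_space \<times> 'b::euclidean_space \<Rightarrow> complex"
  assumes "integrable lborel f"
  shows "(LINT z|lborel. f z) = (LINT x|lborel. LINT y|lborel. f (x, y))"
    and "(LINT z|lborel. f z) = (LINT y|lborel. LINT x|lborel. f (x, y))"
  using lborel_pair.integral_fst'[of f, unfolded lborel_prod, OF assms]
    lborel_pair.integral_snd[of "curry f", unfolded lborel_prod case_prod_curry, OF assms]
  by (simp_all only: curry_def)

lemma integral_lborel_swap:
  fixes f :: "'a::euclidean_space \<Rightarrow> 'b::euclidean_space \<Rightarrow> complex"
  assumes "integrable lborel (\<lambda>(x, y). f x y)"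
  shows "(LINT x|lborel. LINT y|lborel. f x y) = (LINT y|lborel. LINT x|lborel. f x y)"
  using integral_lborel_prod(1)[OF assms, symmetric] integral_lborel_prod(2)[OF assms]
  unfolding prod.case by (rule trans)

text \<open>
  The change of variables between a pair of points and their midpoint and difference.
\<close>

definition midpoint_shear :: "'a::euclidean_space \<times> 'a \<Rightarrow> 'a \<times> 'a" where
  "midpoint_shear = (\<lambda>(x, y). (x + y /\<^sub>R 2, x - y /\<^sub>R 2))"

lemma measurable_midpoint_shear[measurable]: "midpoint_shear \<in> borel \<rightarrow>\<^sub>M borel"
  unfolding midpoint_shear_def case_prod_beta
  by (intro borel_measurable_continuous_onI continuous_intros)

text \<open>
  For fixed \<open>y\<close>, translating \<open>x\<close> by \<open>y / 2\<close> turns the pair into \<open>(x + y, x)\<close>; for fixed \<open>x\<close>, translating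
  \<open>y\<close> by \<open>x\<close> turns this into \<open>(y, x)\<close>. So translation invariance and Tonelli suffice.
\<close>

lemma lborel_midpoint_shear: "distr lborel lborel midpoint_shear = (lborel :: ('a::euclidean_space \<times> 'a) measure)"
proof (rule measure_eqI)
  have tr: "(\<integral>\<^sup>+x. g (x + t) \<partial>lborel) = (\<integral>\<^sup>+x. g x \<partial>lborel)"
    if [measurable]: "g \<in> borel_measurable borel" for g :: "'a \<Rightarrow> ennreal" and t
    by (subst (2) lborel_distr_plus[of t, symmetric]) (simp add: nn_integral_distr add.commute)
  fix A :: "('a \<times> 'a) set" assume "A \<in> sets (distr lborel lborel midpoint_shear)"
  then have [measurable]: "A \<in> sets borel" by simp
  define F :: "'a \<times> 'a \<Rightarrow> ennreal" where "F = indicator A"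
  have F[measurable]: "F \<in> borel_measurable borel" unfolding F_def by measurable
  have "(\<lambda>z::'a \<times> 'a. (fst z + snd z, fst z)) \<in> borel \<rightarrow>\<^sub>M borel"
    by (intro borel_measurable_continuous_onI continuous_intros)
  from measurable_compose[OF this F]
  have F2: "(\<lambda>(x, y). F (x + y, x)) \<in> borel_measurable (lborel \<Otimes>\<^sub>M lborel)"
    unfolding lborel_prod by (simp add: case_prod_beta)
  have F3[measurable]: "F \<in> borel_measurable (lborel \<Otimes>\<^sub>M lborel)"
    unfolding lborel_prod by measurable
  have e1: "(\<integral>\<^sup>+z. F (midpoint_shear z) \<partial>(lborel \<Otimes>\<^sub>M lborel)) = (\<integral>\<^sup>+y. \<integral>\<^sup>+x. F (x + y /\<^sub>R 2, x - y /\<^sub>R 2) \<partial>lborel \<partial>lborel)"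
  proof -
    have "(\<lambda>z. F (midpoint_shear z)) \<in> borel_measurable (lborel \<Otimes>\<^sub>M lborel)"
      unfolding lborel_prod by measurable
    from lborel_pair.nn_integral_snd[OF this] show ?thesis
      by (simp only: midpoint_shear_def prod.case)
  qed
  have e2: "(\<integral>\<^sup>+y. \<integral>\<^sup>+x. F (x + y /\<^sub>R 2, x - y /\<^sub>R 2) \<partial>lborel \<partial>lborel) = (\<integral>\<^sup>+y. \<integral>\<^sup>+x. F (x + y, x) \<partial>lborel \<partial>lborel)"
  proof (rule nn_integral_cong)
    fix y :: 'a
    have "y /\<^sub>R 2 + y /\<^sub>R 2 = (inverse 2 + inverse 2) *\<^sub>R y" by (simp only: scaleR_left_distrib)
    then have y: "y /\<^sub>R 2 + y /\<^sub>R 2 = y" by simp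
    have "x + h = (x + - h) + (h + h)" for x h :: 'a by simp
    from this[of _ "y /\<^sub>R 2", unfolded y]
    have half: "x + y /\<^sub>R 2 = (x + - (y /\<^sub>R 2)) + y" for x .
    have "(\<lambda>x. F (x + y, x)) \<in> borel_measurable borel" by measurable
    from tr[OF this, of "- (y /\<^sub>R 2)"]
    show "(\<integral>\<^sup>+x. F (x + y /\<^sub>R 2, x - y /\<^sub>R 2) \<partial>lborel) = (\<integral>\<^sup>+x. F (x + y, x) \<partial>lborel)"
      unfolding half by (simp only: diff_conv_add_uminus)
  qed
  have e3: "(\<integral>\<^sup>+y. \<integral>\<^sup>+x. F (x + y, x) \<partial>lborel \<partial>lborel) = (\<integral>\<^sup>+x. \<integral>\<^sup>+y. F (x + y, x) \<partial>lborel \<partial>lborel)"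
    using lborel_pair.Fubini'[OF F2] by simp
  have e4: "(\<integral>\<^sup>+x. \<integral>\<^sup>+y. F (x + y, x) \<partial>lborel \<partial>lborel) = (\<integral>\<^sup>+x. \<integral>\<^sup>+y. F (y, x) \<partial>lborel \<partial>lborel)"
  proof (rule nn_integral_cong)
    fix x :: 'a
    have "(\<lambda>y. F (y, x)) \<in> borel_measurable borel" by measurable
    from tr[OF this, of x] show "(\<integral>\<^sup>+y. F (x + y, x) \<partial>lborel) = (\<integral>\<^sup>+y. F (y, x) \<partial>lborel)"
      by (simp only: add.commute)
  qed
  have e5: "(\<integral>\<^sup>+x. \<integral>\<^sup>+y. F (y, x) \<partial>lborel \<partial>lborel) = (\<integral>\<^sup>+z. F z \<partial>(lborel \<Otimes>\<^sub>M lborel))"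
    by (rule lborel_pair.nn_integral_snd[OF F3])
  note e6 = HOL.trans[OF e1 HOL.trans[OF e2 HOL.trans[OF e3 HOL.trans[OF e4 e5]]]]
  have "(\<integral>\<^sup>+z. F (midpoint_shear z) \<partial>lborel) = (\<integral>\<^sup>+z. F z \<partial>lborel)"
    using e6 by (simp only: lborel_prod)
  moreover have "(\<integral>\<^sup>+z. F z \<partial>distr lborel lborel midpoint_shear) = (\<integral>\<^sup>+z. F (midpoint_shear z) \<partial>lborel)"
    by (rule nn_integral_distr) (use measurable_midpoint_shear F in simp_all)
  ultimately have "(\<integral>\<^sup>+z. F z \<partial>distr lborel lborel midpoint_shear) = (\<integral>\<^sup>+z. F z \<partial>lborel)"
    by (rule trans[rotated])
  then show "emeasure (distr lborel lborel midpoint_shear) A = emeasure lborel A"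
    by (simp add: F_def)
qed simp

lemma integral_midpoint_shear:
  fixes f :: "'a::euclidean_space \<times> 'a \<Rightarrow> complex"
  assumes "f \<in> borel_measurable borel"
  shows "(LINT z|lborel. f (midpoint_shear z)) = (LINT z|lborel. f z)"
    and "integrable lborel f \<Longrightarrow> integrable lborel (\<lambda>z. f (midpoint_shear z))"
proof -
  have m: "midpoint_shear \<in> lborel \<rightarrow>\<^sub>M (lborel :: ('a \<times> 'a) measure)" and f: "f \<in> borel_measurable lborel"
    using measurable_midpoint_shear assms by simp_all
  show "(LINT z|lborel. f (midpoint_shear z)) = (LINT z|lborel. f z)"
    by (rule integral_distr[OF m f, unfolded lborel_midpoint_shear, symmetric])
  assume "integrable lborel f"
  then show "integrable lborel (\<lambda>z. f (midpoint_shear z))"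
    by (rule integrable_distr_eq[OF m f, unfolded lborel_midpoint_shear, THEN iffD1])
qed

lemma lborel_integral_prod:
  fixes f :: "'a::euclidean_space \<Rightarrow> real \<Rightarrow> complex"
  assumes f: "\<And>b. b \<in> Basis \<Longrightarrow> integrable lborel (f b)"
  shows "(LINT x|lborel. (\<Prod>b\<in>Basis. f b (x \<bullet> b))) = (\<Prod>b\<in>Basis. LINT s|lborel. f b s)"
    and "integrable lborel (\<lambda>x. (\<Prod>b\<in>Basis. f b (x \<bullet> b)))"
proof -
  interpret product_sigma_finite "\<lambda>_::'a. lborel :: real measure" by standard
  have [measurable]: "f b \<in> borel_measurable borel" if "b \<in> Basis" for b
    using borel_measurable_integrable[OF f[OF that]] by simp
  have m[measurable]: "(\<lambda>x. \<Prod>b\<in>Basis. f b (x \<bullet> b)) \<in> borel_measurable borel" by measurable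
  have m2[measurable]: "(\<lambda>f. \<Sum>b\<in>Basis. f b *\<^sub>R b) \<in> (\<Pi>\<^sub>M b\<in>(Basis::'a set). lborel) \<rightarrow>\<^sub>M borel" by measurable
  have eq: "(\<Prod>b\<in>Basis. f b ((\<Sum>c\<in>Basis. g c *\<^sub>R c) \<bullet> b)) = (\<Prod>b\<in>Basis. f b (g b))" for g :: "'a \<Rightarrow> real"
    by (intro prod.cong refl) (simp add: inner_sum_left inner_Basis if_distrib cong: if_cong)
  show "(LINT x|lborel. (\<Prod>b\<in>Basis. f b (x \<bullet> b))) = (\<Prod>b\<in>Basis. LINT s|lborel. f b s)"
    by (subst lborel_eq, subst integral_distr[OF m2 m])
       (simp add: eq product_integral_prod f)
  show "integrable lborel (\<lambda>x. (\<Prod>b\<in>Basis. f b (x \<bullet> b)))"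
    by (subst lborel_eq, subst integrable_distr_eq[OF m2 m])
       (simp add: eq product_integrable_prod f)
qed

text \<open>
  This is the characteristic function of the standard normal distribution at \<open>sqrt (2 pi) u\<close>, after
  the substitution that replaces \<open>x\<close> by \<open>sqrt (2 pi) x\<close>.
\<close>

lemma fourier_gaussian_real:
  "(LINT x|lborel. complex_of_real (exp (- pi * x\<^sup>2)) * cis (2 * pi * (x * u))) = of_real (exp (- pi * u\<^sup>2))"
  "integrable lborel (\<lambda>x. complex_of_real (exp (- pi * x\<^sup>2)) * cis (2 * pi * (x * u)))"
proof -
  define t where "t = sqrt (2 * pi) * u"
  have t2: "t\<^sup>2 = 2 * pi * u\<^sup>2" by (simp add: t_def power_mult_distrib)
  define F where "F x = complex_of_real (std_normal_density x) * iexp (t * x)" for x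
  have sq: "sqrt (2 * pi) * sqrt (2 * pi) = 2 * pi" by simp
  have F: "F (sqrt (2 * pi) * x) = of_real (1 / sqrt (2 * pi)) * (complex_of_real (exp (- pi * x\<^sup>2)) * cis (2 * pi * (x * u)))" for x
  proof -
    have "t * (sqrt (2 * pi) * x) = 2 * pi * (x * u)" using sq unfolding t_def by (metis mult.assoc mult.commute)
    then show ?thesis
      unfolding F_def cis_conv_exp[symmetric] std_normal_density_def
      by (simp only: power_mult_distrib) simp
  qed
  have Fint: "integrable lborel F"
  proof (rule Bochner_Integration.integrable_bound[of _ std_normal_density])
    show "F \<in> borel_measurable lborel" unfolding F_def by measurable
  qed (auto simp: F_def norm_mult normal_density_nonneg)
  have "(LINT x|lborel. F x) = char std_normal_distribution t"
    unfolding char_def F_def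
    by (subst integral_density) (auto simp: normal_density_nonneg scaleR_conv_of_real)
  then have 1: "(LINT x|lborel. F x) = of_real (exp (- pi * u\<^sup>2))"
    using t2 by (simp add: char_std_normal_distribution)
  have c: "sqrt (2 * pi) \<noteq> 0" by simp
  have "(LINT x|lborel. F x) = sqrt (2 * pi) *\<^sub>R (LINT x|lborel. F (0 + sqrt (2 * pi) * x))"
    using lborel_integral_real_affine[OF c, of F 0] by simp
  also have "\<dots> = (LINT x|lborel. complex_of_real (exp (- pi * x\<^sup>2)) * cis (2 * pi * (x * u)))"
    unfolding F add_0 by (simp add: scaleR_conv_of_real)
  finally show "(LINT x|lborel. complex_of_real (exp (- pi * x\<^sup>2)) * cis (2 * pi * (x * u))) = of_real (exp (- pi * u\<^sup>2))"
    using 1 by simp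
  have "integrable lborel (\<lambda>x. F (0 + sqrt (2 * pi) * x))"
    using Fint c by (rule lborel_integrable_real_affine)
  then have "integrable lborel (\<lambda>x. of_real (sqrt (2 * pi)) * F (0 + sqrt (2 * pi) * x))" by simp
  then show "integrable lborel (\<lambda>x. complex_of_real (exp (- pi * x\<^sup>2)) * cis (2 * pi * (x * u)))"
    unfolding F add_0 by simp
qed

text \<open>
  Both the Gaussian and the character are products over the coordinates.
\<close>

lemma inv_fourier_gaussian:
  fixes u :: "'a::euclidean_space"
  shows "(LINT x|lborel. complex_of_real (exp (- pi * (norm x)\<^sup>2)) * cis (2 * pi * (x \<bullet> u))) = of_real (exp (- pi * (norm u)\<^sup>2))"
    "integrable lborel (\<lambda>x. complex_of_real (exp (- pi * (norm x)\<^sup>2)) * cis (2 * pi * (x \<bullet> u)))"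
proof -
  have n: "exp (- pi * (norm y)\<^sup>2) = (\<Prod>b\<in>Basis. exp (- pi * (y \<bullet> b)\<^sup>2))" for y :: 'a
    unfolding power2_norm_eq_inner euclidean_inner[of y y]
    by (simp add: exp_sum[symmetric] sum_distrib_left power2_eq_square sum_negf[symmetric])
  have c: "cis (2 * pi * (x \<bullet> u)) = (\<Prod>b\<in>Basis. cis (2 * pi * ((x \<bullet> b) * (u \<bullet> b))))" for x
    unfolding euclidean_inner[of x u] cis_conv_exp
    by (simp add: exp_sum[symmetric] sum_distrib_left)
  define G where "G b s = complex_of_real (exp (- pi * s\<^sup>2)) * cis (2 * pi * (s * (u \<bullet> b)))" for b s
  have G: "integrable lborel (G b)" "(LINT s|lborel. G b s) = of_real (exp (- pi * (u \<bullet> b)\<^sup>2))" for b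
    unfolding G_def by (rule fourier_gaussian_real)+
  have eq: "(\<lambda>x. complex_of_real (exp (- pi * (norm x)\<^sup>2)) * cis (2 * pi * (x \<bullet> u)))
     = (\<lambda>x. \<Prod>b\<in>Basis. G b (x \<bullet> b))"
    by (intro ext) (simp only: n c G_def of_real_prod prod.distrib)
  show "(LINT x|lborel. complex_of_real (exp (- pi * (norm x)\<^sup>2)) * cis (2 * pi * (x \<bullet> u))) = of_real (exp (- pi * (norm u)\<^sup>2))"
    unfolding eq lborel_integral_prod(1)[OF G(1)] G(2) by (simp only: n of_real_prod)
  show "integrable lborel (\<lambda>x. complex_of_real (exp (- pi * (norm x)\<^sup>2)) * cis (2 * pi * (x \<bullet> u)))"
    unfolding eq by (rule lborel_integral_prod(2)[OF G(1)])
qed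

section \<open>The Fourier transform on Schwartz functions\<close>

definition gaussian :: "'a::euclidean_space \<Rightarrow> complex" where
  "gaussian x = complex_of_real (exp (- pi * (norm x)\<^sup>2))"

lemma schwartz_gaussian_pi: "gaussian \<in> schwartz"
  using schwartz_gaussian[of pi] by (simp add: gaussian_def[abs_def])

lemma fourier_gaussian_scaled:
  fixes u :: "'a::euclidean_space"
  assumes s: "s > 0"
  shows "(LINT x|lborel. gaussian (s *\<^sub>R x) * cis (2 * pi * (x \<bullet> u))) = of_real (1 / s ^ DIM('a)) * gaussian (u /\<^sub>R s)"
proof -
  define f where "f = (\<lambda>x::'a. gaussian x * cis (2 * pi * (x \<bullet> (u /\<^sub>R s))))"
  have f: "f \<in> schwartz" unfolding f_def by (intro schwartz_modulation schwartz_gaussian_pi)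
  have "(LINT x|lborel. f (0 + s *\<^sub>R x)) = (1 / \<bar>s\<bar> ^ DIM('a)) *\<^sub>R (LINT x|lborel. f x)"
    using s by (intro lborel_integral_affine borel_measurable_schwartz f) auto
  moreover have "(LINT x|lborel. f x) = gaussian (u /\<^sub>R s)"
    unfolding f_def gaussian_def by (rule inv_fourier_gaussian)
  moreover have "(\<lambda>x. f (0 + s *\<^sub>R x)) = (\<lambda>x. gaussian (s *\<^sub>R x) * cis (2 * pi * (x \<bullet> u)))"
  proof
    fix x
    have "(s *\<^sub>R x) \<bullet> (u /\<^sub>R s) = x \<bullet> u" using s by (simp add: field_simps)
    then show "f (0 + s *\<^sub>R x) = gaussian (s *\<^sub>R x) * cis (2 * pi * (x \<bullet> u))"
      unfolding f_def add_0 by (simp only:)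
  qed
  ultimately show ?thesis using s by (simp add: scaleR_conv_of_real)
qed

lemma integral_gaussian: "(LINT x::'a::euclidean_space|lborel. gaussian x) = 1"
  using fourier_gaussian_scaled[of 1 "0::'a"] by (simp add: gaussian_def)

lemma cis_measurable[measurable]: "cis \<in> borel_measurable borel"
  by (intro borel_measurable_continuous_onI continuous_intros)

lemma fourier_integrable:
  assumes "integrable lborel f"
  shows "integrable lborel (\<lambda>\<xi>. f \<xi> * cis (r * (\<xi> \<bullet> x)))" "integrable lborel (\<lambda>\<xi>. f \<xi> * cis (r * (x \<bullet> \<xi>)))"
proof -
  have [measurable]: "f \<in> borel_measurable borel" using borel_measurable_integrable[OF assms] by simp
  have m: "(\<lambda>\<xi>. f \<xi> * cis (r * (\<xi> \<bullet> x))) \<in> borel_measurable borel" by measurable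
  show "integrable lborel (\<lambda>\<xi>. f \<xi> * cis (r * (\<xi> \<bullet> x)))"
    by (rule Bochner_Integration.integrable_bound[OF assms]) (use m in \<open>auto simp: norm_mult\<close>)
  then show "integrable lborel (\<lambda>\<xi>. f \<xi> * cis (r * (x \<bullet> \<xi>)))"
    by (simp only: inner_commute[of x])
qed

lemma cmod_inv_fourier_le: "cmod (inv_fourier f x) \<le> (LINT \<xi>|lborel. cmod (f \<xi>))"
proof -
  have "cmod (inv_fourier f x) \<le> (LINT \<xi>|lborel. cmod (f \<xi> * cis (2 * pi * (x \<bullet> \<xi>))))"
    unfolding inv_fourier_def by (rule integral_norm_bound)
  then show ?thesis by (simp add: norm_mult)
qed

lemma fourier_eq_inv_fourier: "fourier f \<xi> = inv_fourier f (- \<xi>)"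
  unfolding fourier_def inv_fourier_def by (simp add: inner_commute)

lemma integrable_schwartz_norm:
  assumes "f \<in> schwartz"
  shows "integrable lborel (\<lambda>x. norm x * cmod (f x))"
proof -
  have [measurable]: "f \<in> borel_measurable borel" by (rule borel_measurable_schwartz[OF assms])
  have "rapidly_decreasing (\<lambda>x. of_real (norm x) * f x)"
    using assms by (intro rapidly_decreasing_mult[where K = 1 and k = 1] schwartz_rapidly_decreasing) auto
  then have "integrable lborel (\<lambda>x. of_real (norm x) * f x)"
    by (intro integrable_rapidly_decreasing) measurable
  then show ?thesis using integrable_norm by (fastforce simp: norm_mult)
qed

lemma inv_fourier_has_derivative:
  assumes f: "f \<in> schwartz"
  shows "(inv_fourier f has_derivative
    (\<lambda>v. LINT \<xi>|lborel. f \<xi> * ((\<i> * of_real (2 * pi * (v \<bullet> \<xi>))) * cis (2 * pi * (x \<bullet> \<xi>))))) (at x)"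
  unfolding inv_fourier_def[abs_def]
proof (rule has_derivative_integral(1))
  show "integrable lborel (\<lambda>\<xi>. f \<xi> * cis (2 * pi * (y \<bullet> \<xi>)))" for y
    by (intro fourier_integrable integrable_schwartz f)
  show "((\<lambda>x. f t * cis (2 * pi * (x \<bullet> t))) has_derivative
      (\<lambda>v. f t * ((\<i> * of_real (2 * pi * (v \<bullet> t))) * cis (2 * pi * (y \<bullet> t))))) (at y)" for t y
    by (intro has_derivative_mult_right has_derivative_cis_inner)
  show "integrable lborel (\<lambda>\<xi>. 2 * pi * (norm \<xi> * cmod (f \<xi>)))"
    by (intro integrable_mult_right integrable_schwartz_norm f)
  show "cmod (f t * ((\<i> * of_real (2 * pi * (v \<bullet> t))) * cis (2 * pi * (y \<bullet> t)))) \<le> 2 * pi * (norm t * cmod (f t)) * norm v" for t y v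
  proof -
    have "cmod (f t) * (2 * pi * \<bar>v \<bullet> t\<bar>) \<le> cmod (f t) * (2 * pi * (norm v * norm t))"
      by (intro mult_left_mono Cauchy_Schwarz_ineq2) auto
    then show ?thesis by (simp add: norm_mult abs_mult mult_ac)
  qed
qed

lemma partial_deriv_inv_fourier:
  assumes "f \<in> schwartz"
  shows "partial_deriv b (inv_fourier f) = inv_fourier (\<lambda>\<xi>. (\<i> * of_real (2 * pi)) * (of_real (\<xi> \<bullet> b) * f \<xi>))"
  by (intro ext, subst partial_deriv_eq[OF inv_fourier_has_derivative[OF assms]])
     (simp add: inv_fourier_def inner_commute mult_ac)

lemma has_derivative_integral_translate:
  fixes f g :: "'a::euclidean_space \<Rightarrow> complex"
  assumes f: "f \<in> schwartz" and g[measurable]: "g \<in> borel_measurable borel" and g1: "\<And>x. cmod (g x) \<le> 1"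
  shows "((\<lambda>y. LINT t|lborel. f (t + y) * g t) has_derivative
     (\<lambda>v. LINT t|lborel. (\<Sum>b\<in>Basis. (v \<bullet> b) *\<^sub>R partial_deriv b f t) * g t)) (at 0)"
proof -
  have f_meas[measurable]: "f \<in> borel_measurable borel" by (rule borel_measurable_schwartz[OF f])
  define N where "N = 2 * DIM('a)"
  obtain C where C: "\<And>b x. b \<in> Basis \<Longrightarrow> (1 + norm x) ^ N * cmod (partial_deriv b f x) \<le> C b"
  proof -
    have "\<forall>b. \<exists>C. b \<in> Basis \<longrightarrow> (\<forall>x. (1 + norm x) ^ N * cmod (partial_deriv b f x) \<le> C)"
      using schwartz_bound[OF schwartz_partial_deriv[OF f]] by metis
    then obtain C where "\<forall>b. b \<in> Basis \<longrightarrow> (\<forall>x. (1 + norm x) ^ N * cmod (partial_deriv b f x) \<le> C b)" by metis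
    then show ?thesis by (intro that) blast
  qed
  define w where "w t = (\<Sum>b\<in>Basis. 2 ^ N * C b) * (1 / (1 + norm (t::'a)) ^ N)" for t
  have *: "((\<lambda>y. LINT t|lborel. f (t + y) * g t) has_derivative
     (\<lambda>v. LINT t|lborel. (\<Sum>b\<in>Basis. (v \<bullet> b) *\<^sub>R partial_deriv b f (t + 0)) * g t)) (at 0)"
  proof (rule has_derivative_integral(1))
    show "integrable lborel (\<lambda>t. f (t + y) * g t)" for y
    proof (rule Bochner_Integration.integrable_bound)
      show "integrable lborel (\<lambda>t. f (t + y))"
        by (intro lborel_integral_translate f_meas integrable_schwartz f)
      show "AE x in lborel. cmod (f (x + y) * g x) \<le> cmod (f (x + y))"
        using g1 by (intro always_eventually allI) (simp add: norm_mult mult_left_le)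
    qed measurable
    show "integrable lborel w"
      unfolding w_def N_def by (intro integrable_mult_right integrable_inverse_one_plus_norm)
    fix t y :: 'a
    have tr: "((\<lambda>y. t + y) has_derivative (\<lambda>v. v)) (at y)" by (auto intro!: derivative_eq_intros)
    show "((\<lambda>y. f (t + y) * g t) has_derivative (\<lambda>v. (\<Sum>b\<in>Basis. (v \<bullet> b) *\<^sub>R partial_deriv b f (t + y)) * g t)) (at y)"
      by (intro has_derivative_mult_left has_derivative_compose[OF tr has_derivative_partial_deriv] schwartz_differentiable f)
    fix v assume y: "y \<in> ball 0 1"
    have le: "cmod (partial_deriv b f (t + y)) \<le> 2 ^ N * C b * (1 / (1 + norm t) ^ N)" if b: "b \<in> Basis" for b
    proof -
      have "0 \<le> C b" using order_trans[OF _ C[OF b, of 0]] by simp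
      have "(1 + norm t) ^ N \<le> ((1 + norm (t + y)) * 2) ^ N"
        using y by (intro power_mono order_trans[OF one_plus_norm_le_shift[of t y]] mult_left_mono) auto
      then have "(1 + norm t) ^ N * cmod (partial_deriv b f (t + y)) \<le> 2 ^ N * ((1 + norm (t + y)) ^ N * cmod (partial_deriv b f (t + y)))"
        using mult_right_mono[of "(1 + norm t) ^ N" "((1 + norm (t + y)) * 2) ^ N" "cmod (partial_deriv b f (t + y))"]
        unfolding power_mult_distrib by (simp only: mult_ac norm_ge_zero)
      also have "\<dots> \<le> 2 ^ N * C b" by (intro mult_left_mono C b) auto
      finally show ?thesis by (simp add: field_simps add_pos_nonneg)
    qed
    have "cmod ((\<Sum>b\<in>Basis. (v \<bullet> b) *\<^sub>R partial_deriv b f (t + y)) * g t)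
        \<le> cmod (\<Sum>b\<in>Basis. (v \<bullet> b) *\<^sub>R partial_deriv b f (t + y))"
      unfolding norm_mult using g1 by (intro mult_left_le) auto
    also have "\<dots> \<le> (\<Sum>b\<in>Basis. norm v * (2 ^ N * C b * (1 / (1 + norm t) ^ N)))"
    proof (intro sum_norm_le)
      fix b :: 'a assume "b \<in> Basis"
      then show "norm ((v \<bullet> b) *\<^sub>R partial_deriv b f (t + y)) \<le> norm v * (2 ^ N * C b * (1 / (1 + norm t) ^ N))"
        unfolding norm_scaleR by (intro mult_mono Basis_le_norm le) auto
    qed
    also have "\<dots> = w t * norm v" by (simp add: w_def sum_distrib_left sum_distrib_right mult_ac)
    finally show "cmod ((\<Sum>b\<in>Basis. (v \<bullet> b) *\<^sub>R partial_deriv b f (t + y)) * g t) \<le> w t * norm v" .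
  qed
  then show ?thesis by simp
qed

text \<open>
  Integration by parts without boundary terms: by translation invariance the integral of
  \<open>f (t + y)\<close> against the character is \<open>inv_fourier f x\<close> times a character of \<open>y\<close>. Differentiating
  both expressions at \<open>y = 0\<close> gives the claim.
\<close>

lemma inv_fourier_partial_deriv:
  fixes f :: "'a::euclidean_space \<Rightarrow> complex"
  assumes f: "f \<in> schwartz" and b: "b \<in> Basis"
  shows "inv_fourier (partial_deriv b f) x = - (\<i> * of_real (2 * pi * (x \<bullet> b))) * inv_fourier f x"
proof -
  define g where "g t = cis (2 * pi * (x \<bullet> t))" for t
  have g[measurable]: "g \<in> borel_measurable borel" unfolding g_def by measurable
  have f_meas[measurable]: "f \<in> borel_measurable borel" by (rule borel_measurable_schwartz[OF f])
  have 1: "partial_deriv b (\<lambda>y. LINT t|lborel. f (t + y) * g t) 0 = inv_fourier (partial_deriv b f) x"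
  proof -
    have "(\<Sum>c\<in>Basis. (b \<bullet> c) *\<^sub>R partial_deriv c f t) = partial_deriv b f t" for t
      using b by (simp add: inner_Basis if_distrib[of "\<lambda>c. c *\<^sub>R _"] cong: if_cong)
    then show ?thesis
      unfolding inv_fourier_def g_def[symmetric]
      by (subst partial_deriv_eq[OF has_derivative_integral_translate[OF f g]]) (simp_all add: g_def)
  qed
  have "(LINT t|lborel. f (t + y) * g t) = inv_fourier f x * cis (- 2 * pi * (y \<bullet> x))" for y
  proof -
    have "(LINT t|lborel. f (t + y) * g t) = (LINT t|lborel. f (t + y) * g ((t + y) - y))" by simp
    also have "\<dots> = (LINT t|lborel. f t * g (t - y))"
      by (rule lborel_integral_translate(1)[of "\<lambda>t. f t * g (t - y)" y]) measurable
    also have "\<dots> = (LINT t|lborel. (f t * cis (2 * pi * (x \<bullet> t))) * cis (- 2 * pi * (y \<bullet> x)))"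
      by (intro Bochner_Integration.integral_cong)
         (auto simp: g_def cis_mult inner_diff_right right_diff_distrib inner_commute)
    also have "\<dots> = inv_fourier f x * cis (- 2 * pi * (y \<bullet> x))"
      unfolding inv_fourier_def by simp
    finally show ?thesis .
  qed
  then have "partial_deriv b (\<lambda>y. LINT t|lborel. f (t + y) * g t) 0 = - (\<i> * of_real (2 * pi * (x \<bullet> b))) * inv_fourier f x"
    by (simp only:) (subst partial_deriv_cmult, rule differentiable_cis_inner, subst partial_deriv_cis_inner, simp add: inner_commute)
  with 1 show ?thesis by simp
qed

lemma inv_fourier_iterated_partial_deriv:
  assumes "f \<in> schwartz" "b \<in> Basis"
  shows "inv_fourier (derivs (replicate n b) f) x = (- (\<i> * of_real (2 * pi * (x \<bullet> b)))) ^ n * inv_fourier f x"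
proof (induction n)
  case (Suc n)
  have "set (replicate n b) \<subseteq> Basis" using assms by auto
  then show ?case
    using Suc inv_fourier_partial_deriv[OF schwartz_foldr[OF assms(1)] assms(2), of "replicate n b"]
    by (simp only: replicate_Suc foldr.simps comp_apply power_Suc mult.assoc)
qed simp

lemma cmod_inv_fourier_decay:
  assumes "f \<in> schwartz" "b \<in> Basis"
  shows "\<bar>x \<bullet> b\<bar> ^ n * cmod (inv_fourier f x) \<le> (LINT \<xi>|lborel. cmod (derivs (replicate n b) f \<xi>))"
proof -
  have "1 \<le> 2 * pi" using pi_ge_two by simp
  then have "\<bar>x \<bullet> b\<bar> ^ n \<le> (2 * pi * \<bar>x \<bullet> b\<bar>) ^ n"
    using mult_right_mono[of 1 "2 * pi" "\<bar>x \<bullet> b\<bar>"] by (intro power_mono) auto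
  then have "\<bar>x \<bullet> b\<bar> ^ n * cmod (inv_fourier f x) \<le> (2 * pi * \<bar>x \<bullet> b\<bar>) ^ n * cmod (inv_fourier f x)"
    by (rule mult_right_mono) auto
  also have "\<dots> = cmod (inv_fourier (derivs (replicate n b) f) x)"
    unfolding inv_fourier_iterated_partial_deriv[OF assms] by (simp add: norm_mult norm_power)
  also have "\<dots> \<le> (LINT \<xi>|lborel. cmod (derivs (replicate n b) f \<xi>))"
    by (rule cmod_inv_fourier_le)
  finally show ?thesis .
qed

text \<open>
  Coinduction on the class of inverse transforms: a derivative is the transform of \<open>f\<close> times a
  coordinate, and rapid decrease comes from repeated integration by parts.
\<close>

lemma schwartz_inv_fourier:
  assumes "f \<in> schwartz"
  shows "inv_fourier f \<in> schwartz"
proof (rule schwartz_coinduct[where P = "\<lambda>h. \<exists>f\<in>schwartz. h = inv_fourier f"])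
  fix h :: "'a \<Rightarrow> complex"
  assume "\<exists>f\<in>schwartz. h = inv_fourier f"
  then obtain f where f: "f \<in> schwartz" "h = inv_fourier f" by blast
  show "h differentiable at x" for x
    unfolding f(2) using inv_fourier_has_derivative[OF f(1)] by (rule differentiableI)
  show "rapidly_decreasing h" unfolding f(2)
    using cmod_inv_fourier_decay[OF f(1)] by (intro rapidly_decreasing_coordI) blast
  fix b :: 'a
  show "lin_span (\<lambda>h. \<exists>f\<in>schwartz. h = inv_fourier f) (partial_deriv b h)"
    unfolding f(2) partial_deriv_inv_fourier[OF f(1)]
    by (rule lin_span.base, rule bexI, rule refl, intro schwartz_cmult schwartz_inner_mult f)
qed (use assms in auto)

lemma schwartz_fourier:
  assumes "f \<in> schwartz"
  shows "fourier f \<in> schwartz"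
  using schwartz_affine[OF schwartz_inv_fourier[OF assms], of "-1" 0]
  by (simp add: fourier_eq_inv_fourier[abs_def])

lemma fact_double_le: "fact (2 * k) \<le> (4 ^ k * (fact k)\<^sup>2 :: real)"
proof (induction k)
  case (Suc k)
  have "fact (2 * Suc k) = (2 * real k + 2) * (2 * real k + 1) * fact (2 * k)"
    by (simp add: algebra_simps)
  also have "\<dots> \<le> (2 * real k + 2) * (2 * real k + 2) * (4 ^ k * (fact k)\<^sup>2)"
    by (intro mult_mono Suc) auto
  also have "\<dots> = 4 ^ Suc k * (fact (Suc k))\<^sup>2" by (simp add: power2_eq_square algebra_simps)
  finally show ?case .
qed simp

text \<open>
  Only the even powers matter. Since \<open>sqrt (fact (2 k))\<close> is at most \<open>2\<close> to the \<open>k\<close> times \<open>fact k\<close>, the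
  exponential series of \<open>t\<^sup>2 / (4 C\<^sup>2)\<close>, multiplied by \<open>y\<close>, is dominated by \<open>K\<close> times the geometric
  series of ratio one half.
\<close>

lemma exp_square_bound:
  fixes t y C K :: real
  assumes C: "C > 0" and y: "y \<ge> 0"
    and bound: "\<And>n. \<bar>t\<bar> ^ n * y \<le> K * C ^ n * sqrt (fact n)"
  shows "exp (t\<^sup>2 / (4 * C\<^sup>2)) * y \<le> 2 * K"
proof -
  define z where "z = t\<^sup>2 / (4 * C\<^sup>2)"
  have K: "K \<ge> 0" using order_trans[OF _ bound[of 0]] y by simp
  have le: "y * (z ^ k /\<^sub>R fact k) \<le> K * (1 / 2) ^ k" for k
  proof -
    have "\<bar>t\<bar> ^ (2 * k) * y \<le> K * C ^ (2 * k) * sqrt (fact (2 * k))" by (rule bound)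
    also have "\<dots> \<le> K * C ^ (2 * k) * (2 ^ k * fact k)"
    proof -
      have "sqrt (fact (2 * k)) \<le> sqrt ((2 ^ k * fact k)\<^sup>2)"
      proof -
        have "(2 ^ k)\<^sup>2 = (4 ^ k :: real)" by (simp add: power2_eq_square power_mult_distrib[symmetric])
        then show ?thesis using fact_double_le[of k] by (simp only: power_mult_distrib real_sqrt_le_iff)
      qed
      then have "sqrt (fact (2 * k)) \<le> 2 ^ k * fact k" by simp
      then show ?thesis using K C by (intro mult_left_mono) auto
    qed
    finally have 1: "\<bar>t\<bar> ^ (2 * k) * y \<le> K * C ^ (2 * k) * (2 ^ k * fact k)" .
    have zk: "z ^ k = \<bar>t\<bar> ^ (2 * k) / (4 ^ k * C ^ (2 * k))"
      by (simp add: z_def power_divide power_mult_distrib power_mult)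
    have "y * (z ^ k /\<^sub>R fact k) = (\<bar>t\<bar> ^ (2 * k) * y) / (4 ^ k * C ^ (2 * k) * fact k)"
      by (simp add: zk field_simps)
    also have "\<dots> \<le> (K * C ^ (2 * k) * (2 ^ k * fact k)) / (4 ^ k * C ^ (2 * k) * fact k)"
      using C by (intro divide_right_mono 1) auto
    also have "\<dots> = K * (2 ^ k / 4 ^ k)" using C by simp
    also have "\<dots> = K * (1 / 2) ^ k" by (simp add: power_divide[symmetric])
    finally show ?thesis .
  qed
  have "y * exp z = (\<Sum>k. y * (z ^ k /\<^sub>R fact k))"
    unfolding exp_def by (rule suminf_mult[symmetric, OF summable_exp_generic])
  also have "\<dots> \<le> (\<Sum>k. K * (1 / 2) ^ k)"
    by (intro suminf_le le summable_mult summable_exp_generic summable_geometric) auto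
  also have "\<dots> = 2 * K" by (subst suminf_mult) (auto simp: suminf_geometric)
  finally show ?thesis by (simp add: z_def mult.commute)
qed

section \<open>Gaussian decay and Fourier inversion\<close>

text \<open>
  Integrating by parts \<open>n\<close> times in one coordinate turns the derivative bounds into the hypothesis of
  \<open>exp_square_bound\<close>, and thus into a Gaussian bound in that coordinate. The coordinate of largest
  absolute value controls the norm, at the price of the dimension in the exponent.
\<close>

lemma inv_fourier_gaussian_decay:
  fixes f :: "'a::euclidean_space \<Rightarrow> complex"
  assumes f: "f \<in> schwartz" and C: "C > 0" and \<epsilon>: "\<epsilon> > 0"
    and bound: "\<And>n b \<xi>. b \<in> Basis \<Longrightarrow>
      cmod (derivs (replicate n b) f \<xi>) \<le> C ^ (n + 1) * sqrt (fact n) * exp (- \<epsilon> * (norm \<xi>)\<^sup>2)"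
  obtains K \<delta> where "K > 0" "\<delta> > 0" "\<And>x. cmod (inv_fourier f x) \<le> K * exp (- \<delta> * (norm x)\<^sup>2)"
proof -
  define A where "A = (LINT \<xi>::'a|lborel. exp (- \<epsilon> * (norm \<xi>)\<^sup>2))"
  have intA: "integrable lborel (\<lambda>\<xi>::'a. exp (- \<epsilon> * (norm \<xi>)\<^sup>2))"
    using integrable_norm[OF integrable_schwartz[OF schwartz_gaussian[OF \<epsilon>]]] by simp
  have A: "A \<ge> 0" unfolding A_def by simp
  \<comment> \<open>The exponent delivered by \<open>exp_square_bound\<close>.\<close>
  define \<delta> where "\<delta> = 1 / (4 * C\<^sup>2)"
  define d where "d = real DIM('a)"
  have d: "d > 0" by (simp add: d_def)
  have le: "exp (\<delta> * (x \<bullet> b)\<^sup>2) * cmod (inv_fourier f x) \<le> 2 * (A * C)" if b: "b \<in> Basis" for x b :: 'a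
  proof -
    have "\<bar>x \<bullet> b\<bar> ^ n * cmod (inv_fourier f x) \<le> (A * C) * C ^ n * sqrt (fact n)" for n
    proof -
      have "set (replicate n b) \<subseteq> Basis" using b by auto
      then have g: "derivs (replicate n b) f \<in> schwartz" by (rule schwartz_foldr[OF f])
      have "\<bar>x \<bullet> b\<bar> ^ n * cmod (inv_fourier f x) \<le> (LINT \<xi>|lborel. cmod (derivs (replicate n b) f \<xi>))"
        by (rule cmod_inv_fourier_decay[OF f b])
      also have "\<dots> \<le> (LINT \<xi>::'a|lborel. C ^ (n + 1) * sqrt (fact n) * exp (- \<epsilon> * (norm \<xi>)\<^sup>2))"
        by (intro integral_mono integrable_norm integrable_schwartz g integrable_mult_right intA bound b)
      also have "\<dots> = (A * C) * C ^ n * sqrt (fact n)" by (simp add: A_def)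
      finally show ?thesis .
    qed
    from exp_square_bound[OF C _ this] show ?thesis by (simp add: \<delta>_def)
  qed
  have "cmod (inv_fourier f x) \<le> (2 * (A * C) + 1) * exp (- (\<delta> / d) * (norm x)\<^sup>2)" for x
  proof -
    have ne: "(\<lambda>b. \<bar>x \<bullet> b\<bar>) ` Basis \<noteq> {}" by auto
    obtain b where b: "b \<in> Basis" "Max ((\<lambda>b. \<bar>x \<bullet> b\<bar>) ` Basis) = \<bar>x \<bullet> b\<bar>"
      using Max_in[OF _ ne] by (metis (no_types, lifting) finite_Basis finite_imageI imageE)
    then have "\<And>b'. b' \<in> Basis \<Longrightarrow> \<bar>x \<bullet> b'\<bar> \<le> \<bar>x \<bullet> b\<bar>" by (metis Max_ge finite_Basis finite_imageI imageI)
    then have sq: "\<And>b'. b' \<in> Basis \<Longrightarrow> (x \<bullet> b') * (x \<bullet> b') \<le> (x \<bullet> b)\<^sup>2"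
      by (metis abs_le_square_iff power2_eq_square)
    have "(norm x)\<^sup>2 \<le> d * (x \<bullet> b)\<^sup>2"
      unfolding power2_norm_eq_inner euclidean_inner[of x x] d_def
      using sum_bounded_above[of Basis "\<lambda>b'. (x \<bullet> b') * (x \<bullet> b')", OF sq] by simp
    then have "(\<delta> / d) * (norm x)\<^sup>2 \<le> \<delta> * (x \<bullet> b)\<^sup>2"
      using d C by (simp add: \<delta>_def field_simps)
    then have "exp ((\<delta> / d) * (norm x)\<^sup>2) * cmod (inv_fourier f x) \<le> exp (\<delta> * (x \<bullet> b)\<^sup>2) * cmod (inv_fourier f x)"
      by (intro mult_right_mono) auto
    also have "\<dots> \<le> 2 * (A * C) + 1" using le[OF b(1), of x] by simp
    finally show ?thesis by (simp add: exp_minus field_simps)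
  qed
  moreover have "2 * (A * C) + 1 > 0" using A C by (intro add_nonneg_pos) auto
  moreover have "\<delta> / d > 0" using d C by (simp add: \<delta>_def)
  ultimately show ?thesis using that by blast
qed

lemma integrable_tensor:
  fixes f :: "'a::euclidean_space \<Rightarrow> complex" and g :: "'b::euclidean_space \<Rightarrow> complex"
  assumes f: "integrable lborel f" and g: "integrable lborel g"
  shows "integrable lborel (\<lambda>(x, y). f x * g y)"
proof -
  have [measurable]: "f \<in> borel_measurable borel" "g \<in> borel_measurable borel"
    using borel_measurable_integrable[OF f] borel_measurable_integrable[OF g] by simp_all
  show ?thesis
  proof (rule integrable_lborel_prodI)
    show "(\<lambda>(x, y). f x * g y) \<in> borel_measurable borel"
      unfolding borel_prod[symmetric] by measurable
  qed (use f g in \<open>auto simp: norm_mult\<close>)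
qed

text \<open>
  The Gaussian factor makes the double integral absolutely convergent, so that the integrals may be
  exchanged; the transform of a wide Gaussian is a narrow one, which averages \<open>f\<close> near \<open>\<xi>\<close>.
\<close>

lemma inv_fourier_mollified:
  fixes f :: "'a::euclidean_space \<Rightarrow> complex"
  assumes f: "f \<in> schwartz" and s: "s > 0"
  shows "(LINT x|lborel. inv_fourier f x * cis (- 2 * pi * (x \<bullet> \<xi>)) * gaussian (s *\<^sub>R x))
       = (LINT z|lborel. f (\<xi> + s *\<^sub>R z) * gaussian z)"
proof -
  have [measurable]: "f \<in> borel_measurable borel" "gaussian \<in> borel_measurable (borel :: 'a measure)"
    by (intro borel_measurable_schwartz f schwartz_gaussian_pi)+
  define F where "F x \<eta> = f \<eta> * (gaussian (s *\<^sub>R x) * cis (2 * pi * (x \<bullet> (\<eta> - \<xi>))))" for x \<eta>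
  have g: "(\<lambda>x::'a. gaussian (s *\<^sub>R x)) \<in> schwartz"
    using schwartz_affine[OF schwartz_gaussian_pi, of s 0] s by simp
  have int: "integrable lborel (\<lambda>(x, \<eta>). F x \<eta>)"
  proof (rule Bochner_Integration.integrable_bound)
    show "integrable lborel (\<lambda>(x::'a, \<eta>). gaussian (s *\<^sub>R x) * f \<eta>)"
      by (intro integrable_tensor integrable_schwartz f g)
    show "(\<lambda>(x, \<eta>). F x \<eta>) \<in> borel_measurable lborel"
      unfolding F_def lborel_prod[symmetric] by measurable
  qed (auto simp: F_def norm_mult)
  have "(LINT x|lborel. inv_fourier f x * cis (- 2 * pi * (x \<bullet> \<xi>)) * gaussian (s *\<^sub>R x))
      = (LINT x|lborel. LINT \<eta>|lborel. F x \<eta>)"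
  proof (intro Bochner_Integration.integral_cong refl)
    fix x
    have "F x \<eta> = (f \<eta> * cis (2 * pi * (x \<bullet> \<eta>))) * (cis (- 2 * pi * (x \<bullet> \<xi>)) * gaussian (s *\<^sub>R x))" for \<eta>
      by (simp add: F_def inner_diff_right right_diff_distrib cis_mult[symmetric] mult_ac cis_divide[symmetric] divide_inverse cis_inverse
           flip: cis_cnj)
    then have "(LINT \<eta>|lborel. F x \<eta>) = inv_fourier f x * (cis (- 2 * pi * (x \<bullet> \<xi>)) * gaussian (s *\<^sub>R x))"
      unfolding inv_fourier_def by (simp only:) (rule integral_mult_left_zero)
    then show "inv_fourier f x * cis (- 2 * pi * (x \<bullet> \<xi>)) * gaussian (s *\<^sub>R x) = (LINT \<eta>|lborel. F x \<eta>)"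
      by (simp only: mult.assoc)
  qed
  also have "\<dots> = (LINT \<eta>|lborel. LINT x|lborel. F x \<eta>)"
    by (rule integral_lborel_swap[OF int])
  also have "\<dots> = (LINT \<eta>|lborel. f \<eta> * (of_real (1 / s ^ DIM('a)) * gaussian ((\<eta> - \<xi>) /\<^sub>R s)))"
    unfolding F_def by (simp add: fourier_gaussian_scaled[OF s])
  also have "\<dots> = of_real (1 / s ^ DIM('a)) * (LINT \<eta>|lborel. f \<eta> * gaussian ((\<eta> - \<xi>) /\<^sub>R s))"
    by (subst integral_mult_right_zero[symmetric]) (simp add: mult_ac)
  also have "\<dots> = (LINT z|lborel. f (\<xi> + s *\<^sub>R z) * gaussian ((\<xi> + s *\<^sub>R z - \<xi>) /\<^sub>R s))"
    using s by (subst lborel_integral_affine) (auto simp: scaleR_conv_of_real)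
  finally show ?thesis using s by simp
qed

text \<open>
  The width \<open>s\<close> in \<open>inv_fourier_mollified\<close> tends to 0 on both sides.
\<close>

theorem fourier_inversion:
  fixes f :: "'a::euclidean_space \<Rightarrow> complex"
  assumes f: "f \<in> schwartz"
  shows "fourier (inv_fourier f) \<xi> = f \<xi>"
proof -
  define s where "s n = inverse (real (Suc n))" for n
  have s: "s n > 0" for n by (simp add: s_def)
  have s0: "s \<longlonglongrightarrow> 0" unfolding s_def by (rule LIMSEQ_inverse_real_of_nat)
  have [measurable]: "f \<in> borel_measurable borel" "gaussian \<in> borel_measurable (borel :: 'a measure)"
    "inv_fourier f \<in> borel_measurable borel"
    by (intro borel_measurable_schwartz f schwartz_gaussian_pi schwartz_inv_fourier)+
  have fc: "isCont f x" for x
    using smooth_continuous_on[OF schwartz_smooth[OF f]] by (simp add: continuous_on_eq_continuous_at)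
  have gc: "isCont gaussian (x::'a)" for x unfolding gaussian_def by (intro continuous_intros)
  have "(\<lambda>n. LINT x|lborel. inv_fourier f x * cis (- 2 * pi * (x \<bullet> \<xi>)) * gaussian (s n *\<^sub>R x))
      \<longlonglongrightarrow> (LINT x|lborel. inv_fourier f x * cis (- 2 * pi * (x \<bullet> \<xi>)))"
  proof (rule integral_dominated_convergence[where w = "\<lambda>x. cmod (inv_fourier f x)"])
    show "AE x in lborel. (\<lambda>n. inv_fourier f x * cis (- 2 * pi * (x \<bullet> \<xi>)) * gaussian (s n *\<^sub>R x))
       \<longlonglongrightarrow> inv_fourier f x * cis (- 2 * pi * (x \<bullet> \<xi>))"
    proof (intro always_eventually allI)
      fix x :: 'a
      have "(\<lambda>n. gaussian (s n *\<^sub>R x)) \<longlonglongrightarrow> gaussian (0 *\<^sub>R x)"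
        by (intro isCont_tendsto_compose[OF gc] tendsto_intros s0)
      then have "(\<lambda>n. inv_fourier f x * cis (- 2 * pi * (x \<bullet> \<xi>)) * gaussian (s n *\<^sub>R x))
         \<longlonglongrightarrow> inv_fourier f x * cis (- 2 * pi * (x \<bullet> \<xi>)) * gaussian (0 *\<^sub>R x)"
        by (rule tendsto_mult_left)
      then show "(\<lambda>n. inv_fourier f x * cis (- 2 * pi * (x \<bullet> \<xi>)) * gaussian (s n *\<^sub>R x))
         \<longlonglongrightarrow> inv_fourier f x * cis (- 2 * pi * (x \<bullet> \<xi>))"
        by (simp add: gaussian_def)
    qed
  qed (auto simp: norm_mult gaussian_def mult_left_le intro!: integrable_norm integrable_schwartz schwartz_inv_fourier f)
  moreover have "(\<lambda>n. LINT z|lborel. f (\<xi> + s n *\<^sub>R z) * gaussian z) \<longlonglongrightarrow> (LINT z|lborel. f \<xi> * gaussian (z::'a))"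
  proof -
    obtain B where B: "B > 0" "\<And>x. cmod (f x) \<le> B" using schwartz_bound[OF f, of 0] by auto
    show ?thesis
    proof (rule integral_dominated_convergence[where w = "\<lambda>z. B * cmod (gaussian z)"])
      show "AE z in lborel. (\<lambda>n. f (\<xi> + s n *\<^sub>R z) * gaussian z) \<longlonglongrightarrow> f \<xi> * gaussian z"
      proof (intro always_eventually allI)
        fix z :: 'a
        have "(\<lambda>n. f (\<xi> + s n *\<^sub>R z)) \<longlonglongrightarrow> f (\<xi> + 0 *\<^sub>R z)"
          by (intro isCont_tendsto_compose[OF fc] tendsto_intros s0)
        then show "(\<lambda>n. f (\<xi> + s n *\<^sub>R z) * gaussian z) \<longlonglongrightarrow> f \<xi> * gaussian z"
          by (intro tendsto_mult_right) simp
      qed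
      show "integrable lborel (\<lambda>z::'a. B * cmod (gaussian z))"
        by (intro integrable_mult_right integrable_norm integrable_schwartz schwartz_gaussian_pi)
    qed (auto simp: norm_mult intro!: mult_right_mono B)
  qed
  ultimately have "(LINT x|lborel. inv_fourier f x * cis (- 2 * pi * (x \<bullet> \<xi>))) = (LINT z|lborel. f \<xi> * gaussian (z::'a))"
    unfolding inv_fourier_mollified[OF f s] by (rule LIMSEQ_unique)
  then show ?thesis by (simp add: fourier_def integral_gaussian)
qed

lemma multi_deriv_replicate:
  fixes f :: "'a::euclidean_space \<Rightarrow> complex"
  assumes "smooth f" "b \<in> Basis"
  shows "derivs (replicate n b) f = multi_deriv (\<lambda>c. if c = b then n else 0) f"
proof -
  have "count (mset (replicate n b)) = (\<lambda>c. if c = b then n else 0)" by auto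
  moreover have "set (replicate n b) \<subseteq> Basis" using assms(2) by auto
  ultimately show ?thesis using foldr_eq_multi_deriv[OF assms(1), of "replicate n b"] by (simp only:)
qed

text \<open>
  The derivative bounds are extracted for the pure powers of one direction, the only ones that enter
  the decay of the inverse Fourier transform.
\<close>

lemma gelfand_shilov_half_schwartz:
  fixes \<sigma> :: "'a::euclidean_space \<Rightarrow> complex"
  assumes "gelfand_shilov_half \<sigma>"
  obtains C \<epsilon> where "C > 0" "\<epsilon> > 0" "\<sigma> \<in> schwartz"
    "\<And>n b \<xi>. b \<in> Basis \<Longrightarrow> cmod (derivs (replicate n b) \<sigma> \<xi>) \<le> C ^ (n + 1) * sqrt (fact n) * exp (- \<epsilon> * (norm \<xi>)\<^sup>2)"
proof -
  obtain C \<epsilon> where C: "C > 0" "\<epsilon> > 0" and s: "smooth \<sigma>" and bound: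
    "\<And>\<xi> \<alpha>. cmod (multi_deriv \<alpha> \<sigma> \<xi>) \<le> C ^ (multi_order \<alpha> + 1) * multi_fact \<alpha> powr (1/2) * exp (- \<epsilon> * (norm \<xi>)\<^sup>2)"
    using assms unfolding gelfand_shilov_half_def by blast
  show ?thesis
  proof (rule that[OF C])
    show "\<sigma> \<in> schwartz" unfolding schwartz_def bounded_iff mem_Collect_eq
    proof (intro conjI allI s)
      fix N :: nat and \<alpha> :: "'a \<Rightarrow> nat"
      define K where "K = C ^ (multi_order \<alpha> + 1) * multi_fact \<alpha> powr (1/2)"
      have K: "K \<ge> 0" using C by (simp add: K_def)
      obtain B where B: "\<And>x::'a. (1 + norm x) ^ N * cmod (of_real (exp (- \<epsilon> * (norm x)\<^sup>2))) \<le> B"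
        using rapidly_decreasing_gaussian[OF C(2)] unfolding rapidly_decreasing_def by blast
      have "norm ((1 + norm x) ^ N *\<^sub>R multi_deriv \<alpha> \<sigma> x) \<le> K * B" for x
      proof -
        have "norm ((1 + norm x) ^ N *\<^sub>R multi_deriv \<alpha> \<sigma> x) = (1 + norm x) ^ N * cmod (multi_deriv \<alpha> \<sigma> x)"
          by simp
        also have "\<dots> \<le> (1 + norm x) ^ N * (K * exp (- \<epsilon> * (norm x)\<^sup>2))"
          unfolding K_def by (intro mult_left_mono bound) auto
        also have "\<dots> = K * ((1 + norm x) ^ N * cmod (of_real (exp (- \<epsilon> * (norm x)\<^sup>2))))" by simp
        also have "\<dots> \<le> K * B" by (intro mult_left_mono B K)
        finally show ?thesis .
      qed
      then show "\<exists>a. \<forall>x\<in>range (\<lambda>x. (1 + norm x) ^ N *\<^sub>R multi_deriv \<alpha> \<sigma> x). norm x \<le> a" by blast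
    qed
    fix n and b \<xi> :: 'a assume b: "b \<in> Basis"
    have "multi_order (\<lambda>c. if c = b then n else 0) = n" "multi_fact (\<lambda>c. if c = b then n else 0) = fact n"
      using b by (simp_all add: multi_order_def multi_fact_def if_distrib[of fact] cong: if_cong)
    then show "cmod (derivs (replicate n b) \<sigma> \<xi>) \<le> C ^ (n + 1) * sqrt (fact n) * exp (- \<epsilon> * (norm \<xi>)\<^sup>2)"
      using bound[of "\<lambda>c. if c = b then n else 0" \<xi>] unfolding multi_deriv_replicate[OF s b]
      by (simp add: powr_half_sqrt)
  qed
qed

section \<open>The cross-Wigner distribution of Schwartz functions\<close>

lemma norm_lebesgue_integral_le:
  fixes f :: "'b \<Rightarrow> 'c::{banach, second_countable_topology}"
  assumes g: "integrable M g" and le: "\<And>x. norm (f x) \<le> g x"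
  shows "norm (integral\<^sup>L M f) \<le> integral\<^sup>L M g"
proof -
  have "norm (integral\<^sup>L M f) \<le> (LINT x|M. norm (f x))" by (rule integral_norm_bound)
  also have "\<dots> \<le> integral\<^sup>L M g"
    using order_trans[OF norm_ge_zero le] by (intro integral_mono_AE' g always_eventually allI le) auto
  finally show ?thesis .
qed

lemma cross_wigner_eq:
  "cross_wigner f g p = (LINT y|lborel. f (fst p + y /\<^sub>R 2) * cnj (g (fst p - y /\<^sub>R 2)) * cis (- 2 * pi * (y \<bullet> snd p)))"
  by (simp add: cross_wigner_def case_prod_beta)

lemma half_add_half: "y /\<^sub>R 2 + y /\<^sub>R 2 = (y :: 'a::real_vector)"
  by (simp add: scaleR_left_distrib[symmetric])

lemma one_plus_norm_midpoint_le: "1 + norm y \<le> (1 + norm (x + y /\<^sub>R 2)) * (1 + norm (x - y /\<^sub>R 2))"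
  for x y :: "'a::real_normed_vector"
proof -
  have "(x + y /\<^sub>R 2) + - (x - y /\<^sub>R 2) = y /\<^sub>R 2 + y /\<^sub>R 2" by simp
  then have "y = (x + y /\<^sub>R 2) + - (x - y /\<^sub>R 2)" by (simp only: half_add_half)
  then show ?thesis using one_plus_norm_add_le[of "x + y /\<^sub>R 2" "- (x - y /\<^sub>R 2)"]
    by (metis norm_minus_cancel)
qed

lemma one_plus_norm_le_midpoint: "1 + norm x \<le> (1 + norm (x + y /\<^sub>R 2)) * (1 + norm (x - y /\<^sub>R 2))"
  for x y :: "'a::real_normed_vector"
proof -
  have "(x + y /\<^sub>R 2) + (x - y /\<^sub>R 2) = 2 *\<^sub>R x" by (simp add: scaleR_2)
  then have "1 + norm (2 *\<^sub>R x) \<le> (1 + norm (x + y /\<^sub>R 2)) * (1 + norm (x - y /\<^sub>R 2))"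
    using one_plus_norm_add_le[of "x + y /\<^sub>R 2" "x - y /\<^sub>R 2"] by metis
  then show ?thesis by (rule order_trans[rotated]) simp
qed

text \<open>
  The sum and the difference of \<open>x + y / 2\<close> and \<open>x - y / 2\<close> are \<open>2 x\<close> and \<open>y\<close>, so decay of the two
  factors in their arguments gives decay in both variables.
\<close>

lemma cross_wigner_integrand_bound_both:
  assumes "f \<in> schwartz" "g \<in> schwartz"
  obtains B where "B > 0" "\<And>x y. ((1 + norm x) * (1 + norm y)) ^ N * cmod (f (x + y /\<^sub>R 2) * cnj (g (x - y /\<^sub>R 2))) \<le> B"
proof -
  obtain A where A: "A > 0" "\<And>x. (1 + norm x) ^ (2 * N) * cmod (f x) \<le> A" using schwartz_bound[OF assms(1), of "2 * N"] by blast
  obtain B where B: "B > 0" "\<And>x. (1 + norm x) ^ (2 * N) * cmod (g x) \<le> B" using schwartz_bound[OF assms(2), of "2 * N"] by blast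
  have "((1 + norm x) * (1 + norm y)) ^ N * cmod (f (x + y /\<^sub>R 2) * cnj (g (x - y /\<^sub>R 2))) \<le> A * B" for x y
  proof -
    let ?P = "(1 + norm (x + y /\<^sub>R 2)) * (1 + norm (x - y /\<^sub>R 2))"
    have "((1 + norm x) * (1 + norm y)) ^ N * cmod (f (x + y /\<^sub>R 2) * cnj (g (x - y /\<^sub>R 2)))
       \<le> (?P * ?P) ^ N * cmod (f (x + y /\<^sub>R 2) * cnj (g (x - y /\<^sub>R 2)))"
      by (intro mult_right_mono power_mono mult_mono one_plus_norm_midpoint_le one_plus_norm_le_midpoint) auto
    also have "\<dots> = ((1 + norm (x + y /\<^sub>R 2)) ^ (2 * N) * cmod (f (x + y /\<^sub>R 2))) * ((1 + norm (x - y /\<^sub>R 2)) ^ (2 * N) * cmod (g (x - y /\<^sub>R 2)))"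
      by (simp only: power_mult_distrib norm_mult complex_mod_cnj mult_2 mult_2_right power_add ac_simps)
    also have "\<dots> \<le> A * B" using A(1) by (intro mult_mono A B) auto
    finally show ?thesis .
  qed
  with A(1) B(1) show ?thesis by (intro that[of "A * B"]) auto
qed

lemma cross_wigner_integrand_bound:
  assumes "f \<in> schwartz" "g \<in> schwartz"
  obtains B where "B > 0" "\<And>x y. (1 + norm y) ^ N * cmod (f (x + y /\<^sub>R 2) * cnj (g (x - y /\<^sub>R 2))) \<le> B"
proof -
  obtain A where A: "A > 0" "\<And>x. (1 + norm x) ^ N * cmod (f x) \<le> A" using schwartz_bound[OF assms(1), of N] by blast
  obtain B where B: "B > 0" "\<And>x. (1 + norm x) ^ N * cmod (g x) \<le> B" using schwartz_bound[OF assms(2), of N] by blast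
  have "(1 + norm y) ^ N * cmod (f (x + y /\<^sub>R 2) * cnj (g (x - y /\<^sub>R 2))) \<le> A * B" for x y
  proof -
    have "(1 + norm y) ^ N * cmod (f (x + y /\<^sub>R 2) * cnj (g (x - y /\<^sub>R 2)))
       \<le> ((1 + norm (x + y /\<^sub>R 2)) * (1 + norm (x - y /\<^sub>R 2))) ^ N * cmod (f (x + y /\<^sub>R 2) * cnj (g (x - y /\<^sub>R 2)))"
      by (intro mult_right_mono power_mono one_plus_norm_midpoint_le) auto
    also have "\<dots> = ((1 + norm (x + y /\<^sub>R 2)) ^ N * cmod (f (x + y /\<^sub>R 2))) * ((1 + norm (x - y /\<^sub>R 2)) ^ N * cmod (g (x - y /\<^sub>R 2)))"
      by (simp only: power_mult_distrib norm_mult complex_mod_cnj mult_ac)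
    also have "\<dots> \<le> A * B" using A(1) by (intro mult_mono A B) auto
    finally show ?thesis .
  qed
  with A(1) B(1) show ?thesis by (intro that[of "A * B"]) auto
qed

lemma cnj_measurable[measurable]: "cnj \<in> borel_measurable borel"
  by (intro borel_measurable_continuous_onI continuous_intros)

lemma cross_wigner_integrand_integrable:
  fixes f g :: "'a::euclidean_space \<Rightarrow> complex"
  assumes f: "f \<in> schwartz" and g: "g \<in> schwartz"
  shows "integrable lborel (\<lambda>y. f (x + y /\<^sub>R 2) * cnj (g (x - y /\<^sub>R 2)) * cis (- 2 * pi * (y \<bullet> \<xi>)))"
proof -
  have [measurable]: "f \<in> borel_measurable borel" "g \<in> borel_measurable borel"
    by (intro borel_measurable_schwartz f g)+
  have m: "(\<lambda>y. f (x + y /\<^sub>R 2) * cnj (g (x - y /\<^sub>R 2))) \<in> borel_measurable borel" by measurable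
  obtain B where "\<And>y. (1 + norm y) ^ (2 * DIM('a)) * cmod (f (x + y /\<^sub>R 2) * cnj (g (x - y /\<^sub>R 2))) \<le> B"
    using cross_wigner_integrand_bound[OF f g] by metis
  with m show ?thesis by (intro fourier_integrable(1) integrable_polynomial_decay(1))
qed

lemma cross_wigner_polynomial_decay:
  fixes f g :: "'a::euclidean_space \<Rightarrow> complex"
  assumes f: "f \<in> schwartz" and g: "g \<in> schwartz"
  obtains B where "B > 0" "\<And>x \<xi>. (1 + norm x) ^ M * cmod (cross_wigner f g (x, \<xi>)) \<le> B"
proof -
  define N where "N = 2 * DIM('a)"
  have [measurable]: "f \<in> borel_measurable borel" "g \<in> borel_measurable borel"
    by (intro borel_measurable_schwartz f g)+
  define W where "W = (LINT y::'a|lborel. 1 / (1 + norm y) ^ N)"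
  have W: "W \<ge> 0" unfolding W_def by (intro integral_nonneg_AE always_eventually allI) simp
  obtain B where B: "B > 0" "\<And>x y. ((1 + norm x) * (1 + norm y)) ^ (M + N) * cmod (f (x + y /\<^sub>R 2) * cnj (g (x - y /\<^sub>R 2))) \<le> B"
    using cross_wigner_integrand_bound_both[OF f g, of "M + N"] by blast
  have "(1 + norm x) ^ M * cmod (cross_wigner f g (x, \<xi>)) \<le> B * W" for x \<xi>
  proof -
    have decay: "(1 + norm y) ^ N * cmod (of_real ((1 + norm x) ^ M) * (f (x + y /\<^sub>R 2) * cnj (g (x - y /\<^sub>R 2)))) \<le> B" for y
    proof -
      have "(1 + norm x) ^ M * (1 + norm y) ^ N \<le> ((1 + norm x) * (1 + norm y)) ^ (M + N)"
        unfolding power_mult_distrib by (intro mult_mono power_increasing) auto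
      then have "(1 + norm x) ^ M * (1 + norm y) ^ N * cmod (f (x + y /\<^sub>R 2) * cnj (g (x - y /\<^sub>R 2))) \<le> B"
        by (rule order_trans[OF mult_right_mono B(2)]) simp
      then show ?thesis by (simp add: norm_mult mult_ac del: of_real_power of_real_add)
    qed
    have "(1 + norm x) ^ M * cmod (cross_wigner f g (x, \<xi>)) \<le> (1 + norm x) ^ M * (LINT y|lborel. cmod (f (x + y /\<^sub>R 2) * cnj (g (x - y /\<^sub>R 2)) * cis (- 2 * pi * (y \<bullet> \<xi>))))"
      unfolding cross_wigner_eq fst_conv snd_conv by (intro mult_left_mono integral_norm_bound) simp
    also have "\<dots> = (LINT y|lborel. cmod (of_real ((1 + norm x) ^ M) * (f (x + y /\<^sub>R 2) * cnj (g (x - y /\<^sub>R 2)))))"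
      by (simp add: norm_mult del: of_real_power of_real_add)
    also have "\<dots> \<le> B * W" unfolding W_def N_def
      by (rule integrable_polynomial_decay(2)[OF _ decay[unfolded N_def]]) measurable
    finally show ?thesis .
  qed
  then have "\<And>x \<xi>. (1 + norm x) ^ M * cmod (cross_wigner f g (x, \<xi>)) \<le> B * W + 1" by (meson add_increasing2 zero_le_one)
  moreover have "B * W + 1 > 0" using B W by (intro add_nonneg_pos) auto
  ultimately show ?thesis using that by blast
qed

lemma cross_wigner_bounded:
  fixes f g :: "'a::euclidean_space \<Rightarrow> complex"
  assumes f: "f \<in> schwartz" and g: "g \<in> schwartz"
  obtains B where "B > 0" "\<And>p. cmod (cross_wigner f g p) \<le> B"
  using cross_wigner_polynomial_decay[OF f g, of 0] by auto

definition gradient_apply :: "('a::euclidean_space \<Rightarrow> complex) \<Rightarrow> 'a \<Rightarrow> 'a \<Rightarrow> complex" where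
  "gradient_apply f x v = (\<Sum>b\<in>Basis. (v \<bullet> b) *\<^sub>R partial_deriv b f x)"

lemma gradient_apply_Basis: "b \<in> Basis \<Longrightarrow> gradient_apply f x b = partial_deriv b f x"
  by (simp add: gradient_apply_def inner_Basis if_distrib[of "\<lambda>c. c *\<^sub>R _"] cong: if_cong)

lemma gradient_apply_0: "gradient_apply f x 0 = 0"
  by (simp add: gradient_apply_def)

lemma cmod_gradient_apply_le: "cmod (gradient_apply f x v) \<le> norm v * (\<Sum>b\<in>Basis. cmod (partial_deriv b f x))"
  unfolding gradient_apply_def sum_distrib_left
  by (intro sum_norm_le) (auto intro!: mult_right_mono Basis_le_norm)

lemma has_derivative_gradient_apply:
  "f \<in> schwartz \<Longrightarrow> (f has_derivative gradient_apply f x) (at x)"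
  using has_derivative_partial_deriv[OF schwartz_differentiable] by (simp add: gradient_apply_def[abs_def])

text \<open>
  The derivative of the integrand at \<open>y\<close> with respect to the point \<open>p\<close> of phase space, in the
  direction \<open>v\<close>.
\<close>

definition cross_wigner_integrand_deriv ::
    "('a::euclidean_space \<Rightarrow> complex) \<Rightarrow> ('a \<Rightarrow> complex) \<Rightarrow> 'a \<Rightarrow> 'a \<times> 'a \<Rightarrow> 'a \<times> 'a \<Rightarrow> complex" where
  "cross_wigner_integrand_deriv f g y p v =
     f (fst p + y /\<^sub>R 2) * cnj (g (fst p - y /\<^sub>R 2)) * ((\<i> * of_real (- 2 * pi * (snd v \<bullet> y))) * cis (- 2 * pi * (snd p \<bullet> y)))
     + (f (fst p + y /\<^sub>R 2) * cnj (gradient_apply g (fst p - y /\<^sub>R 2) (fst v))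
        + gradient_apply f (fst p + y /\<^sub>R 2) (fst v) * cnj (g (fst p - y /\<^sub>R 2))) * cis (- 2 * pi * (snd p \<bullet> y))"

lemma cross_wigner_has_derivative:
  fixes f g :: "'a::euclidean_space \<Rightarrow> complex"
  assumes f: "f \<in> schwartz" and g: "g \<in> schwartz"
  shows "(cross_wigner f g has_derivative (\<lambda>v. LINT y|lborel. cross_wigner_integrand_deriv f g y p v)) (at p)"
proof -
  define N where "N = 2 * DIM('a)"
  obtain A where A: "\<And>x y. (1 + norm y) ^ (N + 1) * cmod (f (x + y /\<^sub>R 2) * cnj (g (x - y /\<^sub>R 2))) \<le> A"
    using cross_wigner_integrand_bound[OF f g] by metis
  have "\<forall>b. \<exists>B. b \<in> Basis \<longrightarrow> (\<forall>x y. (1 + norm y) ^ N * cmod (partial_deriv b f (x + y /\<^sub>R 2) * cnj (g (x - y /\<^sub>R 2))) \<le> B)"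
    using cross_wigner_integrand_bound[OF schwartz_partial_deriv[OF f] g] by metis
  then obtain B where B: "\<And>b x y. b \<in> Basis \<Longrightarrow> (1 + norm y) ^ N * cmod (partial_deriv b f (x + y /\<^sub>R 2) * cnj (g (x - y /\<^sub>R 2))) \<le> B b"
    by metis
  have "\<forall>b. \<exists>B. b \<in> Basis \<longrightarrow> (\<forall>x y. (1 + norm y) ^ N * cmod (f (x + y /\<^sub>R 2) * cnj (partial_deriv b g (x - y /\<^sub>R 2))) \<le> B)"
    using cross_wigner_integrand_bound[OF f schwartz_partial_deriv[OF g]] by metis
  then obtain C where C: "\<And>b x y. b \<in> Basis \<Longrightarrow> (1 + norm y) ^ N * cmod (f (x + y /\<^sub>R 2) * cnj (partial_deriv b g (x - y /\<^sub>R 2))) \<le> C b"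
    by metis
  define K where "K = 2 * pi * A + (\<Sum>b\<in>Basis. C b) + (\<Sum>b\<in>Basis. B b)"
  have "((\<lambda>p. LINT y|lborel. f (fst p + y /\<^sub>R 2) * cnj (g (fst p - y /\<^sub>R 2)) * cis (- 2 * pi * (snd p \<bullet> y)))
     has_derivative (\<lambda>v. LINT y|lborel. cross_wigner_integrand_deriv f g y p v)) (at p)"
  proof (rule has_derivative_integral(1))
    show "integrable lborel (\<lambda>y. f (fst q + y /\<^sub>R 2) * cnj (g (fst q - y /\<^sub>R 2)) * cis (- 2 * pi * (snd q \<bullet> y)))" for q
      unfolding inner_commute[of "snd q"] by (rule cross_wigner_integrand_integrable[OF f g])
    show "integrable lborel (\<lambda>y::'a. K * (1 / (1 + norm y) ^ N))"
      unfolding N_def by (intro integrable_mult_right integrable_inverse_one_plus_norm)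
    fix y :: 'a and q :: "'a \<times> 'a"
    have 1: "((\<lambda>q. fst q + y /\<^sub>R 2) has_derivative fst) (at q)" "((\<lambda>q. fst q - y /\<^sub>R 2) has_derivative fst) (at q)"
      by (auto intro!: derivative_eq_intros)
    have 2: "((\<lambda>q. cis (- 2 * pi * (snd q \<bullet> y))) has_derivative
        (\<lambda>v. (\<i> * of_real (- 2 * pi * (snd v \<bullet> y))) * cis (- 2 * pi * (snd q \<bullet> y)))) (at q)"
      by (rule has_derivative_compose[OF has_derivative_snd[OF has_derivative_ident] has_derivative_cis_inner])
    show "((\<lambda>q. f (fst q + y /\<^sub>R 2) * cnj (g (fst q - y /\<^sub>R 2)) * cis (- 2 * pi * (snd q \<bullet> y))) has_derivative
         cross_wigner_integrand_deriv f g y q) (at q)"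
      unfolding cross_wigner_integrand_deriv_def[abs_def]
      by (intro has_derivative_mult has_derivative_compose[OF 1(1) has_derivative_gradient_apply[OF f]]
        bounded_linear.has_derivative[OF bounded_linear_cnj] has_derivative_compose[OF 1(2) has_derivative_gradient_apply[OF g]] 2)
    fix v :: "'a \<times> 'a"
    let ?x = "fst q"
    have nf: "norm (fst v) \<le> norm v" "norm (snd v) \<le> norm v"
      using norm_fst_le[of "fst v" "snd v"] norm_snd_le[of "snd v" "fst v"] by simp_all
    have t1: "cmod (f (?x + y /\<^sub>R 2) * cnj (g (?x - y /\<^sub>R 2)) * ((\<i> * of_real (- 2 * pi * (snd v \<bullet> y))) * cis (- 2 * pi * (snd q \<bullet> y))))
        \<le> norm v * (2 * pi * A * (1 / (1 + norm y) ^ N))"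
    proof -
      have "norm y * (1 + norm y) ^ N * cmod (f (?x + y /\<^sub>R 2) * cnj (g (?x - y /\<^sub>R 2)))
         \<le> (1 + norm y) ^ (N + 1) * cmod (f (?x + y /\<^sub>R 2) * cnj (g (?x - y /\<^sub>R 2)))"
        by (intro mult_right_mono) (simp_all add: algebra_simps)
      also have "\<dots> \<le> A" by (rule A)
      finally have yA: "norm y * cmod (f (?x + y /\<^sub>R 2) * cnj (g (?x - y /\<^sub>R 2))) \<le> A * (1 / (1 + norm y) ^ N)"
        by (simp add: field_simps add_pos_nonneg)
      have "\<bar>snd v \<bullet> y\<bar> \<le> norm v * norm y"
        by (rule order_trans[OF Cauchy_Schwarz_ineq2 mult_right_mono[OF nf(2)]]) simp
      then have "cmod (f (?x + y /\<^sub>R 2) * cnj (g (?x - y /\<^sub>R 2))) * (2 * pi * \<bar>snd v \<bullet> y\<bar>)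
          \<le> cmod (f (?x + y /\<^sub>R 2) * cnj (g (?x - y /\<^sub>R 2))) * (2 * pi * (norm v * norm y))"
        by (intro mult_left_mono) auto
      also have "\<dots> = (norm v * (2 * pi)) * (norm y * cmod (f (?x + y /\<^sub>R 2) * cnj (g (?x - y /\<^sub>R 2))))" by (simp only: mult_ac)
      also have "\<dots> \<le> (norm v * (2 * pi)) * (A * (1 / (1 + norm y) ^ N))"
        by (intro mult_left_mono yA) auto
      finally show ?thesis by (simp add: norm_mult abs_mult mult_ac)
    qed
    have t2: "cmod (f (?x + y /\<^sub>R 2) * cnj (gradient_apply g (?x - y /\<^sub>R 2) (fst v))) \<le> norm v * ((\<Sum>b\<in>Basis. C b) * (1 / (1 + norm y) ^ N))"
    proof -
      have "cmod (f (?x + y /\<^sub>R 2) * cnj (gradient_apply g (?x - y /\<^sub>R 2) (fst v)))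
         \<le> cmod (f (?x + y /\<^sub>R 2)) * (norm v * (\<Sum>b\<in>Basis. cmod (partial_deriv b g (?x - y /\<^sub>R 2))))"
        unfolding norm_mult complex_mod_cnj
        by (intro mult_left_mono order_trans[OF cmod_gradient_apply_le] mult_right_mono nf sum_nonneg) auto
      also have "\<dots> = norm v * (\<Sum>b\<in>Basis. cmod (f (?x + y /\<^sub>R 2) * cnj (partial_deriv b g (?x - y /\<^sub>R 2))))"
        by (simp add: norm_mult sum_distrib_left mult_ac)
      also have "\<dots> \<le> norm v * (\<Sum>b\<in>Basis. C b * (1 / (1 + norm y) ^ N))"
        using C[of _ y ?x] by (intro mult_left_mono sum_mono) (simp_all add: field_simps add_pos_nonneg)
      finally show ?thesis by (simp only: sum_distrib_right)
    qed
    have t3: "cmod (gradient_apply f (?x + y /\<^sub>R 2) (fst v) * cnj (g (?x - y /\<^sub>R 2))) \<le> norm v * ((\<Sum>b\<in>Basis. B b) * (1 / (1 + norm y) ^ N))"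
    proof -
      have "cmod (gradient_apply f (?x + y /\<^sub>R 2) (fst v) * cnj (g (?x - y /\<^sub>R 2)))
         \<le> (norm v * (\<Sum>b\<in>Basis. cmod (partial_deriv b f (?x + y /\<^sub>R 2)))) * cmod (g (?x - y /\<^sub>R 2))"
        unfolding norm_mult complex_mod_cnj
        by (intro mult_right_mono order_trans[OF cmod_gradient_apply_le] nf sum_nonneg) auto
      also have "\<dots> = norm v * (\<Sum>b\<in>Basis. cmod (partial_deriv b f (?x + y /\<^sub>R 2) * cnj (g (?x - y /\<^sub>R 2))))"
        by (simp add: norm_mult sum_distrib_left sum_distrib_right mult_ac)
      also have "\<dots> \<le> norm v * (\<Sum>b\<in>Basis. B b * (1 / (1 + norm y) ^ N))"
        using B[of _ y ?x] by (intro mult_left_mono sum_mono) (simp_all add: field_simps add_pos_nonneg)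
      finally show ?thesis by (simp only: sum_distrib_right)
    qed
    have "cmod (cross_wigner_integrand_deriv f g y q v) \<le> norm v * (2 * pi * A * (1 / (1 + norm y) ^ N))
       + (norm v * ((\<Sum>b\<in>Basis. C b) * (1 / (1 + norm y) ^ N)) + norm v * ((\<Sum>b\<in>Basis. B b) * (1 / (1 + norm y) ^ N)))"
      unfolding cross_wigner_integrand_deriv_def
    proof (rule norm_triangle_le[OF add_mono[OF t1]])
      show "cmod ((f (?x + y /\<^sub>R 2) * cnj (gradient_apply g (?x - y /\<^sub>R 2) (fst v)) + gradient_apply f (?x + y /\<^sub>R 2) (fst v) * cnj (g (?x - y /\<^sub>R 2))) * cis (- 2 * pi * (snd q \<bullet> y)))
        \<le> norm v * ((\<Sum>b\<in>Basis. C b) * (1 / (1 + norm y) ^ N)) + norm v * ((\<Sum>b\<in>Basis. B b) * (1 / (1 + norm y) ^ N))"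
        unfolding norm_mult[of _ "cis _"] norm_cis mult_1_right
        by (rule norm_triangle_le[OF add_mono[OF t2 t3]])
    qed
    also have "\<dots> = K * (1 / (1 + norm y) ^ N) * norm v"
      by (simp only: K_def distrib_left distrib_right mult_ac add_ac)
    finally show "cmod (cross_wigner_integrand_deriv f g y q v) \<le> K * (1 / (1 + norm y) ^ N) * norm v" .
  qed
  then show ?thesis unfolding cross_wigner_eq[abs_def] inner_commute[of "snd _"] by simp
qed

text \<open>
  A frequency derivative brings down the factor \<open>y \<bullet> b\<close>. Being the difference of the coordinates of
  \<open>x + y / 2\<close> and \<open>x - y / 2\<close>, it can be distributed over the two functions, so that derivatives of
  cross-Wigner distributions are combinations of cross-Wigner distributions.
\<close>

lemma partial_deriv_cross_wigner:
  fixes f g :: "'a::euclidean_space \<Rightarrow> complex"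
  assumes f: "f \<in> schwartz" and g: "g \<in> schwartz" and b: "b \<in> Basis"
  shows "partial_deriv (b, 0) (cross_wigner f g)
      = (\<lambda>p. cross_wigner f (partial_deriv b g) p + cross_wigner (partial_deriv b f) g p)"
    and "partial_deriv (0, b) (cross_wigner f g)
      = (\<lambda>p. (- (\<i> * of_real (2 * pi))) * (cross_wigner (\<lambda>x. of_real (x \<bullet> b) * f x) g p
                  + (- 1) * cross_wigner f (\<lambda>x. of_real (x \<bullet> b) * g x) p))"
proof -
  note f' = schwartz_partial_deriv[OF f b] and g' = schwartz_partial_deriv[OF g b]
  show "partial_deriv (b, 0) (cross_wigner f g) = (\<lambda>p. cross_wigner f (partial_deriv b g) p + cross_wigner (partial_deriv b f) g p)"
  proof
    fix p :: "'a \<times> 'a"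
    have "cross_wigner_integrand_deriv f g y p (b, 0) =
       f (fst p + y /\<^sub>R 2) * cnj (partial_deriv b g (fst p - y /\<^sub>R 2)) * cis (- 2 * pi * (y \<bullet> snd p))
       + partial_deriv b f (fst p + y /\<^sub>R 2) * cnj (g (fst p - y /\<^sub>R 2)) * cis (- 2 * pi * (y \<bullet> snd p))" for y
      by (simp add: cross_wigner_integrand_deriv_def gradient_apply_Basis[OF b] inner_commute distrib_right)
    then show "partial_deriv (b, 0) (cross_wigner f g) p = cross_wigner f (partial_deriv b g) p + cross_wigner (partial_deriv b f) g p"
      unfolding partial_deriv_eq[OF cross_wigner_has_derivative[OF f g]] cross_wigner_eq
      by (simp only: Bochner_Integration.integral_add[OF cross_wigner_integrand_integrable[OF f g'] cross_wigner_integrand_integrable[OF f' g]])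
  qed
  show "partial_deriv (0, b) (cross_wigner f g)
      = (\<lambda>p. (- (\<i> * of_real (2 * pi))) * (cross_wigner (\<lambda>x. of_real (x \<bullet> b) * f x) g p
                  + (- 1) * cross_wigner f (\<lambda>x. of_real (x \<bullet> b) * g x) p))"
  proof
    fix p :: "'a \<times> 'a"
    define F where "F = (\<lambda>y. of_real ((fst p + y /\<^sub>R 2) \<bullet> b) * f (fst p + y /\<^sub>R 2) * cnj (g (fst p - y /\<^sub>R 2)) * cis (- 2 * pi * (y \<bullet> snd p)))"
    define G where "G = (\<lambda>y. f (fst p + y /\<^sub>R 2) * cnj (of_real ((fst p - y /\<^sub>R 2) \<bullet> b) * g (fst p - y /\<^sub>R 2)) * cis (- 2 * pi * (y \<bullet> snd p)))"
    have F: "integrable lborel F" unfolding F_def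
      using cross_wigner_integrand_integrable[OF schwartz_inner_mult[OF f] g] .
    have G: "integrable lborel G" unfolding G_def
      using cross_wigner_integrand_integrable[OF f schwartz_inner_mult[OF g]] .
    have "cross_wigner_integrand_deriv f g y p (0, b) = (- (\<i> * of_real (2 * pi))) * (F y + (- 1) * G y)" for y
    proof -
      have "(fst p + y /\<^sub>R 2) - (fst p - y /\<^sub>R 2) = y" using half_add_half[of y] by simp
      then have "b \<bullet> y = (fst p + y /\<^sub>R 2) \<bullet> b - (fst p - y /\<^sub>R 2) \<bullet> b" by (metis inner_commute inner_diff_left)
      then show ?thesis
        by (simp add: cross_wigner_integrand_deriv_def F_def G_def gradient_apply_0 inner_commute[of "snd p"] algebra_simps)
    qed
    then have "partial_deriv (0, b) (cross_wigner f g) p = (LINT y|lborel. (- (\<i> * of_real (2 * pi))) * (F y + (- 1) * G y))"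
      unfolding partial_deriv_eq[OF cross_wigner_has_derivative[OF f g]] by simp
    also have "\<dots> = (- (\<i> * of_real (2 * pi))) * ((LINT y|lborel. F y) + (- 1) * (LINT y|lborel. G y))"
      using F G by (simp only: integral_mult_right_zero Bochner_Integration.integral_add integrable_mult_right)
    finally show "partial_deriv (0, b) (cross_wigner f g) p = (- (\<i> * of_real (2 * pi))) * (cross_wigner (\<lambda>x. of_real (x \<bullet> b) * f x) g p
                  + (- 1) * cross_wigner f (\<lambda>x. of_real (x \<bullet> b) * g x) p)"
      by (simp only: cross_wigner_eq F_def G_def)
  qed
qed

lemma smooth_cross_wigner:
  fixes f g :: "'a::euclidean_space \<Rightarrow> complex"
  assumes f: "f \<in> schwartz" and g: "g \<in> schwartz"
  shows "smooth (cross_wigner f g)"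
proof (rule derivs_coinduct(1)[where P = "\<lambda>h. \<exists>f\<in>schwartz. \<exists>g\<in>schwartz. h = cross_wigner f g" and Q = "\<lambda>_. True"])
  fix h :: "'a \<times> 'a \<Rightarrow> complex"
  assume "\<exists>f\<in>schwartz. \<exists>g\<in>schwartz. h = cross_wigner f g"
  then obtain f g where fg: "f \<in> schwartz" "g \<in> schwartz" and h: "h = cross_wigner f g" by blast
  show "h differentiable (at x)" for x
    unfolding h using cross_wigner_has_derivative[OF fg] by (rule differentiableI)
  fix b :: "'a \<times> 'a" assume "b \<in> Basis"
  then consider c where "c \<in> Basis" "b = (c, 0)" | c where "c \<in> Basis" "b = (0, c)"
    by (auto simp: Basis_prod_def)
  then show "lin_span (\<lambda>h. \<exists>f\<in>schwartz. \<exists>g\<in>schwartz. h = cross_wigner f g) (partial_deriv b h)"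
  proof cases
    case 1
    show ?thesis unfolding h 1(2) partial_deriv_cross_wigner(1)[OF fg 1(1)]
      by (intro lin_span.add; rule lin_span.base) (use fg 1 schwartz_partial_deriv in blast)+
  next
    case 2
    show ?thesis unfolding h 2(2) partial_deriv_cross_wigner(2)[OF fg 2(1)]
      by (intro lin_span.scale lin_span.add; rule lin_span.base) (use fg schwartz_inner_mult in blast)+
  qed
qed (use f g in auto)

lemma integrable_exp_norm_square:
  "c > 0 \<Longrightarrow> integrable lborel (\<lambda>x::'a::euclidean_space. exp (- c * (norm x)\<^sup>2))"
  using integrable_norm[OF integrable_schwartz[OF schwartz_gaussian[of c]]] by simp

lemma parallelogram_law: "(norm (x + y))\<^sup>2 + (norm (x - y))\<^sup>2 = 2 * (norm x)\<^sup>2 + 2 * (norm y)\<^sup>2"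
  for x y :: "'a::real_inner"
  by (simp add: power2_norm_eq_inner inner_add_left inner_add_right inner_diff_left inner_diff_right inner_commute)

text \<open>
  By the parallelogram law the exponents at \<open>x + y / 2\<close> and \<open>x - y / 2\<close> add up to
  \<open>2 (norm x)\<^sup>2 + (norm y)\<^sup>2 / 2\<close>.
\<close>

lemma cross_wigner_decay_position:
  fixes f g :: "'a::euclidean_space \<Rightarrow> complex"
  assumes f: "\<And>x. cmod (f x) \<le> K * exp (- \<delta> * (norm x)\<^sup>2)" and g: "\<And>x. cmod (g x) \<le> K * exp (- \<delta> * (norm x)\<^sup>2)"
    and \<delta>: "\<delta> > 0"
  shows "cmod (cross_wigner f g (x, \<xi>)) \<le> K\<^sup>2 * (LINT y::'a|lborel. exp (- (\<delta> / 2) * (norm y)\<^sup>2)) * exp (- 2 * \<delta> * (norm x)\<^sup>2)"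
proof -
  have K: "K \<ge> 0" using order_trans[OF norm_ge_zero f[of 0]] by simp
  have int: "integrable lborel (\<lambda>y::'a. K\<^sup>2 * exp (- 2 * \<delta> * (norm x)\<^sup>2) * exp (- (\<delta> / 2) * (norm y)\<^sup>2))"
    using \<delta> by (intro integrable_mult_right integrable_exp_norm_square) simp
  have "cmod (cross_wigner f g (x, \<xi>)) \<le> (LINT y::'a|lborel. K\<^sup>2 * exp (- 2 * \<delta> * (norm x)\<^sup>2) * exp (- (\<delta> / 2) * (norm y)\<^sup>2))"
    unfolding cross_wigner_eq fst_conv snd_conv
  proof (rule norm_lebesgue_integral_le[OF int])
    fix y :: 'a
    have "cmod (f (x + y /\<^sub>R 2) * cnj (g (x - y /\<^sub>R 2)) * cis (- 2 * pi * (y \<bullet> \<xi>)))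
       \<le> (K * exp (- \<delta> * (norm (x + y /\<^sub>R 2))\<^sup>2)) * (K * exp (- \<delta> * (norm (x - y /\<^sub>R 2))\<^sup>2))"
      unfolding norm_mult norm_cis complex_mod_cnj mult_1_right using K by (intro mult_mono f g) auto
    also have "\<dots> = K\<^sup>2 * exp (- \<delta> * ((norm (x + y /\<^sub>R 2))\<^sup>2 + (norm (x - y /\<^sub>R 2))\<^sup>2))"
      by (simp add: power2_eq_square exp_add[symmetric] distrib_left)
    also have "(norm (x + y /\<^sub>R 2))\<^sup>2 + (norm (x - y /\<^sub>R 2))\<^sup>2 = 2 * (norm x)\<^sup>2 + (norm y)\<^sup>2 / 2"
      unfolding parallelogram_law by (simp add: power_divide)
    also have "K\<^sup>2 * exp (- \<delta> * (2 * (norm x)\<^sup>2 + (norm y)\<^sup>2 / 2)) = K\<^sup>2 * exp (- 2 * \<delta> * (norm x)\<^sup>2) * exp (- (\<delta> / 2) * (norm y)\<^sup>2)"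
      by (simp add: exp_add[symmetric] algebra_simps)
    finally show "cmod (f (x + y /\<^sub>R 2) * cnj (g (x - y /\<^sub>R 2)) * cis (- 2 * pi * (y \<bullet> \<xi>)))
      \<le> K\<^sup>2 * exp (- 2 * \<delta> * (norm x)\<^sup>2) * exp (- (\<delta> / 2) * (norm y)\<^sup>2)" .
  qed
  then show ?thesis by (simp add: mult_ac)
qed

text \<open>
  The formula on the frequency side. After the first inverse transform is written out and the
  integrals are exchanged, the substitution \<open>y = 2 (x - q)\<close> leaves the Fourier transform of the second
  inverse transform at \<open>2 \<xi> - \<eta>\<close>, which Fourier inversion evaluates.
\<close>

lemma cross_wigner_inv_fourier:
  fixes f g :: "'a::euclidean_space \<Rightarrow> complex"
  assumes f: "f \<in> schwartz" and g: "g \<in> schwartz"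
  shows "cross_wigner (inv_fourier f) (inv_fourier g) (x, \<xi>)
    = of_real (2 ^ DIM('a)) * (LINT \<eta>|lborel. f \<eta> * cnj (g (2 *\<^sub>R \<xi> - \<eta>)) * cis (2 * pi * (x \<bullet> (2 *\<^sub>R \<eta> - 2 *\<^sub>R \<xi>))))"
proof -
  define r where "r = inv_fourier g"
  have r: "r \<in> schwartz" unfolding r_def by (rule schwartz_inv_fourier[OF g])
  have [measurable]: "f \<in> borel_measurable borel" "r \<in> borel_measurable borel"
    by (intro borel_measurable_schwartz f r)+
  define F where "F y \<eta> = f \<eta> * cis (2 * pi * ((x + y /\<^sub>R 2) \<bullet> \<eta>)) * (cnj (r (x - y /\<^sub>R 2)) * cis (- 2 * pi * (y \<bullet> \<xi>)))" for y \<eta>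
  have r2: "(\<lambda>y. r ((- 1 / 2) *\<^sub>R y + x)) \<in> schwartz" by (intro schwartz_affine r) auto
  have int: "integrable lborel (\<lambda>(y, \<eta>). F y \<eta>)"
  proof (rule Bochner_Integration.integrable_bound)
    show "integrable lborel (\<lambda>(y::'a, \<eta>). r ((- 1 / 2) *\<^sub>R y + x) * f \<eta>)"
      by (intro integrable_tensor integrable_schwartz f r2)
    show "(\<lambda>(y, \<eta>). F y \<eta>) \<in> borel_measurable lborel"
      unfolding F_def lborel_prod[symmetric] by measurable
    have rx: "(- 1 / 2) *\<^sub>R y + x = x - y /\<^sub>R 2" for y by simp
    show "AE z in lborel. norm (case z of (y, \<eta>) \<Rightarrow> F y \<eta>) \<le> norm (case z of (y, \<eta>) \<Rightarrow> r ((- 1 / 2) *\<^sub>R y + x) * f \<eta>)"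
      unfolding rx F_def by (intro always_eventually allI) (simp add: case_prod_beta norm_mult)
  qed
  have "(LINT \<eta>|lborel. F y \<eta>) = inv_fourier f (x + y /\<^sub>R 2) * cnj (r (x - y /\<^sub>R 2)) * cis (- 2 * pi * (y \<bullet> \<xi>))" for y
    unfolding F_def integral_mult_left_zero inv_fourier_def by (rule mult.assoc[symmetric])
  then have "cross_wigner (inv_fourier f) (inv_fourier g) (x, \<xi>) = (LINT y|lborel. LINT \<eta>|lborel. F y \<eta>)"
    by (simp only: cross_wigner_eq r_def fst_conv snd_conv)
  also have "\<dots> = (LINT \<eta>|lborel. LINT y|lborel. F y \<eta>)" by (rule integral_lborel_swap[OF int])
  also have "\<dots> = (LINT \<eta>|lborel. of_real (2 ^ DIM('a)) * (f \<eta> * cnj (g (2 *\<^sub>R \<xi> - \<eta>)) * cis (2 * pi * (x \<bullet> (2 *\<^sub>R \<eta> - 2 *\<^sub>R \<xi>)))))"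
  proof (intro Bochner_Integration.integral_cong refl)
    fix \<eta>
    have eq: "F (2 *\<^sub>R x + (- 2) *\<^sub>R q) \<eta> = (f \<eta> * cis (2 * pi * (x \<bullet> (2 *\<^sub>R \<eta> - 2 *\<^sub>R \<xi>)))) * cnj (r q * cis (- 2 * pi * (q \<bullet> (2 *\<^sub>R \<xi> - \<eta>))))" for q
    proof -
      have 1: "x + (2 *\<^sub>R x + (- 2) *\<^sub>R q) /\<^sub>R 2 = 2 *\<^sub>R x - q" "x - (2 *\<^sub>R x + (- 2) *\<^sub>R q) /\<^sub>R 2 = q"
      proof -
        have "(2 *\<^sub>R x + (- 2) *\<^sub>R q) /\<^sub>R 2 = x - q" by (simp add: scaleR_right_diff_distrib)
        then show "x + (2 *\<^sub>R x + (- 2) *\<^sub>R q) /\<^sub>R 2 = 2 *\<^sub>R x - q" "x - (2 *\<^sub>R x + (- 2) *\<^sub>R q) /\<^sub>R 2 = q"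
          by (simp_all add: scaleR_2)
      qed
      have "cis (2 * pi * ((2 *\<^sub>R x - q) \<bullet> \<eta>)) * cis (- 2 * pi * ((2 *\<^sub>R x + (- 2) *\<^sub>R q) \<bullet> \<xi>))
          = cis (2 * pi * (x \<bullet> (2 *\<^sub>R \<eta> - 2 *\<^sub>R \<xi>))) * cnj (cis (- 2 * pi * (q \<bullet> (2 *\<^sub>R \<xi> - \<eta>))))"
        unfolding cis_cnj cis_mult
        by (rule arg_cong[of _ _ cis]) (simp add: inner_diff_left inner_diff_right inner_add_left algebra_simps)
      then show ?thesis unfolding F_def 1 complex_cnj_mult by (simp only: mult_ac)
    qed
    have "(LINT q|lborel. F (2 *\<^sub>R x + (- 2) *\<^sub>R q) \<eta>) = (1 / \<bar>- 2\<bar> ^ DIM('a)) *\<^sub>R (LINT y|lborel. F y \<eta>)"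
      by (rule lborel_integral_affine(1)) (auto simp: F_def)
    then have "(LINT y|lborel. F y \<eta>) = of_real (2 ^ DIM('a)) * (LINT q|lborel. F (2 *\<^sub>R x + (- 2) *\<^sub>R q) \<eta>)"
      by (simp add: scaleR_conv_of_real)
    also have "(LINT q|lborel. F (2 *\<^sub>R x + (- 2) *\<^sub>R q) \<eta>) = (f \<eta> * cis (2 * pi * (x \<bullet> (2 *\<^sub>R \<eta> - 2 *\<^sub>R \<xi>)))) * cnj (fourier r (2 *\<^sub>R \<xi> - \<eta>))"
      unfolding eq fourier_def integral_mult_right_zero Bochner_Integration.integral_cnj ..
    also have "fourier r (2 *\<^sub>R \<xi> - \<eta>) = g (2 *\<^sub>R \<xi> - \<eta>)" unfolding r_def by (rule fourier_inversion[OF g])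
    finally show "(LINT y|lborel. F y \<eta>) = of_real (2 ^ DIM('a)) * (f \<eta> * cnj (g (2 *\<^sub>R \<xi> - \<eta>)) * cis (2 * pi * (x \<bullet> (2 *\<^sub>R \<eta> - 2 *\<^sub>R \<xi>))))"
      by (simp only: mult_ac)
  qed
  finally show ?thesis by (simp only: integral_mult_right_zero)
qed

text \<open>
  By the parallelogram law \<open>(norm \<eta>)\<^sup>2 + (norm (2 \<xi> - \<eta>))\<^sup>2\<close> equals
  \<open>2 (norm \<xi>)\<^sup>2 + 2 (norm (\<eta> - \<xi>))\<^sup>2\<close>, so the frequency-side formula inherits the decay of the
  functions before the transform.
\<close>

lemma cross_wigner_decay_frequency:
  fixes f g :: "'a::euclidean_space \<Rightarrow> complex"
  assumes fs: "f \<in> schwartz" "g \<in> schwartz"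
    and f: "\<And>x. cmod (f x) \<le> K * exp (- \<epsilon> * (norm x)\<^sup>2)" and g: "\<And>x. cmod (g x) \<le> K * exp (- \<epsilon> * (norm x)\<^sup>2)"
    and \<epsilon>: "\<epsilon> > 0"
  shows "cmod (cross_wigner (inv_fourier f) (inv_fourier g) (x, \<xi>))
    \<le> 2 ^ DIM('a) * (K\<^sup>2 * (LINT y::'a|lborel. exp (- (2 * \<epsilon>) * (norm y)\<^sup>2))) * exp (- 2 * \<epsilon> * (norm \<xi>)\<^sup>2)"
proof -
  have K: "K \<ge> 0" using order_trans[OF norm_ge_zero f[of 0]] by simp
  define h where "h y = exp (- (2 * \<epsilon>) * (norm (y::'a))\<^sup>2)" for y
  have hm: "h \<in> borel_measurable borel" unfolding h_def by measurable
  have hi: "integrable lborel h" unfolding h_def using \<epsilon> by (intro integrable_exp_norm_square) simp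
  have int: "integrable lborel (\<lambda>\<eta>. K\<^sup>2 * exp (- 2 * \<epsilon> * (norm \<xi>)\<^sup>2) * h (\<eta> + - \<xi>))"
    by (intro integrable_mult_right lborel_integral_translate(2) hm hi)
  have "cmod (LINT \<eta>|lborel. f \<eta> * cnj (g (2 *\<^sub>R \<xi> - \<eta>)) * cis (2 * pi * (x \<bullet> (2 *\<^sub>R \<eta> - 2 *\<^sub>R \<xi>))))
     \<le> (LINT \<eta>|lborel. K\<^sup>2 * exp (- 2 * \<epsilon> * (norm \<xi>)\<^sup>2) * h (\<eta> + - \<xi>))"
  proof (rule norm_lebesgue_integral_le[OF int])
    fix \<eta> :: 'a
    have "cmod (f \<eta> * cnj (g (2 *\<^sub>R \<xi> - \<eta>)) * cis (2 * pi * (x \<bullet> (2 *\<^sub>R \<eta> - 2 *\<^sub>R \<xi>))))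
       \<le> (K * exp (- \<epsilon> * (norm \<eta>)\<^sup>2)) * (K * exp (- \<epsilon> * (norm (2 *\<^sub>R \<xi> - \<eta>))\<^sup>2))"
      unfolding norm_mult norm_cis complex_mod_cnj mult_1_right using K by (intro mult_mono f g) auto
    also have "\<dots> = K\<^sup>2 * exp (- \<epsilon> * ((norm \<eta>)\<^sup>2 + (norm (2 *\<^sub>R \<xi> - \<eta>))\<^sup>2))"
      by (simp add: power2_eq_square exp_add[symmetric] distrib_left)
    also have "(norm \<eta>)\<^sup>2 + (norm (2 *\<^sub>R \<xi> - \<eta>))\<^sup>2 = 2 * (norm \<xi>)\<^sup>2 + 2 * (norm (\<eta> + - \<xi>))\<^sup>2"
      using parallelogram_law[of \<xi> "\<eta> + - \<xi>"] by (simp add: scaleR_2 algebra_simps)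
    also have "K\<^sup>2 * exp (- \<epsilon> * (2 * (norm \<xi>)\<^sup>2 + 2 * (norm (\<eta> + - \<xi>))\<^sup>2)) = K\<^sup>2 * exp (- 2 * \<epsilon> * (norm \<xi>)\<^sup>2) * h (\<eta> + - \<xi>)"
      by (simp add: h_def exp_add[symmetric] algebra_simps)
    finally show "cmod (f \<eta> * cnj (g (2 *\<^sub>R \<xi> - \<eta>)) * cis (2 * pi * (x \<bullet> (2 *\<^sub>R \<eta> - 2 *\<^sub>R \<xi>))))
      \<le> K\<^sup>2 * exp (- 2 * \<epsilon> * (norm \<xi>)\<^sup>2) * h (\<eta> + - \<xi>)" .
  qed
  also have "\<dots> = K\<^sup>2 * exp (- 2 * \<epsilon> * (norm \<xi>)\<^sup>2) * (LINT y|lborel. h y)"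
    unfolding integral_mult_right_zero lborel_integral_translate(1)[OF hm] ..
  finally have "2 ^ DIM('a) * cmod (LINT \<eta>|lborel. f \<eta> * cnj (g (2 *\<^sub>R \<xi> - \<eta>)) * cis (2 * pi * (x \<bullet> (2 *\<^sub>R \<eta> - 2 *\<^sub>R \<xi>))))
      \<le> 2 ^ DIM('a) * (K\<^sup>2 * exp (- 2 * \<epsilon> * (norm \<xi>)\<^sup>2) * (LINT y|lborel. h y))" by (rule mult_left_mono) simp
  then show ?thesis
    unfolding cross_wigner_inv_fourier[OF fs] norm_mult h_def by (simp add: norm_power mult_ac)
qed

section \<open>Wigner distributions of Fourier multipliers\<close>

lemma borel_measurable_cross_wigner:
  "f \<in> schwartz \<Longrightarrow> g \<in> schwartz \<Longrightarrow> cross_wigner f g \<in> borel_measurable borel"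
  by (intro borel_measurable_continuous_onI smooth_continuous_on smooth_cross_wigner)

lemma one_plus_norm_Pair_le: "1 + norm (x, y) \<le> (1 + norm x) * (1 + norm y)"
proof -
  have "0 \<le> norm x * norm y" by simp
  then show ?thesis
    using norm_Pair_le[of x y] unfolding distrib_left distrib_right mult_1_left mult_1_right by linarith
qed

lemma one_plus_norm_le_Pair: "1 + norm x \<le> 1 + norm (x, y)" "1 + norm y \<le> 1 + norm (x, y)"
  using norm_fst_le[of x y] norm_snd_le[of y x] by auto

lemma integrable_triple_decay:
  fixes F :: "'a::euclidean_space \<times> 'b::euclidean_space \<times> 'c::euclidean_space \<Rightarrow> complex"
  assumes "F \<in> borel_measurable borel"
    and "\<And>x y z. ((1 + norm x) * (1 + norm y) * (1 + norm z)) ^ (2 * DIM('a \<times> 'b \<times> 'c)) * cmod (F (x, y, z)) \<le> B"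
  shows "integrable lborel F"
proof (rule integrable_polynomial_decay(1)[OF assms(1)])
  fix p :: "'a \<times> 'b \<times> 'c"
  obtain x y z where p: "p = (x, y, z)" by (cases p)
  have "1 + norm p \<le> (1 + norm x) * ((1 + norm y) * (1 + norm z))"
    unfolding p by (intro order_trans[OF one_plus_norm_Pair_le] mult_left_mono one_plus_norm_Pair_le) simp
  then have "(1 + norm p) ^ (2 * DIM('a \<times> 'b \<times> 'c)) * cmod (F p)
     \<le> ((1 + norm x) * (1 + norm y) * (1 + norm z)) ^ (2 * DIM('a \<times> 'b \<times> 'c)) * cmod (F p)"
    by (intro mult_right_mono power_mono) (auto simp: mult.assoc)
  also have "\<dots> \<le> B" unfolding p by (rule assms(2))
  finally show "(1 + norm p) ^ (2 * DIM('a \<times> 'b \<times> 'c)) * cmod (F p) \<le> B" .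
qed

lemma schwartz_fourier_multiplier:
  "\<sigma> \<in> schwartz \<Longrightarrow> f \<in> schwartz \<Longrightarrow> fourier_multiplier \<sigma> f \<in> schwartz"
  unfolding fourier_multiplier_def by (intro schwartz_inv_fourier schwartz_mult schwartz_fourier)

lemma convolution_commute:
  fixes A B :: "'a::euclidean_space \<Rightarrow> complex"
  assumes A: "A \<in> borel_measurable borel" and B: "B \<in> borel_measurable borel"
  shows "(LINT u|lborel. A u * B (x - u)) = (LINT y|lborel. A (x - y) * B y)"
proof -
  have "(LINT y|lborel. A (x - y) * B (x - (x - y))) = (LINT u|lborel. A u * B (x - u))"
    by (rule lborel_integral_reflect(1)[of "\<lambda>u. A u * B (x - u)"]) (use A B in measurable)
  then show ?thesis by simp
qed

lemma fourier_multiplier_convolution: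
  fixes \<sigma> f :: "'a::euclidean_space \<Rightarrow> complex"
  assumes \<sigma>: "\<sigma> \<in> schwartz" and f: "f \<in> schwartz"
  shows "fourier_multiplier \<sigma> f x = (LINT s|lborel. inv_fourier \<sigma> s * f (x - s))"
proof -
  have [measurable]: "f \<in> borel_measurable borel" "\<sigma> \<in> borel_measurable borel" "inv_fourier \<sigma> \<in> borel_measurable borel"
    by (intro borel_measurable_schwartz f \<sigma> schwartz_inv_fourier)+
  define F where "F \<xi> t = \<sigma> \<xi> * f t * cis (2 * pi * ((x - t) \<bullet> \<xi>))" for \<xi> t
  have int: "integrable lborel (\<lambda>(\<xi>, t). F \<xi> t)"
  proof (rule Bochner_Integration.integrable_bound)
    show "integrable lborel (\<lambda>(\<xi>, t). \<sigma> \<xi> * f t)" by (intro integrable_tensor integrable_schwartz f \<sigma>)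
    show "(\<lambda>(\<xi>, t). F \<xi> t) \<in> borel_measurable lborel"
      unfolding F_def lborel_prod[symmetric] by measurable
    show "AE z in lborel. norm (case z of (\<xi>, t) \<Rightarrow> F \<xi> t) \<le> norm (case z of (\<xi>, t) \<Rightarrow> \<sigma> \<xi> * f t)"
      by (intro always_eventually allI) (simp add: F_def norm_mult case_prod_beta)
  qed
  have "fourier_multiplier \<sigma> f x = (LINT \<xi>|lborel. LINT t|lborel. F \<xi> t)"
    unfolding fourier_multiplier_def inv_fourier_def
  proof (intro Bochner_Integration.integral_cong refl)
    fix \<xi>
    have "F \<xi> t = (\<sigma> \<xi> * cis (2 * pi * (x \<bullet> \<xi>))) * (f t * cis (- 2 * pi * (t \<bullet> \<xi>)))" for t
    proof -
      have "cis (2 * pi * ((x - t) \<bullet> \<xi>)) = cis (2 * pi * (x \<bullet> \<xi>)) * cis (- 2 * pi * (t \<bullet> \<xi>))"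
        unfolding cis_mult by (rule arg_cong[of _ _ cis]) (simp add: inner_diff_left right_diff_distrib)
      then show ?thesis by (simp only: F_def mult_ac)
    qed
    then have "(LINT t|lborel. F \<xi> t) = (\<sigma> \<xi> * cis (2 * pi * (x \<bullet> \<xi>))) * fourier f \<xi>"
      unfolding fourier_def by (simp only:) (rule integral_mult_right_zero)
    then show "\<sigma> \<xi> * fourier f \<xi> * cis (2 * pi * (x \<bullet> \<xi>)) = (LINT t|lborel. F \<xi> t)"
      by (simp add: mult_ac)
  qed
  also have "\<dots> = (LINT t|lborel. LINT \<xi>|lborel. F \<xi> t)" by (rule integral_lborel_swap[OF int])
  also have "\<dots> = (LINT t|lborel. inv_fourier \<sigma> (x - t) * f t)"
  proof (intro Bochner_Integration.integral_cong refl)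
    fix t
    have "F \<xi> t = \<sigma> \<xi> * cis (2 * pi * ((x - t) \<bullet> \<xi>)) * f t" for \<xi> by (simp add: F_def mult_ac)
    then show "(LINT \<xi>|lborel. F \<xi> t) = inv_fourier \<sigma> (x - t) * f t"
      unfolding inv_fourier_def by (simp only:) (rule integral_mult_left_zero)
  qed
  also have "\<dots> = (LINT s|lborel. inv_fourier \<sigma> s * f (x - s))"
    by (rule convolution_commute[symmetric]) measurable
  finally show ?thesis .
qed

text \<open>
  The product of the two convolutions is an integral over pairs \<open>(s, t)\<close>. The substitution
  \<open>s = u + v / 2\<close>, \<open>t = u - v / 2\<close> separates the factor that depends on \<open>r\<close> from the integrand of
  \<open>cross_wigner f g\<close> at \<open>x - u\<close>, with \<open>y\<close> shifted by \<open>v\<close>. Undoing this shift contributes the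
  character of \<open>v\<close> that completes \<open>cross_wigner r r\<close>.
\<close>

lemma cross_wigner_convolution:
  fixes r f g :: "'a::euclidean_space \<Rightarrow> complex"
  assumes r: "r \<in> schwartz" and f: "f \<in> schwartz" and g: "g \<in> schwartz"
    and F: "\<And>x. F x = (LINT s|lborel. r s * f (x - s))" and G: "\<And>x. G x = (LINT s|lborel. r s * g (x - s))"
  shows "cross_wigner F G (x, \<xi>) = (LINT y|lborel. cross_wigner r r (x - y, \<xi>) * cross_wigner f g (y, \<xi>))"
proof -
  have meas[measurable]: "r \<in> borel_measurable borel" "f \<in> borel_measurable borel" "g \<in> borel_measurable borel"
    by (intro borel_measurable_schwartz r f g)+
  have cw_meas: "(\<lambda>z. cross_wigner f1 f2 (c z, \<xi>)) \<in> borel_measurable borel"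
    if "f1 \<in> schwartz" "f2 \<in> schwartz" "continuous_on UNIV c" for f1 f2 and c :: "'c::euclidean_space \<Rightarrow> 'a"
  proof -
    have "(\<lambda>z. (c z, \<xi>)) \<in> borel \<rightarrow>\<^sub>M borel"
      by (intro borel_measurable_continuous_onI continuous_intros that)
    from measurable_compose[OF this borel_measurable_cross_wigner[OF that(1,2)]] show ?thesis .
  qed
  define P where "P u v = r (u + v /\<^sub>R 2) * cnj (r (u - v /\<^sub>R 2))" for u v
  define Q where "Q u w = f ((x - u) + w /\<^sub>R 2) * cnj (g ((x - u) - w /\<^sub>R 2))" for u w
  define E where "E y = cis (- 2 * pi * (y \<bullet> \<xi>))" for y
  have P_int: "integrable lborel (\<lambda>(u, v). P u v)"
  proof -
    have "integrable lborel (\<lambda>(s, t). r s * cnj (r t))"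
      by (intro integrable_tensor integrable_schwartz r integrable_cnj)
    then have "integrable lborel (\<lambda>z. (\<lambda>(s, t). r s * cnj (r t)) (midpoint_shear z))"
      by (rule integral_midpoint_shear(2)[rotated]) (unfold borel_prod[symmetric], measurable)
    then show ?thesis by (simp add: midpoint_shear_def P_def split_beta')
  qed
  have FG: "F (x + y /\<^sub>R 2) * cnj (G (x - y /\<^sub>R 2)) = (LINT z|lborel. P (fst z) (snd z) * Q (fst z) (y - snd z))" for y
  proof -
    have i: "integrable lborel (\<lambda>s. r s * h (c - s))" if "h \<in> schwartz" for h c
      using integrable_schwartz[OF schwartz_mult[OF r schwartz_affine[OF that, of "-1" c]]] by simp
    note fi = i[OF f, of "x + y /\<^sub>R 2"] integrable_cnj[OF i[OF g, of "x - y /\<^sub>R 2"]]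
    define H where "H = (\<lambda>(s, t). (r s * f (x + y /\<^sub>R 2 - s)) * cnj (r t * g (x - y /\<^sub>R 2 - t)))"
    have H: "integrable lborel H" unfolding H_def by (rule integrable_tensor[OF fi])
    have "F (x + y /\<^sub>R 2) * cnj (G (x - y /\<^sub>R 2)) = (LINT z|lborel. H z)"
      unfolding integral_lborel_prod(1)[OF H] unfolding H_def prod.case F G
        integral_mult_right_zero integral_mult_left_zero Bochner_Integration.integral_cnj ..
    also have "\<dots> = (LINT z|lborel. H (midpoint_shear z))"
      using borel_measurable_integrable[OF H] by (intro integral_midpoint_shear(1)[symmetric]) simp
    also have "\<dots> = (LINT z|lborel. P (fst z) (snd z) * Q (fst z) (y - snd z))"
    proof (intro Bochner_Integration.integral_cong refl)
      fix z :: "'a \<times> 'a"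
      obtain u v where z: "z = (u, v)" by (cases z)
      have "x + y /\<^sub>R 2 - (u + v /\<^sub>R 2) = (x - u) + (y - v) /\<^sub>R 2" "x - y /\<^sub>R 2 - (u - v /\<^sub>R 2) = (x - u) - (y - v) /\<^sub>R 2"
        by (simp_all add: scaleR_right_diff_distrib)
      then show "H (midpoint_shear z) = P (fst z) (snd z) * Q (fst z) (y - snd z)"
        unfolding H_def midpoint_shear_def z P_def Q_def by (simp only: prod.case fst_conv snd_conv complex_cnj_mult mult_ac)
    qed
    finally show ?thesis .
  qed
  define T where "T y z = P (fst z) (snd z) * Q (fst z) (y - snd z) * E y" for y z
  have T_int: "integrable lborel (\<lambda>(y, z). T y z)"
  proof -
    define M where "M = 2 * DIM('a \<times> 'a \<times> 'a)"
    obtain A where A1: "A > 0"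
      and A2: "\<And>u v. ((1 + norm u) * (1 + norm v)) ^ (2 * M) * cmod (r (u + v /\<^sub>R 2) * cnj (r (u - v /\<^sub>R 2))) \<le> A"
      by (rule cross_wigner_integrand_bound_both[OF r r, of "2 * M"]) (rule that)
    obtain B where B1: "B > 0"
      and B2: "\<And>u w. (1 + norm w) ^ M * cmod (f (u + w /\<^sub>R 2) * cnj (g (u - w /\<^sub>R 2))) \<le> B"
      by (rule cross_wigner_integrand_bound[OF f g, of M]) (rule that)
    have A: "A > 0" "\<And>u v. ((1 + norm u) * (1 + norm v)) ^ (2 * M) * cmod (P u v) \<le> A"
      unfolding P_def by (rule A1, rule A2)
    have B: "B > 0" "\<And>u w. (1 + norm w) ^ M * cmod (Q u w) \<le> B"
      unfolding Q_def by (rule B1, rule B2)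
    show ?thesis
    proof (rule integrable_triple_decay[where B = "A * B"])
      show "(\<lambda>(y, z). T y z) \<in> borel_measurable borel"
        unfolding T_def P_def Q_def E_def borel_prod[symmetric] by measurable
      fix y u v :: 'a
      have "((1 + norm y) * (1 + norm u) * (1 + norm v)) ^ M \<le> (((1 + norm (y - v)) * (1 + norm v)) * ((1 + norm u) * (1 + norm u)) * (1 + norm v)) ^ M"
        using one_plus_norm_add_le[of "y - v" v]
        by (intro power_mono mult_mono) (auto simp: distrib_left)
      also have "\<dots> = ((1 + norm u) * (1 + norm v)) ^ (2 * M) * (1 + norm (y - v)) ^ M"
        by (simp only: power_mult_distrib mult_2 mult_2_right power_add ac_simps)
      finally have "((1 + norm y) * (1 + norm u) * (1 + norm v)) ^ M * cmod (T y (u, v))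
         \<le> (((1 + norm u) * (1 + norm v)) ^ (2 * M) * (1 + norm (y - v)) ^ M) * cmod (T y (u, v))"
        by (rule mult_right_mono) simp
      also have "\<dots> = (((1 + norm u) * (1 + norm v)) ^ (2 * M) * cmod (P u v)) * ((1 + norm (y - v)) ^ M * cmod (Q u (y - v)))"
        by (simp add: T_def E_def norm_mult)
      also have "\<dots> \<le> A * B" using A(1) by (intro mult_mono A B) auto
      finally show "((1 + norm y) * (1 + norm u) * (1 + norm v)) ^ (2 * DIM('a \<times> 'a \<times> 'a)) * cmod (case (y, u, v) of (y, z) \<Rightarrow> T y z) \<le> A * B"
        by (simp add: M_def)
    qed
  qed
  have inner: "(LINT y|lborel. T y z) = P (fst z) (snd z) * E (snd z) * cross_wigner f g (x - fst z, \<xi>)" for z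
  proof -
    define K where "K w = Q (fst z) w * E w" for w
    have K[measurable]: "K \<in> borel_measurable borel" unfolding K_def Q_def E_def by measurable
    have "T y z = P (fst z) (snd z) * E (snd z) * K (y + - snd z)" for y
    proof -
      have "E y = E (snd z) * E (y - snd z)" unfolding E_def cis_mult
        by (rule arg_cong[of _ _ cis]) (simp add: inner_diff_left right_diff_distrib)
      then show ?thesis by (simp add: T_def K_def mult_ac)
    qed
    then have "(LINT y|lborel. T y z) = P (fst z) (snd z) * E (snd z) * (LINT y|lborel. K (y + - snd z))"
      by (simp only:) (rule integral_mult_right_zero)
    also have "(LINT y|lborel. K (y + - snd z)) = cross_wigner f g (x - fst z, \<xi>)"
      unfolding lborel_integral_translate(1)[OF K] unfolding K_def Q_def E_def cross_wigner_eq fst_conv snd_conv ..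
    finally show ?thesis .
  qed
  define U where "U = (\<lambda>(u, v). P u v * E v * cross_wigner f g (x - u, \<xi>))"
  have U_int: "integrable lborel U"
  proof -
    obtain B where B: "B > 0" "\<And>p. cmod (cross_wigner f g p) \<le> B" using cross_wigner_bounded[OF f g] by blast
    show ?thesis
    proof (rule Bochner_Integration.integrable_bound)
      show "integrable lborel (\<lambda>z. of_real B * (case z of (u, v) \<Rightarrow> P u v))" by (intro integrable_mult_right P_int)
      have W_meas: "(\<lambda>z::'a \<times> 'a. cross_wigner f g (x - fst z, \<xi>)) \<in> borel_measurable borel"
        by (intro cw_meas f g continuous_intros)
      have "E \<in> borel_measurable borel" unfolding E_def by measurable
      from measurable_compose[OF borel_measurable_continuous_onI[OF continuous_on_snd[OF continuous_on_id]] this]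
      have E_meas: "(\<lambda>z::'a \<times> 'a. E (snd z)) \<in> borel_measurable borel" .
      have P_meas: "(\<lambda>z. P (fst z) (snd z)) \<in> borel_measurable borel"
        using borel_measurable_integrable[OF P_int] by (simp add: split_beta')
      show "U \<in> borel_measurable lborel"
        using borel_measurable_times[OF borel_measurable_times[OF P_meas E_meas] W_meas]
        by (simp add: U_def split_beta')
      show "AE z in lborel. norm (U z) \<le> norm (of_real B * (case z of (u, v) \<Rightarrow> P u v))"
      proof (intro always_eventually allI)
        fix z
        have "cmod (P (fst z) (snd z)) * cmod (cross_wigner f g (x - fst z, \<xi>)) \<le> cmod (P (fst z) (snd z)) * B"
          by (intro mult_left_mono B) simp
        then show "norm (U z) \<le> norm (of_real B * (case z of (u, v) \<Rightarrow> P u v))"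
          using B(1) by (simp add: U_def E_def case_prod_beta norm_mult mult.commute)
      qed
    qed
  qed
  have c1: "cross_wigner F G (x, \<xi>) = (LINT y|lborel. LINT z|lborel. T y z)"
    unfolding cross_wigner_eq fst_conv snd_conv FG E_def[symmetric] T_def
      integral_mult_left_zero ..
  have c2: "(LINT y|lborel. LINT z|lborel. T y z) = (LINT z|lborel. LINT y|lborel. T y z)"
    by (rule integral_lborel_swap[OF T_int])
  have c3: "(LINT z|lborel. LINT y|lborel. T y z) = (LINT z|lborel. U z)"
    unfolding inner U_def by (simp add: case_prod_beta)
  have c4: "(LINT z|lborel. U z) = (LINT u|lborel. LINT v|lborel. U (u, v))"
    by (rule integral_lborel_prod(1)[OF U_int])
  have c5: "(LINT u|lborel. LINT v|lborel. U (u, v)) = (LINT u|lborel. cross_wigner r r (u, \<xi>) * cross_wigner f g (x - u, \<xi>))"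
    unfolding U_def prod.case integral_mult_left_zero
    unfolding cross_wigner_eq[of r r] P_def E_def fst_conv snd_conv ..
  have c6: "(LINT u|lborel. cross_wigner r r (u, \<xi>) * cross_wigner f g (x - u, \<xi>))
      = (LINT y|lborel. cross_wigner r r (x - y, \<xi>) * cross_wigner f g (y, \<xi>))"
    by (rule convolution_commute[of "\<lambda>u. cross_wigner r r (u, \<xi>)" "\<lambda>y. cross_wigner f g (y, \<xi>)"])
       (intro cw_meas r f g continuous_intros)+
  show ?thesis by (rule HOL.trans[OF c1 HOL.trans[OF c2 HOL.trans[OF c3 HOL.trans[OF c4 HOL.trans[OF c5 c6]]]]])
qed

text \<open>
  The distributional definition was obtained from the function by a substitution; here this
  substitution is undone, with Fubini for an integrand that decays in all three variables.
\<close>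

lemma cross_wigner_dist_regular:
  fixes F G :: "'a::euclidean_space \<Rightarrow> complex" and \<Phi> :: "'a \<times> 'a \<Rightarrow> complex"
  assumes F: "F \<in> schwartz" and G: "G \<in> schwartz" and \<Phi>: "\<Phi> \<in> schwartz"
  shows "cross_wigner_dist (regular_dist F) (regular_dist G) \<Phi> = (LINT x|lborel. LINT \<xi>|lborel. \<Phi> (x, \<xi>) * cross_wigner F G (x, \<xi>))"
proof -
  have meas[measurable]: "F \<in> borel_measurable borel" "G \<in> borel_measurable borel" "\<Phi> \<in> borel_measurable (borel \<Otimes>\<^sub>M borel)"
    "cross_wigner F G \<in> borel_measurable (borel \<Otimes>\<^sub>M borel)"
    unfolding borel_prod by (intro borel_measurable_schwartz borel_measurable_cross_wigner F G \<Phi>)+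
  define T where "T z \<xi> = F (fst z) * cnj (G (snd z)) * (\<Phi> ((fst z + snd z) /\<^sub>R 2, \<xi>) * cis (- 2 * pi * ((fst z - snd z) \<bullet> \<xi>)))" for z \<xi>
  have T_int: "integrable lborel (\<lambda>(z, \<xi>). T z \<xi>)"
  proof -
    define M where "M = 2 * DIM(('a \<times> 'a) \<times> 'a)"
    obtain A where A: "A > 0" "\<And>p. (1 + norm p) ^ M * cmod (F p) \<le> A" using schwartz_bound[OF F, of M] by blast
    obtain B where B: "B > 0" "\<And>p. (1 + norm p) ^ M * cmod (G p) \<le> B" using schwartz_bound[OF G, of M] by blast
    obtain C where C: "C > 0" "\<And>p. (1 + norm p) ^ M * cmod (\<Phi> p) \<le> C" using schwartz_bound[OF \<Phi>, of M] by blast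
    show ?thesis
    proof (rule integrable_polynomial_decay(1))
      show "(\<lambda>(z, \<xi>). T z \<xi>) \<in> borel_measurable borel"
        unfolding T_def borel_prod[symmetric] by measurable
      fix w :: "('a \<times> 'a) \<times> 'a"
      obtain p q \<xi> where w: "w = ((p, q), \<xi>)" by (metis surj_pair)
      have "1 + norm w \<le> ((1 + norm p) * (1 + norm q)) * (1 + norm \<xi>)"
        unfolding w by (intro order_trans[OF one_plus_norm_Pair_le] mult_right_mono one_plus_norm_Pair_le) simp
      also have "\<dots> \<le> ((1 + norm p) * (1 + norm q)) * (1 + norm ((p + q) /\<^sub>R 2, \<xi>))"
        by (intro mult_left_mono one_plus_norm_le_Pair) simp
      finally have "(1 + norm w) ^ M * cmod (T (p, q) \<xi>) \<le> (((1 + norm p) * (1 + norm q)) * (1 + norm ((p + q) /\<^sub>R 2, \<xi>))) ^ M * cmod (T (p, q) \<xi>)"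
        by (intro mult_right_mono power_mono) auto
      also have "\<dots> = ((1 + norm p) ^ M * cmod (F p)) * ((1 + norm q) ^ M * cmod (G q)) * ((1 + norm ((p + q) /\<^sub>R 2, \<xi>)) ^ M * cmod (\<Phi> ((p + q) /\<^sub>R 2, \<xi>)))"
        by (simp add: T_def norm_mult power_mult_distrib)
      also have "\<dots> \<le> A * B * C" using A(1) B(1) by (intro mult_mono A B C) auto
      finally show "(1 + norm w) ^ (2 * DIM(('a \<times> 'a) \<times> 'a)) * cmod (case w of (z, \<xi>) \<Rightarrow> T z \<xi>) \<le> A * B * C"
        by (simp add: M_def w)
    qed
  qed
  have T1: "integrable lborel (\<lambda>z. LINT \<xi>|lborel. T z \<xi>)"
    using lborel_pair.integrable_fst'[of "\<lambda>(z, \<xi>). T z \<xi>"] T_int by (simp add: lborel_prod)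
  have K: "(LINT \<xi>|lborel. T z \<xi>) = F (fst z) * cnj (G (snd z)) * wigner_pullback \<Phi> (fst z) (snd z)" for z
    unfolding T_def integral_mult_right_zero wigner_pullback_def ..
  have "cross_wigner_dist (regular_dist F) (regular_dist G) \<Phi> = (LINT p|lborel. LINT q|lborel. F p * (cnj (G q) * wigner_pullback \<Phi> p q))"
    unfolding cross_wigner_dist_def regular_dist_def integral_mult_right_zero
      Bochner_Integration.integral_cnj[symmetric] complex_cnj_mult complex_cnj_cnj ..
  also have "\<dots> = (LINT z|lborel. LINT \<xi>|lborel. T z \<xi>)"
    unfolding integral_lborel_prod(1)[OF T1] unfolding K fst_conv snd_conv mult.assoc ..
  also have "\<dots> = (LINT \<xi>|lborel. LINT z|lborel. T z \<xi>)" by (rule integral_lborel_swap[OF T_int])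
  also have "\<dots> = (LINT \<xi>|lborel. LINT x|lborel. \<Phi> (x, \<xi>) * cross_wigner F G (x, \<xi>))"
  proof (intro Bochner_Integration.integral_cong refl)
    fix \<xi> :: 'a
    obtain C where C: "C > 0" "\<And>p. cmod (\<Phi> p) \<le> C" using schwartz_bound[OF \<Phi>, of 0] by auto
    have FG: "integrable lborel (\<lambda>(p, q). F p * cnj (G q))"
      by (intro integrable_tensor integrable_schwartz integrable_cnj F G)
    have Tz: "integrable lborel (\<lambda>z. T z \<xi>)"
    proof (rule Bochner_Integration.integrable_bound)
      show "integrable lborel (\<lambda>z. of_real C * (case z of (p, q) \<Rightarrow> F p * cnj (G q)))" by (intro integrable_mult_right FG)
      show "(\<lambda>z. T z \<xi>) \<in> borel_measurable lborel" unfolding T_def lborel_prod[symmetric] by measurable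
      show "AE z in lborel. norm (T z \<xi>) \<le> norm (of_real C * (case z of (p, q) \<Rightarrow> F p * cnj (G q)))"
      proof (intro always_eventually allI)
        fix z
        have "cmod (F (fst z) * cnj (G (snd z))) * cmod (\<Phi> ((fst z + snd z) /\<^sub>R 2, \<xi>)) \<le> cmod (F (fst z) * cnj (G (snd z))) * C"
          by (intro mult_left_mono C) simp
        then show "norm (T z \<xi>) \<le> norm (of_real C * (case z of (p, q) \<Rightarrow> F p * cnj (G q)))"
          using C(1) by (simp add: T_def case_prod_beta norm_mult mult.commute)
      qed
    qed
    have Tm: "(\<lambda>z. T z \<xi>) \<in> borel_measurable borel" using borel_measurable_integrable[OF Tz] by simp
    have Ts: "T (midpoint_shear (x, y)) \<xi> = \<Phi> (x, \<xi>) * (F (x + y /\<^sub>R 2) * cnj (G (x - y /\<^sub>R 2)) * cis (- 2 * pi * (y \<bullet> \<xi>)))" for x y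
    proof -
      have "((x + y /\<^sub>R 2) + (x - y /\<^sub>R 2)) /\<^sub>R 2 = x" "(x + y /\<^sub>R 2) - (x - y /\<^sub>R 2) = y"
      proof -
        have "(x + y /\<^sub>R 2) + (x - y /\<^sub>R 2) = x + x" "(x + y /\<^sub>R 2) - (x - y /\<^sub>R 2) = y /\<^sub>R 2 + y /\<^sub>R 2" by simp_all
        then show "((x + y /\<^sub>R 2) + (x - y /\<^sub>R 2)) /\<^sub>R 2 = x" "(x + y /\<^sub>R 2) - (x - y /\<^sub>R 2) = y"
          by (simp_all only: scaleR_right_distrib half_add_half)
      qed
      then show ?thesis by (simp only: T_def midpoint_shear_def prod.case fst_conv snd_conv mult_ac)
    qed
    have "(LINT z|lborel. T z \<xi>) = (LINT z|lborel. T (midpoint_shear z) \<xi>)"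
      by (rule integral_midpoint_shear(1)[OF Tm, symmetric])
    also have "\<dots> = (LINT x|lborel. LINT y|lborel. T (midpoint_shear (x, y)) \<xi>)"
      by (rule integral_lborel_prod(1)[OF integral_midpoint_shear(2)[OF Tm Tz]])
    also have "\<dots> = (LINT x|lborel. \<Phi> (x, \<xi>) * cross_wigner F G (x, \<xi>))"
      unfolding Ts integral_mult_right_zero cross_wigner_eq fst_conv snd_conv ..
    finally show "(LINT z|lborel. T z \<xi>) = (LINT x|lborel. \<Phi> (x, \<xi>) * cross_wigner F G (x, \<xi>))" .
  qed
  also have "\<dots> = (LINT x|lborel. LINT \<xi>|lborel. \<Phi> (x, \<xi>) * cross_wigner F G (x, \<xi>))"
  proof (rule integral_lborel_swap[symmetric])
    obtain B where B: "B > 0" "\<And>p. cmod (cross_wigner F G p) \<le> B" using cross_wigner_bounded[OF F G] by blast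
    show "integrable lborel (\<lambda>(x, \<xi>). \<Phi> (x, \<xi>) * cross_wigner F G (x, \<xi>))"
    proof (rule Bochner_Integration.integrable_bound)
      show "integrable lborel (\<lambda>p. of_real B * \<Phi> p)" by (intro integrable_mult_right integrable_schwartz \<Phi>)
      show "(\<lambda>(x, \<xi>). \<Phi> (x, \<xi>) * cross_wigner F G (x, \<xi>)) \<in> borel_measurable lborel"
        unfolding lborel_prod[symmetric] by measurable
      show "AE p in lborel. norm (case p of (x, \<xi>) \<Rightarrow> \<Phi> (x, \<xi>) * cross_wigner F G (x, \<xi>)) \<le> norm (of_real B * \<Phi> p)"
      proof (intro always_eventually allI)
        fix p
        have "cmod (\<Phi> p) * cmod (cross_wigner F G p) \<le> cmod (\<Phi> p) * B" by (intro mult_left_mono B) simp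
        then show "norm (case p of (x, \<xi>) \<Rightarrow> \<Phi> (x, \<xi>) * cross_wigner F G (x, \<xi>)) \<le> norm (of_real B * \<Phi> p)"
          using B(1) by (simp add: case_prod_beta norm_mult mult.commute)
      qed
    qed
  qed
  finally show ?thesis .
qed

section \<open>Tempered distributions and the kernel of a Fourier multiplier\<close>

text \<open>
  Only finitely many lists of directions have length at most \<open>N\<close>, although infinitely many functions
  represent the corresponding multi-indices.
\<close>

lemma schwartz_norm_bdd:
  fixes f :: "'a::euclidean_space \<Rightarrow> complex"
  assumes f: "f \<in> schwartz"
  shows "bdd_above ((\<lambda>(\<alpha>, x). (1 + norm x) ^ N * cmod (multi_deriv \<alpha> f x)) ` ({\<alpha>. multi_order \<alpha> \<le> N} \<times> UNIV))"
proof -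
  define L where "L = {bs :: 'a list. set bs \<subseteq> Basis \<and> length bs \<le> N}"
  have L: "finite L" unfolding L_def by (rule finite_lists_length_le) simp
  have "\<forall>bs. \<exists>B. bs \<in> L \<longrightarrow> (\<forall>x. (1 + norm x) ^ N * cmod (derivs bs f x) \<le> B)"
    using f unfolding schwartz_iff rapidly_decreasing_def L_def by blast
  then obtain B where B: "\<And>bs x. bs \<in> L \<Longrightarrow> (1 + norm x) ^ N * cmod (derivs bs f x) \<le> B bs"
    by metis
  show ?thesis
  proof (rule bdd_aboveI2)
    fix p :: "('a \<Rightarrow> nat) \<times> 'a" assume p: "p \<in> {\<alpha>. multi_order \<alpha> \<le> N} \<times> UNIV"
    obtain \<alpha> x where ax: "p = (\<alpha>, x)" "multi_order \<alpha> \<le> N" using p by auto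
    then have in_L: "multi_index_list \<alpha> \<in> L"
      using set_multi_index_list[of \<alpha>] by (simp add: L_def length_multi_index_list)
    have "(1 + norm x) ^ N * cmod (multi_deriv \<alpha> f x) \<le> \<bar>B (multi_index_list \<alpha>)\<bar>"
      unfolding multi_deriv_eq_foldr using B[OF in_L] by (rule order_trans) simp
    also have "\<dots> \<le> (\<Sum>bs\<in>L. \<bar>B bs\<bar>)" using L in_L by (intro member_le_sum) auto
    finally show "(case p of (\<alpha>, x) \<Rightarrow> (1 + norm x) ^ N * cmod (multi_deriv \<alpha> f x)) \<le> (\<Sum>bs\<in>L. \<bar>B bs\<bar>)"
      by (simp add: ax)
  qed
qed

lemma schwartz_norm_upper:
  fixes f :: "'a::euclidean_space \<Rightarrow> complex"
  assumes f: "f \<in> schwartz"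
  shows "(1 + norm x) ^ N * cmod (f x) \<le> schwartz_norm N f"
proof -
  have "multi_index_list (\<lambda>_::'a. 0::nat) = []"
    using length_multi_index_list[of "\<lambda>_::'a. 0::nat"] by (simp add: multi_order_def)
  then have "multi_deriv (\<lambda>_. 0) f = f" by (simp add: multi_deriv_eq_foldr)
  moreover have "((\<lambda>_. 0), x) \<in> {\<alpha>. multi_order \<alpha> \<le> N} \<times> UNIV" by (simp add: multi_order_def)
  ultimately show ?thesis
    using cSUP_upper[OF _ schwartz_norm_bdd[OF f], of "((\<lambda>_. 0), x)" N] by (simp add: schwartz_norm_def)
qed

lemma schwartz_norm_nonneg: "f \<in> schwartz \<Longrightarrow> 0 \<le> schwartz_norm N f"
  by (rule order_trans[OF _ schwartz_norm_upper[of f 0]]) simp_all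

lemma schwartz_norm_least:
  fixes f :: "'a::euclidean_space \<Rightarrow> complex"
  assumes "\<And>bs x. set bs \<subseteq> Basis \<Longrightarrow> length bs \<le> N \<Longrightarrow> (1 + norm x) ^ N * cmod (derivs bs f x) \<le> M"
  shows "schwartz_norm N f \<le> M"
  unfolding schwartz_norm_def
proof (rule cSUP_least)
  have "((\<lambda>_. 0), 0) \<in> {\<alpha>. multi_order \<alpha> \<le> N} \<times> UNIV" by (simp add: multi_order_def)
  then show "{\<alpha>. multi_order \<alpha> \<le> N} \<times> UNIV \<noteq> {}" by blast
  fix p :: "('a \<Rightarrow> nat) \<times> 'a" assume "p \<in> {\<alpha>. multi_order \<alpha> \<le> N} \<times> UNIV"
  then obtain \<alpha> x where "p = (\<alpha>, x)" "multi_order \<alpha> \<le> N" by auto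
  then show "(case p of (\<alpha>, x) \<Rightarrow> (1 + norm x) ^ N * cmod (multi_deriv \<alpha> f x)) \<le> M"
    using assms[OF set_multi_index_list[of \<alpha>]] by (simp add: multi_deriv_eq_foldr length_multi_index_list)
qed

lemma integrable_mult_bounded:
  fixes f g :: "'a::euclidean_space \<Rightarrow> complex"
  assumes f: "integrable lborel f" and g: "g \<in> borel_measurable borel" "\<And>x. cmod (g x) \<le> B"
  shows "integrable lborel (\<lambda>x. f x * g x)"
    and "cmod (LINT x|lborel. f x * g x) \<le> (LINT x|lborel. cmod (f x)) * B"
proof -
  have le: "cmod (f x * g x) \<le> cmod (f x) * B" for x
    unfolding norm_mult by (intro mult_left_mono g) simp
  have i: "integrable lborel (\<lambda>x. cmod (f x) * B)" by (intro integrable_mult_left integrable_norm f)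
  have [measurable]: "f \<in> borel_measurable borel" "g \<in> borel_measurable borel"
    using borel_measurable_integrable[OF f] g(1) by simp_all
  show "integrable lborel (\<lambda>x. f x * g x)"
  proof (rule Bochner_Integration.integrable_bound[OF i])
    show "AE x in lborel. norm (f x * g x) \<le> norm (cmod (f x) * B)"
      using le by (intro always_eventually allI) (metis abs_ge_self order_trans real_norm_def)
  qed measurable
  show "cmod (LINT x|lborel. f x * g x) \<le> (LINT x|lborel. cmod (f x)) * B"
    using norm_lebesgue_integral_le[OF i le] by simp
qed

lemma tempered_regular_dist:
  fixes u :: "'a::euclidean_space \<Rightarrow> complex"
  assumes u: "integrable lborel u"
  shows "tempered_dist (regular_dist u)"
proof -
  have i: "integrable lborel (\<lambda>x. u x * \<phi> x)" "cmod (regular_dist u \<phi>) \<le> (LINT x|lborel. cmod (u x)) * schwartz_norm 0 \<phi>"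
    if "\<phi> \<in> schwartz" for \<phi> :: "'a \<Rightarrow> complex"
  proof -
    have "cmod (\<phi> x) \<le> schwartz_norm 0 \<phi>" for x using schwartz_norm_upper[OF that, of x 0] by simp
    with integrable_mult_bounded[OF u borel_measurable_schwartz[OF that]]
    show "integrable lborel (\<lambda>x. u x * \<phi> x)" "cmod (regular_dist u \<phi>) \<le> (LINT x|lborel. cmod (u x)) * schwartz_norm 0 \<phi>"
      unfolding regular_dist_def by blast+
  qed
  show ?thesis
    unfolding tempered_dist_def
  proof (intro conjI ballI allI)
    fix \<phi> \<psi> :: "'a \<Rightarrow> complex" assume "\<phi> \<in> schwartz" "\<psi> \<in> schwartz"
    then show "regular_dist u (\<lambda>x. \<phi> x + \<psi> x) = regular_dist u \<phi> + regular_dist u \<psi>"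
      unfolding regular_dist_def distrib_left by (intro Bochner_Integration.integral_add i)
  next
    fix c and \<phi> :: "'a \<Rightarrow> complex"
    show "regular_dist u (\<lambda>x. c * \<phi> x) = c * regular_dist u \<phi>"
      unfolding regular_dist_def mult.left_commute[of _ c] by (rule integral_mult_right_zero)
  next
    show "\<exists>C N. \<forall>\<phi>\<in>schwartz. cmod (regular_dist u \<phi>) \<le> C * schwartz_norm N \<phi>"
      using i(2) by blast
  qed
qed

lemma continuous_linear_op_fourier_multiplier:
  fixes \<sigma> :: "'a::euclidean_space \<Rightarrow> complex"
  assumes \<sigma>: "\<sigma> \<in> schwartz"
  shows "continuous_linear_op (\<lambda>f. regular_dist (fourier_multiplier \<sigma> f))"
proof -
  note r = schwartz_inv_fourier[OF \<sigma>]
  define R where "R = (LINT s|lborel. cmod (inv_fourier \<sigma> s))"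
  have conv: "integrable lborel (\<lambda>s. inv_fourier \<sigma> s * f (x - s))" if "f \<in> schwartz" for f x
    using integrable_schwartz[OF schwartz_mult[OF r schwartz_affine[OF that, of "-1" x]]] by simp
  have T: "fourier_multiplier \<sigma> f \<in> schwartz" if "f \<in> schwartz" for f
    using \<sigma> that by (rule schwartz_fourier_multiplier)
  have bound: "cmod (fourier_multiplier \<sigma> f x) \<le> R * schwartz_norm 0 f" if f: "f \<in> schwartz" for f x
  proof -
    have "(\<lambda>s. f (x - s)) \<in> borel_measurable borel"
      using borel_measurable_schwartz[OF schwartz_affine[OF f, of "-1" x]] by simp
    then show ?thesis
      unfolding fourier_multiplier_convolution[OF \<sigma> f] R_def
      using schwartz_norm_upper[OF f, of _ 0] by (intro integrable_mult_bounded(2) integrable_schwartz r) simp_all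
  qed
  show ?thesis
    unfolding continuous_linear_op_def
  proof (intro conjI ballI)
    fix f :: "'a \<Rightarrow> complex" assume "f \<in> schwartz"
    then show "tempered_dist (regular_dist (fourier_multiplier \<sigma> f))"
      by (intro tempered_regular_dist integrable_schwartz T)
  next
    fix \<phi> :: "'a \<Rightarrow> complex" assume \<phi>: "\<phi> \<in> schwartz"
    have i: "integrable lborel (\<lambda>x. fourier_multiplier \<sigma> f x * \<phi> x)" if "f \<in> schwartz" for f
      by (intro integrable_schwartz schwartz_mult T that \<phi>)
    show "tempered_dist (\<lambda>f. regular_dist (fourier_multiplier \<sigma> f) \<phi>)"
      unfolding tempered_dist_def
    proof (intro conjI ballI allI)
      fix f g :: "'a \<Rightarrow> complex" assume fg: "f \<in> schwartz" "g \<in> schwartz"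
      have "fourier_multiplier \<sigma> (\<lambda>x. f x + g x) x = fourier_multiplier \<sigma> f x + fourier_multiplier \<sigma> g x" for x
        unfolding fourier_multiplier_convolution[OF \<sigma> fg(1)] fourier_multiplier_convolution[OF \<sigma> fg(2)]
          fourier_multiplier_convolution[OF \<sigma> schwartz_add[OF fg]] distrib_left
        by (intro Bochner_Integration.integral_add conv fg)
      then show "regular_dist (fourier_multiplier \<sigma> (\<lambda>x. f x + g x)) \<phi>
          = regular_dist (fourier_multiplier \<sigma> f) \<phi> + regular_dist (fourier_multiplier \<sigma> g) \<phi>"
        unfolding regular_dist_def by (simp only: distrib_right) (intro Bochner_Integration.integral_add i fg)
    next
      fix c and f :: "'a \<Rightarrow> complex" assume f: "f \<in> schwartz"
      have "fourier_multiplier \<sigma> (\<lambda>x. c * f x) x = c * fourier_multiplier \<sigma> f x" for x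
        unfolding fourier_multiplier_convolution[OF \<sigma> f] fourier_multiplier_convolution[OF \<sigma> schwartz_cmult[OF f]]
          mult.left_commute[of _ c] by (rule integral_mult_right_zero)
      then show "regular_dist (fourier_multiplier \<sigma> (\<lambda>x. c * f x)) \<phi> = c * regular_dist (fourier_multiplier \<sigma> f) \<phi>"
        unfolding regular_dist_def by (simp only: mult.assoc) (rule integral_mult_right_zero)
    next
      show "\<exists>C N. \<forall>f\<in>schwartz. cmod (regular_dist (fourier_multiplier \<sigma> f) \<phi>) \<le> C * schwartz_norm N f"
      proof (intro exI ballI)
        fix f :: "'a \<Rightarrow> complex" assume f: "f \<in> schwartz"
        have "cmod (LINT x|lborel. \<phi> x * fourier_multiplier \<sigma> f x) \<le> (LINT x|lborel. cmod (\<phi> x)) * (R * schwartz_norm 0 f)"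
          by (intro integrable_mult_bounded(2) integrable_schwartz \<phi> borel_measurable_schwartz T f bound)
        then show "cmod (regular_dist (fourier_multiplier \<sigma> f) \<phi>) \<le> ((LINT x|lborel. cmod (\<phi> x)) * R) * schwartz_norm 0 f"
          by (simp add: regular_dist_def mult_ac)
      qed
    qed
  qed
qed

text \<open>
  The norm of \<open>(x, y, \<xi>)\<close> is at most that of \<open>((x, \<xi>), (y, \<xi>))\<close>, so restricting a test function to equal
  frequencies preserves its decay.
\<close>

lemma tempered_delta_kernel:
  fixes a :: "'a::euclidean_space \<times> 'a \<Rightarrow> complex"
  assumes a: "continuous_on UNIV a" and A: "\<And>p. cmod (a p) \<le> A"
  shows "tempered_dist (delta_kernel a)"
proof -
  define M where "M = 2 * DIM('a \<times> 'a \<times> 'a)"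
  define F where "F \<Phi> p = a (fst p - fst (snd p), snd (snd p)) * \<Phi> ((fst p, snd (snd p)), (fst (snd p), snd (snd p)))"
    for \<Phi> and p :: "'a \<times> 'a \<times> 'a"
  have delta: "delta_kernel a \<Phi> = (LINT p|lborel. F \<Phi> p)" for \<Phi>
    unfolding delta_kernel_def F_def case_prod_beta ..
  have A0: "A \<ge> 0" using order_trans[OF norm_ge_zero A[of 0]] .
  have meas: "F \<Phi> \<in> borel_measurable borel" if "\<Phi> \<in> schwartz" for \<Phi>
    unfolding F_def
    by (intro borel_measurable_continuous_onI continuous_on_mult continuous_on_compose2[OF a]
        continuous_on_compose2[OF smooth_continuous_on[OF schwartz_smooth[OF that]]] continuous_intros) auto
  have decay: "(1 + norm p) ^ M * cmod (F \<Phi> p) \<le> A * schwartz_norm M \<Phi>" if \<Phi>: "\<Phi> \<in> schwartz" for \<Phi> p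
  proof -
    obtain x y \<xi> where p: "p = (x, y, \<xi>)" by (metis surj_pair)
    have "norm p \<le> norm ((x, \<xi>), (y, \<xi>))"
      unfolding p norm_Pair by (intro real_sqrt_le_mono) (simp add: add_nonneg_nonneg)
    then have "(1 + norm p) ^ M * cmod (F \<Phi> p) \<le> (1 + norm ((x, \<xi>), (y, \<xi>))) ^ M * (A * cmod (\<Phi> ((x, \<xi>), (y, \<xi>))))"
      unfolding F_def p fst_conv snd_conv norm_mult by (intro mult_mono power_mono A mult_right_mono) (auto intro: A0)
    also have "\<dots> = A * ((1 + norm ((x, \<xi>), (y, \<xi>))) ^ M * cmod (\<Phi> ((x, \<xi>), (y, \<xi>))))" by (simp only: mult_ac)
    also have "\<dots> \<le> A * schwartz_norm M \<Phi>" by (intro mult_left_mono schwartz_norm_upper \<Phi> A0)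
    finally show ?thesis .
  qed
  have int: "integrable lborel (F \<Phi>)" if "\<Phi> \<in> schwartz" for \<Phi>
    by (rule integrable_polynomial_decay(1)[OF meas[OF that] decay[OF that, unfolded M_def]])
  show ?thesis
    unfolding tempered_dist_def delta
  proof (intro conjI ballI allI)
    fix \<phi> \<psi> :: "('a \<times> 'a) \<times> ('a \<times> 'a) \<Rightarrow> complex" assume "\<phi> \<in> schwartz" "\<psi> \<in> schwartz"
    then show "(LINT p|lborel. F (\<lambda>x. \<phi> x + \<psi> x) p) = (LINT p|lborel. F \<phi> p) + (LINT p|lborel. F \<psi> p)"
      using int[of \<phi>] int[of \<psi>] unfolding F_def distrib_left by (intro Bochner_Integration.integral_add)
  next
    fix c and \<phi> :: "('a \<times> 'a) \<times> ('a \<times> 'a) \<Rightarrow> complex"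
    show "(LINT p|lborel. F (\<lambda>x. c * \<phi> x) p) = c * (LINT p|lborel. F \<phi> p)"
      unfolding F_def mult.left_commute[of _ c] by (rule integral_mult_right_zero)
  next
    show "\<exists>C N. \<forall>\<phi>\<in>schwartz. cmod (LINT p|lborel. F \<phi> p) \<le> C * schwartz_norm N \<phi>"
    proof (intro exI ballI)
      fix \<phi> :: "('a \<times> 'a) \<times> ('a \<times> 'a) \<Rightarrow> complex" assume \<phi>: "\<phi> \<in> schwartz"
      have "cmod (LINT p|lborel. F \<phi> p) \<le> (LINT p|lborel. cmod (F \<phi> p))" by (rule integral_norm_bound)
      also have "\<dots> \<le> (A * schwartz_norm M \<phi>) * (LINT p::'a \<times> 'a \<times> 'a|lborel. 1 / (1 + norm p) ^ M)"
        using integrable_polynomial_decay(2)[OF meas[OF \<phi>] decay[OF \<phi>, unfolded M_def]] by (simp add: M_def)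
      finally show "cmod (LINT p|lborel. F \<phi> p) \<le> (A * (LINT p::'a \<times> 'a \<times> 'a|lborel. 1 / (1 + norm p) ^ M)) * schwartz_norm M \<phi>"
        by (simp only: mult_ac)
    qed
  qed
qed

text \<open>
  The multiplier is a convolution with \<open>inv_fourier \<sigma>\<close>, so \<open>cross_wigner_convolution\<close> gives the
  Wigner distribution of the image; Fubini puts the iterated integral into the form of the kernel.
\<close>

lemma wigner_represents_fourier_multiplier:
  fixes \<sigma> :: "'a::euclidean_space \<Rightarrow> complex"
  assumes \<sigma>: "\<sigma> \<in> schwartz"
  shows "wigner_represents (\<lambda>f. regular_dist (fourier_multiplier \<sigma> f))
     (delta_kernel (cross_wigner (inv_fourier \<sigma>) (inv_fourier \<sigma>)))"
  unfolding wigner_represents_def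
proof (intro ballI)
  fix f g :: "'a \<Rightarrow> complex" and \<Phi> :: "'a \<times> 'a \<Rightarrow> complex"
  assume f: "f \<in> schwartz" and g: "g \<in> schwartz" and \<Phi>: "\<Phi> \<in> schwartz"
  define r where "r = inv_fourier \<sigma>"
  have r: "r \<in> schwartz" unfolding r_def by (rule schwartz_inv_fourier[OF \<sigma>])
  define A where "A = cross_wigner r r"
  define W where "W = cross_wigner f g"
  have cont: "continuous_on UNIV A" "continuous_on UNIV W" "continuous_on UNIV \<Phi>"
    unfolding A_def W_def by (intro smooth_continuous_on smooth_cross_wigner schwartz_smooth r f g \<Phi>)+
  define R where "R p = A (fst p - fst (snd p), snd (snd p)) * (\<Phi> (fst p, snd (snd p)) * W (snd p))" for p :: "'a \<times> 'a \<times> 'a"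
  define M where "M = 2 * DIM('a \<times> 'a \<times> 'a)"
  obtain B1 where B1: "B1 > 0" and B1': "\<And>x \<xi>. (1 + norm x) ^ M * cmod (cross_wigner r r (x, \<xi>)) \<le> B1"
    by (rule cross_wigner_polynomial_decay[OF r r, of M]) (rule that)
  obtain B2 where B2: "B2 > 0" and B2': "\<And>p. cmod (cross_wigner f g p) \<le> B2"
    by (rule cross_wigner_bounded[OF f g]) (rule that)
  obtain B3 where B3: "B3 > 0" and B3': "\<And>p. (1 + norm p) ^ (3 * M) * cmod (\<Phi> p) \<le> B3"
    by (rule schwartz_bound[OF \<Phi>, of "3 * M"]) (rule that)
  have decay: "((1 + norm x) * (1 + norm y) * (1 + norm \<xi>)) ^ M * cmod (R (x, y, \<xi>)) \<le> B1 * (B3 * B2)" for x y \<xi>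
  proof -
    have y: "1 + norm y \<le> (1 + norm (x - y)) * (1 + norm x)"
      using one_plus_norm_add_le[of "y - x" x] by (simp add: norm_minus_commute)
    have "(1 + norm x) * (1 + norm y) * (1 + norm \<xi>)
      \<le> (1 + norm (x, \<xi>)) * ((1 + norm (x - y)) * (1 + norm (x, \<xi>))) * (1 + norm (x, \<xi>))"
      by (intro mult_mono one_plus_norm_le_Pair order_trans[OF y] mult_left_mono) (auto intro!: mult_nonneg_nonneg)
    also have "\<dots> = (1 + norm (x - y)) * (1 + norm (x, \<xi>)) ^ 3" by (simp only: power3_eq_cube mult_ac)
    finally have "((1 + norm x) * (1 + norm y) * (1 + norm \<xi>)) ^ M * cmod (R (x, y, \<xi>))
        \<le> ((1 + norm (x - y)) * (1 + norm (x, \<xi>)) ^ 3) ^ M * cmod (R (x, y, \<xi>))"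
      by (intro mult_right_mono power_mono) auto
    also have "\<dots> = ((1 + norm (x - y)) ^ M * cmod (A (x - y, \<xi>))) * (((1 + norm (x, \<xi>)) ^ (3 * M) * cmod (\<Phi> (x, \<xi>))) * cmod (W (y, \<xi>)))"
      unfolding R_def fst_conv snd_conv norm_mult by (simp only: power_mult_distrib power_mult[symmetric] mult_ac)
    also have "\<dots> \<le> B1 * (B3 * B2)"
      unfolding A_def W_def using B1 B2 B3 by (intro mult_mono B1' B2' B3') auto
    finally show ?thesis .
  qed
  have R_cont: "continuous_on UNIV R"
    unfolding R_def by (intro continuous_on_mult continuous_on_compose2[OF cont(1)] continuous_on_compose2[OF cont(2)]
        continuous_on_compose2[OF cont(3)] continuous_intros) auto
  have R_int: "integrable lborel R"
    by (rule integrable_triple_decay[OF borel_measurable_continuous_onI[OF R_cont] decay[unfolded M_def]])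
  have R_sec: "integrable lborel (\<lambda>q. R (x, q))" for x
  proof (rule integrable_polynomial_decay(1))
    show "(\<lambda>q. R (x, q)) \<in> borel_measurable borel"
      by (intro borel_measurable_continuous_onI continuous_on_compose2[OF R_cont] continuous_intros) auto
    fix q :: "'a \<times> 'a"
    obtain y \<xi> where q: "q = (y, \<xi>)" by (cases q)
    have "(1 + norm q) ^ (2 * DIM('a \<times> 'a)) \<le> (1 + norm q) ^ M" by (intro power_increasing) (auto simp: M_def)
    also have "\<dots> \<le> ((1 + norm x) * (1 + norm y) * (1 + norm \<xi>)) ^ M"
    proof (intro power_mono)
      have "1 + norm q \<le> 1 * ((1 + norm y) * (1 + norm \<xi>))" unfolding q using one_plus_norm_Pair_le[of y \<xi>] by simp
      also have "\<dots> \<le> (1 + norm x) * ((1 + norm y) * (1 + norm \<xi>))" by (intro mult_right_mono) auto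
      finally show "1 + norm q \<le> (1 + norm x) * (1 + norm y) * (1 + norm \<xi>)" by (simp only: mult.assoc)
    qed simp
    finally have "(1 + norm q) ^ (2 * DIM('a \<times> 'a)) * cmod (R (x, q)) \<le> ((1 + norm x) * (1 + norm y) * (1 + norm \<xi>)) ^ M * cmod (R (x, q))"
      by (rule mult_right_mono) simp
    also have "\<dots> \<le> B1 * (B3 * B2)" unfolding q by (rule decay)
    finally show "(1 + norm q) ^ (2 * DIM('a \<times> 'a)) * cmod (R (x, q)) \<le> B1 * (B3 * B2)" .
  qed
  have conv: "cross_wigner (fourier_multiplier \<sigma> f) (fourier_multiplier \<sigma> g) (x, \<xi>) = (LINT y|lborel. A (x - y, \<xi>) * W (y, \<xi>))" for x \<xi>
    unfolding A_def W_def r_def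
    by (rule cross_wigner_convolution[OF schwartz_inv_fourier[OF \<sigma>] f g fourier_multiplier_convolution[OF \<sigma> f] fourier_multiplier_convolution[OF \<sigma> g]])
  have sec: "(LINT q|lborel. R (x, q)) = (LINT \<xi>|lborel. \<Phi> (x, \<xi>) * cross_wigner (fourier_multiplier \<sigma> f) (fourier_multiplier \<sigma> g) (x, \<xi>))" for x
  proof -
    have "R (x, y, \<xi>) = \<Phi> (x, \<xi>) * (A (x - y, \<xi>) * W (y, \<xi>))" for y \<xi>
      unfolding R_def fst_conv snd_conv by (rule mult.left_commute)
    then show ?thesis
      unfolding integral_lborel_prod(2)[OF R_sec] conv
      by (simp only: integral_mult_right_zero)
  qed
  have "delta_kernel A (\<lambda>(z, w). \<Phi> z * W w) = (LINT p|lborel. R p)"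
    unfolding delta_kernel_def R_def case_prod_beta fst_conv snd_conv by simp
  also have "\<dots> = (LINT x|lborel. LINT q|lborel. R (x, q))" by (rule integral_lborel_prod(1)[OF R_int])
  finally show "cross_wigner_dist (regular_dist (fourier_multiplier \<sigma> f)) (regular_dist (fourier_multiplier \<sigma> g)) \<Phi>
      = delta_kernel (cross_wigner (inv_fourier \<sigma>) (inv_fourier \<sigma>)) (\<lambda>(z, w). \<Phi> z * cross_wigner f g w)"
    unfolding A_def W_def r_def sec
    unfolding cross_wigner_dist_regular[OF schwartz_fourier_multiplier[OF \<sigma> f] schwartz_fourier_multiplier[OF \<sigma> g] \<Phi>]
    by (rule sym)
qed

section \<open>Applying tempered distributions to integrals of test functions\<close>

lemma foldr_partial_deriv_add_cmult:
  assumes f: "f \<in> schwartz" and g: "g \<in> schwartz" and bs: "set bs \<subseteq> Basis"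
  shows "derivs bs (\<lambda>x. f x + c * g x) = (\<lambda>x. derivs bs f x + c * derivs bs g x)"
  using bs
proof (induction bs)
  case (Cons b bs)
  then have d: "derivs bs f differentiable (at x)" "derivs bs g differentiable (at x)" for x
    using f g by (auto intro!: schwartz_differentiable schwartz_foldr)
  have "partial_deriv b (\<lambda>x. derivs bs f x + c * derivs bs g x) x
      = partial_deriv b (derivs bs f) x + c * partial_deriv b (derivs bs g) x" for x
    by (subst partial_deriv_add[OF d(1)]) (auto simp: d(2) partial_deriv_cmult[OF d(2)] intro: differentiable_mult)
  then show ?case using Cons by simp
qed simp

lemma tempered_dist_zero_limit:
  fixes \<Psi> :: "'a::euclidean_space \<Rightarrow> complex"
  assumes k: "tempered_dist k" and \<Psi>: "\<Psi> \<in> schwartz" and \<Psi>': "\<And>i. \<Psi>' i \<in> schwartz" and zero: "\<And>i::nat. k (\<Psi>' i) = 0"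
    and conv: "\<And>N. \<exists>e. e \<longlonglongrightarrow> (0::real) \<and> (\<forall>i bs x. set bs \<subseteq> Basis \<longrightarrow> length bs \<le> N \<longrightarrow>
      (1 + norm x) ^ N * cmod (derivs bs \<Psi> x - derivs bs (\<Psi>' i) x) \<le> e i)"
  shows "k \<Psi> = 0"
proof -
  obtain C N where C: "\<And>\<phi>. \<phi> \<in> schwartz \<Longrightarrow> cmod (k \<phi>) \<le> C * schwartz_norm N \<phi>"
    using k unfolding tempered_dist_def by blast
  obtain e where e: "e \<longlonglongrightarrow> 0" and e_le: "\<And>i bs x. set bs \<subseteq> Basis \<Longrightarrow> length bs \<le> N \<Longrightarrow>
      (1 + norm x) ^ N * cmod (derivs bs \<Psi> x - derivs bs (\<Psi>' i) x) \<le> e i"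
    using conv[of N] by blast
  have "cmod (k \<Psi>) \<le> \<bar>C\<bar> * e i" for i
  proof -
    let ?d = "\<lambda>x. \<Psi> x + (- 1) * \<Psi>' i x"
    have d: "?d \<in> schwartz" by (intro schwartz_add schwartz_cmult \<Psi> \<Psi>')
    have "k ?d = k \<Psi> + (- 1) * k (\<Psi>' i)"
      using k \<Psi> \<Psi>'[of i] schwartz_cmult[OF \<Psi>'[of i], of "- 1"] unfolding tempered_dist_def by metis
    then have "k ?d = k \<Psi>" by (simp only: zero mult_zero_right add_0_right)
    then have "cmod (k \<Psi>) \<le> C * schwartz_norm N ?d" using C[OF d] by (simp only:)
    also have "\<dots> \<le> \<bar>C\<bar> * schwartz_norm N ?d" by (intro mult_right_mono schwartz_norm_nonneg d) simp
    also have "\<dots> \<le> \<bar>C\<bar> * e i"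
    proof (intro mult_left_mono schwartz_norm_least)
      fix bs :: "'a list" and x assume bs: "set bs \<subseteq> Basis" "length bs \<le> N"
      have "derivs bs ?d x = derivs bs \<Psi> x - derivs bs (\<Psi>' i) x"
        unfolding foldr_partial_deriv_add_cmult[OF \<Psi> \<Psi>' bs(1)] by simp
      then show "(1 + norm x) ^ N * cmod (derivs bs ?d x) \<le> e i" using e_le[OF bs] by (simp only:)
    qed simp
    finally show ?thesis .
  qed
  moreover have "(\<lambda>i. \<bar>C\<bar> * e i) \<longlonglongrightarrow> \<bar>C\<bar> * 0" by (intro tendsto_mult_left e)
  ultimately have "cmod (k \<Psi>) \<le> \<bar>C\<bar> * 0" by (intro LIMSEQ_le_const) auto
  then show ?thesis by simp
qed

lemma tempered_dist_sum:
  assumes k: "tempered_dist k" and fin: "finite I" "I \<noteq> {}" and f: "\<And>i. i \<in> I \<Longrightarrow> f i \<in> schwartz" and zero: "\<And>i. i \<in> I \<Longrightarrow> k (f i) = 0"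
  shows "k (\<lambda>x. \<Sum>i\<in>I. \<gamma> i * f i x) = 0"
  using fin f zero
proof (induction rule: finite_ne_induct)
  case (singleton i)
  then show ?case using k unfolding tempered_dist_def by simp
next
  case (insert i I)
  have 1: "(\<lambda>x. \<gamma> i * f i x) \<in> schwartz" "(\<lambda>x. \<Sum>i\<in>I. \<gamma> i * f i x) \<in> schwartz"
    using insert by (auto intro!: schwartz_cmult schwartz_sum)
  have "(\<lambda>x. \<Sum>i\<in>insert i I. \<gamma> i * f i x) = (\<lambda>x. \<gamma> i * f i x + (\<Sum>i\<in>I. \<gamma> i * f i x))"
    using insert by simp
  then have "k (\<lambda>x. \<Sum>i\<in>insert i I. \<gamma> i * f i x) = k (\<lambda>x. \<gamma> i * f i x) + k (\<lambda>x. \<Sum>i\<in>I. \<gamma> i * f i x)"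
    using k 1 unfolding tempered_dist_def by (simp only:)
  also have "k (\<lambda>x. \<gamma> i * f i x) = \<gamma> i * k (f i)" using k insert unfolding tempered_dist_def by blast
  finally show ?case using insert by simp
qed

lemma integrable_rapidly_decreasing_weight:
  fixes c :: "'b::euclidean_space \<Rightarrow> complex"
  assumes [measurable]: "c \<in> borel_measurable borel" and c: "rapidly_decreasing c"
  shows "integrable lborel (\<lambda>t. cmod (c t) * (B * (1 + norm t) ^ K))"
proof -
  have "rapidly_decreasing (\<lambda>t. of_real ((1 + norm t) ^ K) * c t)"
    by (rule rapidly_decreasing_mult[OF c, of _ 1 K]) (simp del: of_real_power of_real_add)
  then have "integrable lborel (\<lambda>t. of_real ((1 + norm t) ^ K) * c t)"
    by (intro integrable_rapidly_decreasing) measurable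
  from integrable_mult_right[OF integrable_norm[OF this], of B] show ?thesis
    by (simp add: norm_mult mult_ac del: of_real_power of_real_add)
qed

text \<open>
  Iterated differentiation under the integral sign. Stating it with measurability in \<open>t\<close> instead of
  continuity makes it apply to families composed with simple functions.
\<close>

lemma superposition_schwartz:
  fixes H :: "'b::euclidean_space \<Rightarrow> 'a::euclidean_space \<Rightarrow> complex"
  assumes H: "\<And>t. H t \<in> schwartz"
    and meas: "\<And>bs x. set bs \<subseteq> Basis \<Longrightarrow> (\<lambda>t. derivs bs (H t) x) \<in> borel_measurable borel"
    and growth: "\<And>bs N. set bs \<subseteq> Basis \<Longrightarrow>
      \<exists>B K. \<forall>t x. (1 + norm x) ^ N * cmod (derivs bs (H t) x) \<le> B * (1 + norm t) ^ K"
    and c: "c \<in> borel_measurable borel" "rapidly_decreasing c"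
  shows "(\<lambda>x. LINT t|lborel. c t * H t x) \<in> schwartz"
    and "set bs \<subseteq> Basis \<Longrightarrow> derivs bs (\<lambda>x. LINT t|lborel. c t * H t x) = (\<lambda>x. LINT t|lborel. c t * derivs bs (H t) x)"
    and "set bs \<subseteq> Basis \<Longrightarrow> integrable lborel (\<lambda>t. c t * derivs bs (H t) x)"
proof -
  define \<Psi> where "\<Psi> bs x = (LINT t|lborel. c t * derivs bs (H t) x)" for bs x
  have c_meas[measurable]: "c \<in> borel_measurable borel" by (rule c(1))
  note weight = integrable_rapidly_decreasing_weight[OF c]
  have int: "integrable lborel (\<lambda>t. c t * derivs bs (H t) x)" if bs: "set bs \<subseteq> Basis" for bs x
  proof -
    obtain B K where B: "\<And>t x. cmod (derivs bs (H t) x) \<le> B * (1 + norm t) ^ K"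
      using growth[OF bs, of 0] by auto
    have [measurable]: "(\<lambda>t. derivs bs (H t) x) \<in> borel_measurable borel" by (rule meas[OF bs])
    show ?thesis
    proof (rule Bochner_Integration.integrable_bound[OF weight[of B K]])
      show "AE t in lborel. norm (c t * derivs bs (H t) x) \<le> norm (cmod (c t) * (B * (1 + norm t) ^ K))"
      proof (intro always_eventually allI)
        fix t
        have "norm (c t * derivs bs (H t) x) \<le> cmod (c t) * (B * (1 + norm t) ^ K)"
          unfolding norm_mult by (intro mult_left_mono B) simp
        then show "norm (c t * derivs bs (H t) x) \<le> norm (cmod (c t) * (B * (1 + norm t) ^ K))"
          unfolding real_norm_def by (rule order_trans[OF _ abs_ge_self])
      qed
    qed measurable
  qed
  then show "set bs \<subseteq> Basis \<Longrightarrow> integrable lborel (\<lambda>t. c t * derivs bs (H t) x)" .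
  have deriv: "(\<Psi> bs has_derivative (\<lambda>v. LINT t|lborel. c t * gradient_apply (derivs bs (H t)) x v)) (at x)"
    if bs: "set bs \<subseteq> Basis" for bs x
  proof -
    have "\<forall>b. \<exists>B K. b \<in> Basis \<longrightarrow> (\<forall>t x. cmod (partial_deriv b (derivs bs (H t)) x) \<le> B * (1 + norm t) ^ K)"
    proof
      fix b :: 'a
      show "\<exists>B K. b \<in> Basis \<longrightarrow> (\<forall>t x. cmod (partial_deriv b (derivs bs (H t)) x) \<le> B * (1 + norm t) ^ K)"
        using growth[of "b # bs" 0] bs by (cases "b \<in> Basis") auto
    qed
    then obtain B K where B: "\<And>b t x. b \<in> Basis \<Longrightarrow> cmod (partial_deriv b (derivs bs (H t)) x) \<le> B b * (1 + norm t) ^ K b"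
      by metis
    show ?thesis
      unfolding \<Psi>_def
    proof (rule has_derivative_integral(1))
      show "integrable lborel (\<lambda>t. c t * derivs bs (H t) y)" for y by (rule int[OF bs])
      show "((\<lambda>x. c t * derivs bs (H t) x) has_derivative (\<lambda>v. c t * gradient_apply (derivs bs (H t)) y v)) (at y)" for t y
        by (intro has_derivative_mult_right has_derivative_gradient_apply schwartz_foldr H bs)
      show "integrable lborel (\<lambda>t. \<Sum>b\<in>Basis. cmod (c t) * (B b * (1 + norm t) ^ K b))"
        by (intro Bochner_Integration.integrable_sum weight)
      fix t y v
      have "cmod (c t * gradient_apply (derivs bs (H t)) y v)
          \<le> cmod (c t) * (norm v * (\<Sum>b\<in>Basis. B b * (1 + norm t) ^ K b))"
        unfolding norm_mult
        by (intro mult_left_mono order_trans[OF cmod_gradient_apply_le] sum_mono B) auto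
      then show "cmod (c t * gradient_apply (derivs bs (H t)) y v) \<le> (\<Sum>b\<in>Basis. cmod (c t) * (B b * (1 + norm t) ^ K b)) * norm v"
        by (simp add: sum_distrib_left mult_ac)
    qed
  qed
  have pd: "partial_deriv b (\<Psi> bs) = \<Psi> (b # bs)" if "set bs \<subseteq> Basis" "b \<in> Basis" for b bs
    by (intro ext) (simp add: partial_deriv_eq[OF deriv[OF that(1)]] gradient_apply_Basis[OF that(2)] \<Psi>_def)
  have foldr: "derivs bs (\<Psi> []) = \<Psi> bs" if "set bs \<subseteq> Basis" for bs
    using that by (induction bs) (auto simp: pd)
  have eq: "(\<lambda>x. LINT t|lborel. c t * H t x) = \<Psi> []" by (rule ext) (simp add: \<Psi>_def)
  show "set bs \<subseteq> Basis \<Longrightarrow> derivs bs (\<lambda>x. LINT t|lborel. c t * H t x) = (\<lambda>x. LINT t|lborel. c t * derivs bs (H t) x)"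
    unfolding eq foldr \<Psi>_def ..
  show "(\<lambda>x. LINT t|lborel. c t * H t x) \<in> schwartz"
    unfolding schwartz_iff eq
  proof (intro conjI allI impI)
    show "smooth (\<Psi> [])"
      unfolding smooth_def using deriv foldr by (metis differentiableI)
    fix bs :: "'a list" assume bs: "set bs \<subseteq> Basis"
    show "rapidly_decreasing (derivs bs (\<Psi> []))"
      unfolding foldr[OF bs] rapidly_decreasing_def
    proof
      fix N
      obtain B K where B: "\<And>t x. (1 + norm x) ^ N * cmod (derivs bs (H t) x) \<le> B * (1 + norm t) ^ K"
        using growth[OF bs, of N] by blast
      have "(1 + norm x) ^ N * cmod (\<Psi> bs x) \<le> (LINT t|lborel. cmod (c t) * (B * (1 + norm t) ^ K))" for x
      proof -
        have "(1 + norm x) ^ N * cmod (\<Psi> bs x) = cmod (of_real ((1 + norm x) ^ N) * \<Psi> bs x)"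
          by (simp add: norm_mult del: of_real_power of_real_add)
        also have "\<dots> = cmod (LINT t|lborel. of_real ((1 + norm x) ^ N) * (c t * derivs bs (H t) x))"
          unfolding \<Psi>_def integral_mult_right_zero ..
        also have "\<dots> \<le> (LINT t|lborel. cmod (c t) * (B * (1 + norm t) ^ K))"
        proof (rule norm_lebesgue_integral_le[OF weight])
          fix t
          have "cmod (of_real ((1 + norm x) ^ N) * (c t * derivs bs (H t) x))
              = cmod (c t) * ((1 + norm x) ^ N * cmod (derivs bs (H t) x))"
            by (simp add: norm_mult mult_ac del: of_real_power of_real_add)
          also have "\<dots> \<le> cmod (c t) * (B * (1 + norm t) ^ K)" by (intro mult_left_mono B) simp
          finally show "cmod (of_real ((1 + norm x) ^ N) * (c t * derivs bs (H t) x)) \<le> cmod (c t) * (B * (1 + norm t) ^ K)" .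
        qed
        finally show ?thesis .
      qed
      then show "\<exists>B. \<forall>x. (1 + norm x) ^ N * cmod (\<Psi> bs x) \<le> B" by blast
    qed
  qed
qed

text \<open>
  Polynomial growth and polynomially controlled Lipschitz dependence on the parameter, in every
  Schwartz seminorm: exactly what dominated convergence needs when the parameter is approximated.
\<close>

definition tempered_family :: "('b::euclidean_space \<Rightarrow> 'a::euclidean_space \<Rightarrow> complex) \<Rightarrow> bool" where
  "tempered_family H \<longleftrightarrow> (\<forall>t. H t \<in> schwartz) \<and> (\<forall>bs N. set bs \<subseteq> Basis \<longrightarrow>
     (\<exists>B K. \<forall>t x. (1 + norm x) ^ N * cmod (derivs bs (H t) x) \<le> B * (1 + norm t) ^ K) \<and>
     (\<exists>B K. \<forall>t t' x. (1 + norm x) ^ N * cmod (derivs bs (H t) x - derivs bs (H t') x)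
        \<le> B * (1 + norm t + norm t') ^ K * norm (t - t')))"

lemma tempered_family_measurable:
  fixes H :: "'b::euclidean_space \<Rightarrow> 'a::euclidean_space \<Rightarrow> complex"
  assumes H: "tempered_family H" and bs: "set bs \<subseteq> Basis"
  shows "(\<lambda>t. derivs bs (H t) x) \<in> borel_measurable borel"
proof (rule borel_measurable_continuous_onI)
  have "\<exists>B K. \<forall>t t' x. (1 + norm x) ^ 0 * cmod (derivs bs (H t) x - derivs bs (H t') x)
        \<le> B * (1 + norm t + norm t') ^ K * norm (t - t')"
    using H bs unfolding tempered_family_def by blast
  then obtain B K where B: "\<And>t t' x. cmod (derivs bs (H t) x - derivs bs (H t') x)
        \<le> B * (1 + norm t + norm t') ^ K * norm (t - t')" by auto
  have "((\<lambda>t. derivs bs (H t) x) \<longlongrightarrow> derivs bs (H a) x) (at a)" for a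
  proof -
    have "((\<lambda>t. B * (1 + norm t + norm a) ^ K * norm (t - a)) \<longlongrightarrow> B * (1 + norm a + norm a) ^ K * norm (a - a)) (at a)"
      by (intro tendsto_intros)
    then have "((\<lambda>t. B * (1 + norm t + norm a) ^ K * norm (t - a)) \<longlongrightarrow> 0) (at a)" by simp
    then have "((\<lambda>t. derivs bs (H t) x - derivs bs (H a) x) \<longlongrightarrow> 0) (at a)"
      by (rule Lim_null_comparison[rotated]) (intro always_eventually allI B)
    then show ?thesis by (rule LIM_zero_cancel)
  qed
  then show "continuous_on UNIV (\<lambda>t. derivs bs (H t) x)"
    by (simp add: continuous_on_def)
qed

lemma tempered_family_superposition:
  fixes H :: "'b::euclidean_space \<Rightarrow> 'a::euclidean_space \<Rightarrow> complex"
  assumes H: "tempered_family H" and c: "c \<in> borel_measurable borel" "rapidly_decreasing c"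
  shows "(\<lambda>x. LINT t|lborel. c t * H t x) \<in> schwartz"
    and "set bs \<subseteq> Basis \<Longrightarrow> derivs bs (\<lambda>x. LINT t|lborel. c t * H t x) = (\<lambda>x. LINT t|lborel. c t * derivs bs (H t) x)"
    and "set bs \<subseteq> Basis \<Longrightarrow> integrable lborel (\<lambda>t. c t * derivs bs (H t) x)"
proof -
  have g: "\<exists>B K. \<forall>t x. (1 + norm x) ^ N * cmod (derivs bs (H t) x) \<le> B * (1 + norm t) ^ K" if "set bs \<subseteq> Basis" for bs N
    using H that unfolding tempered_family_def by blast
  have h: "H t \<in> schwartz" for t using H unfolding tempered_family_def by blast
  note S = superposition_schwartz[of H, OF h tempered_family_measurable[OF H] g c]
  show "(\<lambda>x. LINT t|lborel. c t * H t x) \<in> schwartz" by (rule S(1))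
  show "set bs \<subseteq> Basis \<Longrightarrow> derivs bs (\<lambda>x. LINT t|lborel. c t * H t x) = (\<lambda>x. LINT t|lborel. c t * derivs bs (H t) x)"
    by (rule S(2))
  show "set bs \<subseteq> Basis \<Longrightarrow> integrable lborel (\<lambda>t. c t * derivs bs (H t) x)"
    by (rule S(3))
qed

text \<open>
  A distribution is only known to respect finite sums. Let \<open>s i\<close> be simple functions converging to
  the identity on the parameter space. Replacing \<open>H t\<close> by \<open>H (s i t)\<close> turns the integral into a finite
  sum, on which \<open>k\<close> vanishes, and by the Lipschitz bound the error tends to 0 in every seminorm.
\<close>

lemma tempered_dist_superposition:
  fixes H :: "'b::euclidean_space \<Rightarrow> 'a::euclidean_space \<Rightarrow> complex"
  assumes k: "tempered_dist k" and H: "tempered_family H" and zero: "\<And>t. k (H t) = 0"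
    and c: "c \<in> borel_measurable borel" "rapidly_decreasing c"
  shows "k (\<lambda>x. LINT t|lborel. c t * H t x) = 0"
proof -
  have HS: "H t \<in> schwartz" for t using H unfolding tempered_family_def by blast
  have c_meas[measurable]: "c \<in> borel_measurable borel" by (rule c(1))
  have c_int: "integrable lborel c" using c by (rule integrable_rapidly_decreasing)
  have "(\<lambda>t::'b. t) \<in> borel_measurable lborel" by simp
  from borel_measurable_implies_sequence_metric[OF this, of 0]
  obtain s :: "nat \<Rightarrow> 'b \<Rightarrow> 'b" where s: "\<And>i. simple_function lborel (s i)" and s_lim: "\<And>t. (\<lambda>i. s i t) \<longlonglongrightarrow> t"
    and s_le: "\<And>i t. norm (s i t) \<le> 2 * norm t"
    by auto
  have s_meas[measurable]: "s i \<in> borel_measurable borel" for i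
    using borel_measurable_simple_function[OF s[of i]] by simp
  define \<Psi>' where "\<Psi>' i x = (LINT t|lborel. c t * H (s i t) x)" for i x
  have growth': "\<exists>B K. \<forall>t x. (1 + norm x) ^ N * cmod (derivs bs (H (s i t)) x) \<le> B * (1 + norm t) ^ K"
    if bs: "set bs \<subseteq> Basis" for bs N i
  proof -
    obtain B K where B: "\<And>t x. (1 + norm x) ^ N * cmod (derivs bs (H t) x) \<le> B * (1 + norm t) ^ K"
      using H bs unfolding tempered_family_def by meson
    have B0: "B \<ge> 0" using order_trans[OF _ B[of 0 0]] by simp
    have "(1 + norm x) ^ N * cmod (derivs bs (H (s i t)) x) \<le> B * 2 ^ K * (1 + norm t) ^ K" for t x
    proof -
      have "(1 + norm (s i t)) ^ K \<le> (2 * (1 + norm t)) ^ K" using s_le[of i t] by (intro power_mono) auto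
      then have "B * (1 + norm (s i t)) ^ K \<le> B * 2 ^ K * (1 + norm t) ^ K"
        using B0 by (simp only: power_mult_distrib mult.assoc mult_left_mono)
      then show ?thesis by (rule order_trans[OF B])
    qed
    then show ?thesis by blast
  qed
  have meas': "(\<lambda>t. derivs bs (H (s i t)) x) \<in> borel_measurable borel" if "set bs \<subseteq> Basis" for bs x i
    by (rule measurable_compose[OF s_meas tempered_family_measurable[OF H that]])
  note S = tempered_family_superposition[OF H c]
  show ?thesis
  proof (rule tempered_dist_zero_limit[OF k S(1), of \<Psi>'])
    show "\<Psi>' i \<in> schwartz" for i
      unfolding \<Psi>'_def[abs_def] by (rule superposition_schwartz(1)[OF HS meas' growth' c])
    show "k (\<Psi>' i) = 0" for i
    proof -
      define V where "V = range (s i)"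
      have V: "finite V" "V \<noteq> {}" using simple_functionD(1)[OF s[of i]] by (simp_all add: V_def)
      define \<gamma> where "\<gamma> v = (LINT t|lborel. c t * indicator (s i -` {v}) t)" for v
      have "\<Psi>' i x = (\<Sum>v\<in>V. \<gamma> v * H v x)" for x
      proof -
        have "c t * H (s i t) x = (\<Sum>v\<in>V. (c t * indicator (s i -` {v}) t) * H v x)" for t
        proof -
          have "(\<Sum>v\<in>V. (c t * indicator (s i -` {v}) t) * H v x) = (\<Sum>v\<in>V. if s i t = v then c t * H v x else 0)"
            by (intro sum.cong) (auto simp: indicator_def)
          then show ?thesis using V(1) by (simp add: V_def)
        qed
        moreover have "integrable lborel (\<lambda>t. (c t * indicator (s i -` {v}) t) * H v x)" for v
        proof (intro integrable_mult_left integrable_mult_bounded(1)[where B = 1] c_int)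
          show "indicator (s i -` {v}) \<in> borel_measurable borel"
            using measurable_sets[OF s_meas[of i], of "{v}"] by (intro borel_measurable_indicator) simp
        qed (simp add: indicator_def)
        ultimately show ?thesis
          unfolding \<Psi>'_def \<gamma>_def by (simp only: Bochner_Integration.integral_sum integral_mult_left_zero)
      qed
      then have "\<Psi>' i = (\<lambda>x. \<Sum>v\<in>V. \<gamma> v * H v x)" by blast
      then show ?thesis using tempered_dist_sum[OF k V HS zero] by (simp only:)
    qed
    fix N
    define L where "L = {bs :: 'a list. set bs \<subseteq> Basis \<and> length bs \<le> N}"
    have L: "finite L" unfolding L_def by (rule finite_lists_length_le) simp
    have "\<forall>bs. \<exists>B K. bs \<in> L \<longrightarrow> (\<forall>t t' x. (1 + norm x) ^ N * cmod (derivs bs (H t) x - derivs bs (H t') x)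
        \<le> B * (1 + norm t + norm t') ^ K * norm (t - t'))"
      using H unfolding tempered_family_def L_def by blast
    then obtain B K where B: "\<And>bs t t' x. bs \<in> L \<Longrightarrow> (1 + norm x) ^ N * cmod (derivs bs (H t) x - derivs bs (H t') x)
        \<le> B bs * (1 + norm t + norm t') ^ K bs * norm (t - t')" by metis
    \<comment> \<open>One pair of constants that serves all derivatives of order at most N.\<close>
    define B' where "B' = (\<Sum>bs\<in>L. \<bar>B bs\<bar>)"
    define K' where "K' = (\<Sum>bs\<in>L. K bs)"
    have B': "B' \<ge> 0" unfolding B'_def by (intro sum_nonneg) simp
    have lip: "(1 + norm x) ^ N * cmod (derivs bs (H t) x - derivs bs (H t') x)
        \<le> B' * (1 + norm t + norm t') ^ K' * norm (t - t')" if bs: "bs \<in> L" for bs t t' x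
    proof (rule order_trans[OF B[OF bs]], intro mult_right_mono mult_mono power_increasing)
      have "\<bar>B bs\<bar> \<le> B'" unfolding B'_def using L bs by (intro member_le_sum[of bs L "\<lambda>bs. \<bar>B bs\<bar>"]) auto
      then show "B bs \<le> B'" by simp
      show "K bs \<le> K'" unfolding K'_def using L bs by (intro member_le_sum) auto
    qed (use B' in auto)
    define e where "e i = (LINT t|lborel. cmod (c t) * (B' * (1 + norm t + norm (s i t)) ^ K' * norm (t - s i t)))" for i
    have dom: "B' * (1 + norm t + norm (s i t)) ^ K' * norm (t - s i t) \<le> (B' * 3 ^ (K' + 1)) * (1 + norm t) ^ (K' + 1)" for i t
    proof -
      have "B' * (1 + norm t + norm (s i t)) ^ K' * norm (t - s i t) \<le> B' * (3 * (1 + norm t)) ^ K' * (3 * (1 + norm t))"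
        using s_le[of i t] norm_triangle_ineq4[of t "s i t"] B' by (intro mult_mono power_mono) auto
      then show ?thesis by (simp only: power_mult_distrib power_add power_one_right mult_ac)
    qed
    note weight = integrable_rapidly_decreasing_weight[OF c, of "B' * 3 ^ (K' + 1)" "K' + 1"]
    have le: "norm (cmod (c t) * (B' * (1 + norm t + norm (s i t)) ^ K' * norm (t - s i t))) \<le> cmod (c t) * ((B' * 3 ^ (K' + 1)) * (1 + norm t) ^ (K' + 1))" for i t
    proof -
      have "0 \<le> cmod (c t) * (B' * (1 + norm t + norm (s i t)) ^ K' * norm (t - s i t))" using B' by simp
      then show ?thesis unfolding real_norm_def by (simp only: abs_of_nonneg) (intro mult_left_mono dom norm_ge_zero)
    qed
    have m: "(\<lambda>t. cmod (c t) * (B' * (1 + norm t + norm (s i t)) ^ K' * norm (t - s i t))) \<in> borel_measurable lborel" for i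
      by measurable
    have e_int: "integrable lborel (\<lambda>t. cmod (c t) * (B' * (1 + norm t + norm (s i t)) ^ K' * norm (t - s i t)))" for i
    proof (rule Bochner_Integration.integrable_bound[OF weight m])
      show "AE t in lborel. norm (cmod (c t) * (B' * (1 + norm t + norm (s i t)) ^ K' * norm (t - s i t))) \<le> norm (cmod (c t) * ((B' * 3 ^ (K' + 1)) * (1 + norm t) ^ (K' + 1)))"
        by (intro always_eventually allI order_trans[OF le]) (simp only: real_norm_def abs_ge_self)
    qed
    have "e \<longlonglongrightarrow> (LINT t::'b|lborel. 0)"
      unfolding e_def
    proof (rule integral_dominated_convergence[OF _ m weight])
      show "AE t in lborel. (\<lambda>i. cmod (c t) * (B' * (1 + norm t + norm (s i t)) ^ K' * norm (t - s i t))) \<longlonglongrightarrow> 0"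
      proof (intro always_eventually allI)
        fix t
        have "(\<lambda>i. cmod (c t) * (B' * (1 + norm t + norm (s i t)) ^ K' * norm (t - s i t)))
           \<longlonglongrightarrow> cmod (c t) * (B' * (1 + norm t + norm t) ^ K' * norm (t - t))"
          by (intro tendsto_intros s_lim)
        then show "(\<lambda>i. cmod (c t) * (B' * (1 + norm t + norm (s i t)) ^ K' * norm (t - s i t))) \<longlonglongrightarrow> 0" by simp
      qed
      show "AE t in lborel. norm (cmod (c t) * (B' * (1 + norm t + norm (s i t)) ^ K' * norm (t - s i t))) \<le> cmod (c t) * ((B' * 3 ^ (K' + 1)) * (1 + norm t) ^ (K' + 1))" for i
        by (intro always_eventually allI le)
    qed simp
    then have e0: "e \<longlonglongrightarrow> 0" by simp
    have "(1 + norm x) ^ N * cmod (derivs bs (\<lambda>x. LINT t|lborel. c t * H t x) x - derivs bs (\<Psi>' i) x) \<le> e i"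
      if bs: "set bs \<subseteq> Basis" "length bs \<le> N" for i bs x
    proof -
      let ?D = "\<lambda>t. derivs bs (H t) x - derivs bs (H (s i t)) x"
      have D': "derivs bs (\<Psi>' i) = (\<lambda>x. LINT t|lborel. c t * derivs bs (H (s i t)) x)"
        unfolding \<Psi>'_def[abs_def] by (rule superposition_schwartz(2)[OF HS meas' growth' c bs(1)])
      have D'_int: "integrable lborel (\<lambda>t. c t * derivs bs (H (s i t)) x)"
        by (rule superposition_schwartz(3)[OF HS meas' growth' c bs(1)])
      have "derivs bs (\<lambda>x. LINT t|lborel. c t * H t x) x - derivs bs (\<Psi>' i) x = (LINT t|lborel. c t * ?D t)"
        unfolding S(2)[OF bs(1)] D' right_diff_distrib
        by (rule Bochner_Integration.integral_diff[symmetric, OF S(3)[OF bs(1)] D'_int])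
      then have "(1 + norm x) ^ N * cmod (derivs bs (\<lambda>x. LINT t|lborel. c t * H t x) x - derivs bs (\<Psi>' i) x)
         = cmod (of_real ((1 + norm x) ^ N) * (LINT t|lborel. c t * ?D t))"
        by (simp add: norm_mult del: of_real_power of_real_add)
      also have "\<dots> = cmod (LINT t|lborel. of_real ((1 + norm x) ^ N) * (c t * ?D t))"
        unfolding integral_mult_right_zero ..
      also have "\<dots> \<le> e i" unfolding e_def
      proof (rule norm_lebesgue_integral_le[OF e_int])
        fix t
        have "cmod (of_real ((1 + norm x) ^ N) * (c t * ?D t)) = cmod (c t) * ((1 + norm x) ^ N * cmod (?D t))"
          by (simp add: norm_mult mult_ac del: of_real_power of_real_add)
        also have "\<dots> \<le> cmod (c t) * (B' * (1 + norm t + norm (s i t)) ^ K' * norm (t - s i t))"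
          using bs by (intro mult_left_mono lip) (auto simp: L_def)
        finally show "cmod (of_real ((1 + norm x) ^ N) * (c t * ?D t)) \<le> cmod (c t) * (B' * (1 + norm t + norm (s i t)) ^ K' * norm (t - s i t))" .
      qed
      finally show ?thesis .
    qed
    with e0 show "\<exists>e. e \<longlonglongrightarrow> 0 \<and> (\<forall>i bs x. set bs \<subseteq> Basis \<longrightarrow> length bs \<le> N \<longrightarrow>
      (1 + norm x) ^ N * cmod (derivs bs (\<lambda>x. LINT t|lborel. c t * H t x) x - derivs bs (\<Psi>' i) x) \<le> e i)"
      by blast
  qed
qed

section \<open>Families of translates and of modulations\<close>

lemma foldr_partial_deriv_translate:
  assumes f: "f \<in> schwartz" and bs: "set bs \<subseteq> Basis"
  shows "derivs bs (\<lambda>x. f (x + a)) = (\<lambda>x. derivs bs f (x + a))"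
  using bs
proof (induction bs)
  case (Cons b bs)
  then have "derivs bs f differentiable (at (1 *\<^sub>R x + a))" for x
    using f by (intro schwartz_differentiable schwartz_foldr) auto
  then have pd: "partial_deriv b (\<lambda>x. derivs bs f (x + a)) x = partial_deriv b (derivs bs f) (x + a)" for x
    using partial_deriv_affine(1)[of "derivs bs f" 1 x a b] by simp
  have "derivs bs (\<lambda>x. f (x + a)) = (\<lambda>x. derivs bs f (x + a))" using Cons by simp
  with pd show ?case by auto
qed simp

lemma schwartz_translate: "f \<in> schwartz \<Longrightarrow> (\<lambda>x. f (x + a)) \<in> schwartz"
  using schwartz_affine[of f 1 a] by simp

text \<open>
  The mean value inequality on the segment from \<open>x + v\<close> to \<open>x + u\<close>; for a point of this segment the
  weight differs from that at \<open>x\<close> by a factor of at most \<open>1 + norm u + norm v\<close>.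
\<close>

lemma schwartz_lipschitz_translate:
  fixes F :: "'a::euclidean_space \<Rightarrow> complex"
  assumes F: "F \<in> schwartz"
  shows "\<exists>B\<ge>0. \<forall>u v x. (1 + norm x) ^ N * cmod (F (x + u) - F (x + v)) \<le> B * (1 + norm u + norm v) ^ N * norm (u - v)"
proof -
  have "\<forall>b. \<exists>B. b \<in> Basis \<longrightarrow> (\<forall>x. (1 + norm x) ^ N * cmod (partial_deriv b F x) \<le> B)"
    using schwartz_bound[OF schwartz_partial_deriv[OF F]] by metis
  then obtain B where B: "\<And>b x. b \<in> Basis \<Longrightarrow> (1 + norm x) ^ N * cmod (partial_deriv b F x) \<le> B b" by metis
  have B0: "0 \<le> B b" if "b \<in> Basis" for b using order_trans[OF _ B[OF that, of 0]] by simp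
  define B' where "B' = (\<Sum>b\<in>Basis. B b)"
  have B': "B' \<ge> 0" unfolding B'_def by (intro sum_nonneg B0)
  have "(1 + norm x) ^ N * cmod (F (x + u) - F (x + v)) \<le> B' * (1 + norm u + norm v) ^ N * norm (u - v)" for u v x
  proof -
    define W where "W = (1 + norm u + norm v) ^ N / (1 + norm x) ^ N"
    have grad: "cmod (gradient_apply F y h) \<le> B' * W * norm h" if y: "y \<in> closed_segment (x + v) (x + u)" for y h
    proof -
      obtain r where r: "0 \<le> r" "r \<le> 1" "y = (1 - r) *\<^sub>R (x + v) + r *\<^sub>R (x + u)"
        using y by (auto simp: closed_segment_def)
      define w where "w = (1 - r) *\<^sub>R v + r *\<^sub>R u"
      have yw: "y = x + w" unfolding r(3) w_def by (simp add: algebra_simps)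
      have "norm w \<le> (1 - r) * norm v + r * norm u"
        unfolding w_def using r by (intro order_trans[OF norm_triangle_ineq]) simp
      also have "\<dots> \<le> 1 * norm v + 1 * norm u" using r by (intro add_mono mult_right_mono) auto
      finally have w: "1 + norm w \<le> 1 + norm u + norm v" by simp
      have "(1 + norm x) ^ N \<le> ((1 + norm y) * (1 + norm u + norm v)) ^ N"
        unfolding yw by (intro power_mono order_trans[OF one_plus_norm_le_shift[of x w]] mult_left_mono w) auto
      then have pw: "(1 + norm x) ^ N \<le> (1 + norm y) ^ N * (1 + norm u + norm v) ^ N" by (simp only: power_mult_distrib)
      have pd: "cmod (partial_deriv b F y) \<le> B b * W" if b: "b \<in> Basis" for b
      proof -
        have "(1 + norm x) ^ N * cmod (partial_deriv b F y) \<le> ((1 + norm y) ^ N * (1 + norm u + norm v) ^ N) * cmod (partial_deriv b F y)"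
          by (intro mult_right_mono pw) simp
        also have "\<dots> = (1 + norm u + norm v) ^ N * ((1 + norm y) ^ N * cmod (partial_deriv b F y))" by (simp only: mult_ac)
        also have "\<dots> \<le> (1 + norm u + norm v) ^ N * B b" by (intro mult_left_mono B b) simp
        finally show ?thesis unfolding W_def by (simp add: field_simps add_pos_nonneg)
      qed
      have "cmod (gradient_apply F y h) \<le> norm h * (\<Sum>b\<in>Basis. B b * W)"
        by (intro order_trans[OF cmod_gradient_apply_le] mult_left_mono sum_mono pd) auto
      also have "(\<Sum>b\<in>Basis. B b * W) = B' * W" by (simp add: B'_def sum_distrib_right)
      finally show ?thesis by (simp only: mult_ac)
    qed
    have "cmod (F (x + u) - F (x + v)) \<le> B' * W * norm ((x + u) - (x + v))"
    proof (rule differentiable_bound[of "closed_segment (x + v) (x + u)"])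
      show "(F has_derivative gradient_apply F y) (at y within closed_segment (x + v) (x + u))" for y
        by (rule has_derivative_at_withinI[OF has_derivative_gradient_apply[OF F]])
      show "onorm (gradient_apply F y) \<le> B' * W" if "y \<in> closed_segment (x + v) (x + u)" for y
        by (rule onorm_le) (rule grad[OF that])
    qed auto
    then have "(1 + norm x) ^ N * cmod (F (x + u) - F (x + v)) \<le> (1 + norm x) ^ N * (B' * W * norm (u - v))"
      by (intro mult_left_mono) auto
    also have "\<dots> = B' * (1 + norm u + norm v) ^ N * norm (u - v)"
    proof -
      have "1 + norm x \<noteq> 0" using norm_ge_zero[of x] by linarith
      then show ?thesis by (simp add: W_def)
    qed
    finally show ?thesis .
  qed
  with B' show ?thesis by blast
qed

lemma tempered_family_translate:
  fixes h :: "'a::euclidean_space \<Rightarrow> complex"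
  assumes h: "h \<in> schwartz"
  shows "tempered_family (\<lambda>t x. h (x + r *\<^sub>R t))"
  unfolding tempered_family_def
proof (intro conjI allI impI)
  show "(\<lambda>x. h (x + r *\<^sub>R t)) \<in> schwartz" for t by (rule schwartz_translate[OF h])
  fix bs :: "'a list" and N :: nat assume bs: "set bs \<subseteq> Basis"
  define F where "F = derivs bs h"
  have F: "F \<in> schwartz" unfolding F_def by (rule schwartz_foldr[OF h bs])
  have eq: "derivs bs (\<lambda>x. h (x + r *\<^sub>R t)) x = F (x + r *\<^sub>R t)" for t x
    unfolding F_def foldr_partial_deriv_translate[OF h bs] ..
  define R where "R = 1 + \<bar>r\<bar>"
  have R: "1 \<le> R" "\<bar>r\<bar> \<le> R" by (simp_all add: R_def)
  show "\<exists>B K. \<forall>t x. (1 + norm x) ^ N * cmod (derivs bs (\<lambda>x. h (x + r *\<^sub>R t)) x) \<le> B * (1 + norm t) ^ K"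
  proof -
    obtain B where B: "B > 0" "\<And>x. (1 + norm x) ^ N * cmod (F x) \<le> B"
      by (rule schwartz_bound[OF F, of N]) (rule that)
    have "(1 + norm x) ^ N * cmod (F (x + r *\<^sub>R t)) \<le> (R ^ N * B) * (1 + norm t) ^ N" for t x
    proof -
      have "1 + \<bar>r\<bar> * norm t \<le> R * (1 + norm t)"
        using R(1) mult_right_mono[OF R(2) norm_ge_zero[of t]] unfolding distrib_left mult_1_right by linarith
      then have "1 + norm x \<le> (1 + norm (x + r *\<^sub>R t)) * (R * (1 + norm t))"
        by (intro order_trans[OF one_plus_norm_le_shift[of x "r *\<^sub>R t"]] mult_left_mono) auto
      then have "(1 + norm x) ^ N * cmod (F (x + r *\<^sub>R t)) \<le> ((1 + norm (x + r *\<^sub>R t)) * (R * (1 + norm t))) ^ N * cmod (F (x + r *\<^sub>R t))"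
        by (intro mult_right_mono power_mono) auto
      also have "\<dots> = (R ^ N * (1 + norm t) ^ N) * ((1 + norm (x + r *\<^sub>R t)) ^ N * cmod (F (x + r *\<^sub>R t)))"
        by (simp only: power_mult_distrib mult_ac)
      also have "\<dots> \<le> (R ^ N * (1 + norm t) ^ N) * B" using R by (intro mult_left_mono B) auto
      finally show ?thesis by (simp only: mult_ac)
    qed
    then show ?thesis unfolding eq by blast
  qed
  show "\<exists>B K. \<forall>t t' x. (1 + norm x) ^ N * cmod (derivs bs (\<lambda>x. h (x + r *\<^sub>R t)) x - derivs bs (\<lambda>x. h (x + r *\<^sub>R t')) x)
      \<le> B * (1 + norm t + norm t') ^ K * norm (t - t')"
  proof -
    obtain B where B: "B \<ge> 0" "\<And>u v x. (1 + norm x) ^ N * cmod (F (x + u) - F (x + v)) \<le> B * (1 + norm u + norm v) ^ N * norm (u - v)"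
      using schwartz_lipschitz_translate[OF F, of N] by blast
    have "(1 + norm x) ^ N * cmod (F (x + r *\<^sub>R t) - F (x + r *\<^sub>R t')) \<le> (B * R ^ (N + 1)) * (1 + norm t + norm t') ^ N * norm (t - t')" for t t' x
    proof -
      have "1 + \<bar>r\<bar> * norm t + \<bar>r\<bar> * norm t' \<le> R * (1 + norm t + norm t')"
        using R mult_right_mono[OF R(2), of "norm t"] mult_right_mono[OF R(2), of "norm t'"]
        unfolding distrib_left mult_1_right by (simp add: add_mono)
      then have 1: "(1 + norm (r *\<^sub>R t) + norm (r *\<^sub>R t')) ^ N \<le> (R * (1 + norm t + norm t')) ^ N"
        by (intro power_mono) auto
      have 2: "norm (r *\<^sub>R t - r *\<^sub>R t') \<le> R * norm (t - t')"
        unfolding scaleR_diff_right[symmetric] norm_scaleR by (intro mult_right_mono R) simp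
      have "B * (1 + norm (r *\<^sub>R t) + norm (r *\<^sub>R t')) ^ N * norm (r *\<^sub>R t - r *\<^sub>R t')
        \<le> B * (R * (1 + norm t + norm t')) ^ N * (R * norm (t - t'))"
        using B(1) R by (intro mult_mono 1 2 mult_nonneg_nonneg) auto
      also have "\<dots> = (B * R ^ (N + 1)) * (1 + norm t + norm t') ^ N * norm (t - t')"
        by (simp only: power_mult_distrib power_add power_one_right mult_ac)
      finally show ?thesis by (rule order_trans[OF B(2)])
    qed
    then show ?thesis unfolding eq by blast
  qed
qed

lemma cmod_cis_diff_le: "cmod (cis a - cis b) \<le> \<bar>a - b\<bar>"
proof -
  have "cis a - cis b = cis b * (cis (a - b) - 1)" by (simp add: right_diff_distrib cis_mult)
  then have "cmod (cis a - cis b) = cmod (cis (a - b) - 1)" by (simp add: norm_mult)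
  also have "\<dots> \<le> \<bar>a - b\<bar>"
    using iexp_approx1[of "a - b" 0] by (simp add: cis_conv_exp)
  finally show ?thesis .
qed

lemma cmod_add_mult_le:
  assumes "cmod z \<le> r"
  shows "cmod (p + z * q) \<le> cmod p + r * cmod q"
  using norm_triangle_ineq[of p "z * q"] mult_right_mono[OF assms norm_ge_zero[of q]]
  unfolding norm_mult by linarith

text \<open>
  Induction that removes the derivative applied first. With \<open>e\<close> the character of frequency \<open>t\<close>, the
  derivative of \<open>g e\<close> is \<open>(partial_deriv b g) e\<close> plus a multiple of \<open>(b \<bullet> t) g e\<close>, so the statement has
  to be proved for all \<open>g\<close> at once, and each step costs one power of the parameter.
\<close>

lemma modulation_family_bounds:
  fixes g :: "'a::euclidean_space \<Rightarrow> complex"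
  assumes "set bs \<subseteq> Basis" "g \<in> schwartz"
  shows "(\<exists>B K. \<forall>t x. (1 + norm x) ^ N * cmod (derivs bs (\<lambda>x. g x * cis (2 * pi * (x \<bullet> t))) x) \<le> B * (1 + norm t) ^ K) \<and>
     (\<exists>B K. \<forall>t t' x. (1 + norm x) ^ N * cmod (derivs bs (\<lambda>x. g x * cis (2 * pi * (x \<bullet> t))) x - derivs bs (\<lambda>x. g x * cis (2 * pi * (x \<bullet> t'))) x)
        \<le> B * (1 + norm t + norm t') ^ K * norm (t - t'))"
  using assms
proof (induction bs arbitrary: g rule: rev_induct)
  case Nil
  obtain B where B: "B > 0" "\<And>x. (1 + norm x) ^ (N + 1) * cmod (g x) \<le> B"
    by (rule schwartz_bound[OF Nil(2), of "N + 1"]) (rule that)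
  have 1: "(1 + norm x) ^ N * cmod (g x * cis (2 * pi * (x \<bullet> t))) \<le> B * (1 + norm t) ^ 0" for x t
  proof -
    have "(1 + norm x) ^ N * cmod (g x) \<le> (1 + norm x) ^ (N + 1) * cmod (g x)"
      by (intro mult_right_mono power_increasing) auto
    also have "\<dots> \<le> B" by (rule B)
    finally show ?thesis by (simp add: norm_mult)
  qed
  have 2: "(1 + norm x) ^ N * cmod (g x * cis (2 * pi * (x \<bullet> t)) - g x * cis (2 * pi * (x \<bullet> t')))
      \<le> (2 * pi * B) * (1 + norm t + norm t') ^ 0 * norm (t - t')" for x t t'
  proof -
    have "cmod (cis (2 * pi * (x \<bullet> t)) - cis (2 * pi * (x \<bullet> t'))) \<le> \<bar>2 * pi * (x \<bullet> t) - 2 * pi * (x \<bullet> t')\<bar>"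
      by (rule cmod_cis_diff_le)
    also have "\<dots> = 2 * pi * \<bar>x \<bullet> (t - t')\<bar>"
      by (simp add: inner_diff_right right_diff_distrib[symmetric] abs_mult)
    also have "\<dots> \<le> 2 * pi * ((1 + norm x) * norm (t - t'))"
      by (intro mult_left_mono order_trans[OF Cauchy_Schwarz_ineq2] mult_right_mono) auto
    finally have c: "cmod (cis (2 * pi * (x \<bullet> t)) - cis (2 * pi * (x \<bullet> t'))) \<le> 2 * pi * ((1 + norm x) * norm (t - t'))" .
    have "(1 + norm x) ^ N * cmod (g x * cis (2 * pi * (x \<bullet> t)) - g x * cis (2 * pi * (x \<bullet> t')))
       = (1 + norm x) ^ N * cmod (g x) * cmod (cis (2 * pi * (x \<bullet> t)) - cis (2 * pi * (x \<bullet> t')))"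
      unfolding right_diff_distrib[symmetric] norm_mult by (simp only: mult.assoc)
    also have "\<dots> \<le> (1 + norm x) ^ N * cmod (g x) * (2 * pi * ((1 + norm x) * norm (t - t')))"
      by (intro mult_left_mono c) simp
    also have "\<dots> = (2 * pi * norm (t - t')) * ((1 + norm x) ^ (N + 1) * cmod (g x))"
      by (simp only: power_add power_one_right mult_ac)
    also have "\<dots> \<le> (2 * pi * norm (t - t')) * B" by (intro mult_left_mono B) simp
    finally show ?thesis by (simp add: mult_ac)
  qed
  show ?case unfolding foldr.simps id_apply using 1 2 by blast
next
  case (snoc b bs)
  then have bs: "set bs \<subseteq> Basis" and b: "b \<in> Basis" and g: "g \<in> schwartz" by auto
  define e where "e t x = cis (2 * pi * (x \<bullet> t))" for t x :: 'a
  define P where "P t x = derivs bs (\<lambda>x. partial_deriv b g x * e t x) x" for t x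
  define Q where "Q t x = derivs bs (\<lambda>x. g x * e t x) x" for t x
  have eq: "derivs (bs @ [b]) (\<lambda>x. g x * e t x) x = P t x + (\<i> * of_real (2 * pi * (b \<bullet> t))) * Q t x" for t x
    unfolding P_def Q_def
    using foldr_partial_deriv_add_cmult[OF schwartz_modulation[OF schwartz_partial_deriv[OF g b], of "2 * pi" t] schwartz_modulation[OF g, of "2 * pi" t] bs]
    by (simp add: partial_deriv_modulation[OF g] e_def)
  have coef: "cmod (\<i> * of_real (2 * pi * (b \<bullet> t))) \<le> 2 * pi * norm t" for t
  proof -
    have "\<bar>b \<bullet> t\<bar> \<le> norm t" using Basis_le_norm[OF b, of t] by (simp add: inner_commute)
    then show ?thesis by (simp add: norm_mult abs_mult)
  qed
  note IH1 = snoc.IH[OF bs schwartz_partial_deriv[OF g b], folded e_def, folded P_def]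
  note IH2 = snoc.IH[OF bs g, folded e_def, folded Q_def]
  obtain B1 K1 where B1: "\<And>t x. (1 + norm x) ^ N * cmod (P t x) \<le> B1 * (1 + norm t) ^ K1" using IH1 by blast
  obtain B2 K2 where B2: "\<And>t x. (1 + norm x) ^ N * cmod (Q t x) \<le> B2 * (1 + norm t) ^ K2" using IH2 by blast
  obtain L1 M1 where L1: "\<And>t t' x. (1 + norm x) ^ N * cmod (P t x - P t' x) \<le> L1 * (1 + norm t + norm t') ^ M1 * norm (t - t')" using IH1 by blast
  obtain L2 M2 where L2: "\<And>t t' x. (1 + norm x) ^ N * cmod (Q t x - Q t' x) \<le> L2 * (1 + norm t + norm t') ^ M2 * norm (t - t')" using IH2 by blast
  have B1': "B1 \<ge> 0" using order_trans[OF _ B1[of 0 0]] by simp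
  have B2': "B2 \<ge> 0" using order_trans[OF _ B2[of 0 0]] by simp
  define w where "w t t' = 1 + norm t + norm t'" for t t' :: 'a
  have w: "1 \<le> w t t'" "1 + norm t \<le> w t t'" "norm t' \<le> w t t'" for t t' by (simp_all add: w_def)
  have growth: "(1 + norm x) ^ N * cmod (P t x + (\<i> * of_real (2 * pi * (b \<bullet> t))) * Q t x) \<le> (B1 + 2 * pi * B2) * (1 + norm t) ^ (K1 + K2 + 1)" for t x
  proof -
    have "(1 + norm x) ^ N * cmod (P t x + (\<i> * of_real (2 * pi * (b \<bullet> t))) * Q t x)
       \<le> (1 + norm x) ^ N * (cmod (P t x) + (2 * pi * norm t) * cmod (Q t x))"
      by (intro mult_left_mono cmod_add_mult_le coef) simp
    also have "\<dots> = (1 + norm x) ^ N * cmod (P t x) + (2 * pi * norm t) * ((1 + norm x) ^ N * cmod (Q t x))"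
      by (simp only: distrib_left mult_ac)
    also have "\<dots> \<le> B1 * (1 + norm t) ^ K1 + (2 * pi * (1 + norm t)) * (B2 * (1 + norm t) ^ K2)"
      by (intro add_mono mult_mono B1 B2) auto
    also have "\<dots> \<le> B1 * (1 + norm t) ^ (K1 + K2 + 1) + (2 * pi * B2) * (1 + norm t) ^ (K1 + K2 + 1)"
    proof (rule add_mono)
      show "B1 * (1 + norm t) ^ K1 \<le> B1 * (1 + norm t) ^ (K1 + K2 + 1)" by (intro mult_left_mono power_increasing B1') auto
      have "(2 * pi * (1 + norm t)) * (B2 * (1 + norm t) ^ K2) = (2 * pi * B2) * (1 + norm t) ^ (K2 + 1)"
        by (simp only: power_add power_one_right mult_ac)
      also have "\<dots> \<le> (2 * pi * B2) * (1 + norm t) ^ (K1 + K2 + 1)" using B2' by (intro mult_left_mono power_increasing) auto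
      finally show "(2 * pi * (1 + norm t)) * (B2 * (1 + norm t) ^ K2) \<le> (2 * pi * B2) * (1 + norm t) ^ (K1 + K2 + 1)" .
    qed
    finally show ?thesis by (simp only: distrib_right)
  qed
  define M where "M = M1 + M2 + K2 + 1"
  have lip: "(1 + norm x) ^ N * cmod ((P t x + (\<i> * of_real (2 * pi * (b \<bullet> t))) * Q t x) - (P t' x + (\<i> * of_real (2 * pi * (b \<bullet> t'))) * Q t' x))
     \<le> (\<bar>L1\<bar> + 2 * pi * B2 + 2 * pi * \<bar>L2\<bar>) * (1 + norm t + norm t') ^ M * norm (t - t')" for t t' x
  proof -
    have "(P t x + (\<i> * of_real (2 * pi * (b \<bullet> t))) * Q t x) - (P t' x + (\<i> * of_real (2 * pi * (b \<bullet> t'))) * Q t' x)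
       = (P t x - P t' x) + ((\<i> * of_real (2 * pi * (b \<bullet> (t - t')))) * Q t x + (\<i> * of_real (2 * pi * (b \<bullet> t'))) * (Q t x - Q t' x))"
      by (simp add: inner_diff_right algebra_simps)
    also have "cmod \<dots> \<le> cmod (P t x - P t' x) + (2 * pi * norm (t - t') * cmod (Q t x) + 2 * pi * norm t' * cmod (Q t x - Q t' x))"
    proof (rule order_trans[OF norm_triangle_ineq], rule add_left_mono)
      have "cmod (\<i> * of_real (2 * pi * (b \<bullet> (t - t'))) * Q t x) \<le> 2 * pi * norm (t - t') * cmod (Q t x)"
        unfolding norm_mult[of "_ * _"] by (intro mult_right_mono coef) simp
      moreover have "cmod (\<i> * of_real (2 * pi * (b \<bullet> (t - t'))) * Q t x + \<i> * of_real (2 * pi * (b \<bullet> t')) * (Q t x - Q t' x))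
          \<le> cmod (\<i> * of_real (2 * pi * (b \<bullet> (t - t'))) * Q t x) + 2 * pi * norm t' * cmod (Q t x - Q t' x)"
        by (intro cmod_add_mult_le coef)
      ultimately show "cmod (\<i> * of_real (2 * pi * (b \<bullet> (t - t'))) * Q t x + \<i> * of_real (2 * pi * (b \<bullet> t')) * (Q t x - Q t' x))
          \<le> 2 * pi * norm (t - t') * cmod (Q t x) + 2 * pi * norm t' * cmod (Q t x - Q t' x)" by linarith
    qed
    finally have "(1 + norm x) ^ N * cmod ((P t x + (\<i> * of_real (2 * pi * (b \<bullet> t))) * Q t x) - (P t' x + (\<i> * of_real (2 * pi * (b \<bullet> t'))) * Q t' x))
       \<le> (1 + norm x) ^ N * (cmod (P t x - P t' x) + (2 * pi * norm (t - t') * cmod (Q t x) + 2 * pi * norm t' * cmod (Q t x - Q t' x)))"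
      by (rule mult_left_mono) simp
    also have "\<dots> = (1 + norm x) ^ N * cmod (P t x - P t' x) + ((2 * pi * norm (t - t')) * ((1 + norm x) ^ N * cmod (Q t x)) + (2 * pi * norm t') * ((1 + norm x) ^ N * cmod (Q t x - Q t' x)))"
      by (simp only: distrib_left mult_ac)
    also have "\<dots> \<le> \<bar>L1\<bar> * w t t' ^ M * norm (t - t') + ((2 * pi * B2) * w t t' ^ M * norm (t - t') + (2 * pi * \<bar>L2\<bar>) * w t t' ^ M * norm (t - t'))"
    proof (intro add_mono)
      show "(1 + norm x) ^ N * cmod (P t x - P t' x) \<le> \<bar>L1\<bar> * w t t' ^ M * norm (t - t')"
        using w(1)[of t t'] by (intro order_trans[OF L1[folded w_def]] mult_right_mono mult_mono power_increasing) (auto simp: M_def)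
      have "(2 * pi * norm (t - t')) * ((1 + norm x) ^ N * cmod (Q t x)) \<le> (2 * pi * norm (t - t')) * (B2 * w t t' ^ M)"
      proof (intro mult_left_mono order_trans[OF B2])
        have "(1 + norm t) ^ K2 \<le> w t t' ^ K2" by (intro power_mono w) simp
        also have "\<dots> \<le> w t t' ^ M" by (intro power_increasing w) (simp add: M_def)
        finally show "(1 + norm t) ^ K2 \<le> w t t' ^ M" .
      qed (use B2' in auto)
      then show "(2 * pi * norm (t - t')) * ((1 + norm x) ^ N * cmod (Q t x)) \<le> (2 * pi * B2) * w t t' ^ M * norm (t - t')"
        by (simp only: mult_ac)
      have "(2 * pi * norm t') * ((1 + norm x) ^ N * cmod (Q t x - Q t' x)) \<le> (2 * pi * w t t') * (\<bar>L2\<bar> * w t t' ^ M2 * norm (t - t'))"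
      proof (rule mult_mono)
        show "(1 + norm x) ^ N * cmod (Q t x - Q t' x) \<le> \<bar>L2\<bar> * w t t' ^ M2 * norm (t - t')"
          using w(1)[of t t'] by (intro order_trans[OF L2[folded w_def]] mult_right_mono) auto
      qed (use w[of t t'] w(3)[of t' t] in auto)
      also have "\<dots> = (2 * pi * \<bar>L2\<bar> * norm (t - t')) * w t t' ^ (M2 + 1)" by (simp only: power_add power_one_right mult_ac)
      also have "\<dots> \<le> (2 * pi * \<bar>L2\<bar> * norm (t - t')) * w t t' ^ M" by (intro mult_left_mono power_increasing w) (auto simp: M_def)
      finally show "(2 * pi * norm t') * ((1 + norm x) ^ N * cmod (Q t x - Q t' x)) \<le> (2 * pi * \<bar>L2\<bar>) * w t t' ^ M * norm (t - t')"
        by (simp only: mult_ac)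
    qed
    finally show ?thesis by (simp only: distrib_right w_def add.assoc)
  qed
  show ?case unfolding e_def[symmetric] eq using growth lip by blast
qed

lemma tempered_family_modulation:
  fixes g :: "'a::euclidean_space \<Rightarrow> complex"
  assumes "g \<in> schwartz"
  shows "tempered_family (\<lambda>t x. g x * cis (2 * pi * (x \<bullet> t)))"
  unfolding tempered_family_def using modulation_family_bounds[OF _ assms] schwartz_modulation[OF assms] by blast

section \<open>Coherent states and uniqueness of the Wigner kernel\<close>

text \<open>
  The Gaussian factor is the exponential of \<open>- 2 pi (norm (x - m))\<^sup>2\<close>. This is the width that the
  cross-Wigner distribution of two copies of \<open>gaussian\<close> has in both position and frequency.
\<close>

definition coherent_state :: "'a::euclidean_space \<Rightarrow> 'a \<Rightarrow> 'a \<Rightarrow> complex" where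
  "coherent_state m u x = gaussian (sqrt 2 *\<^sub>R (x - m)) * cis (2 * pi * (x \<bullet> u))"

lemma schwartz_gaussian_affine: "r \<noteq> 0 \<Longrightarrow> (\<lambda>x. gaussian (r *\<^sub>R (x - m))) \<in> schwartz"
  using schwartz_affine[OF schwartz_gaussian_pi, of r "- (r *\<^sub>R m)"] by (simp add: scaleR_diff_right)

lemma schwartz_coherent_state: "coherent_state m u \<in> schwartz"
  unfolding coherent_state_def[abs_def] by (intro schwartz_modulation schwartz_gaussian_affine) simp

lemma gaussian_mult:
  assumes "r\<^sup>2 + s\<^sup>2 = q\<^sup>2"
  shows "gaussian (r *\<^sub>R x) * gaussian (s *\<^sub>R x) = gaussian (q *\<^sub>R x)"
proof -
  have "(norm (r *\<^sub>R x))\<^sup>2 + (norm (s *\<^sub>R x))\<^sup>2 = (norm (q *\<^sub>R x))\<^sup>2"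
    unfolding norm_scaleR power_mult_distrib power2_abs distrib_right[symmetric] assms ..
  then have "exp (- pi * (norm (r *\<^sub>R x))\<^sup>2) * exp (- pi * (norm (s *\<^sub>R x))\<^sup>2) = exp (- pi * (norm (q *\<^sub>R x))\<^sup>2)"
    unfolding exp_add[symmetric] distrib_left[symmetric] by (simp only:)
  then show ?thesis unfolding gaussian_def of_real_mult[symmetric] by (simp only:)
qed

lemma tempered_dist_scale_zero:
  assumes k: "tempered_dist k" and f: "f \<in> schwartz" and c: "c \<noteq> 0" and zero: "k (\<lambda>x. c * f x) = 0"
  shows "k f = 0"
proof -
  have "k (\<lambda>x. c * f x) = c * k f" using k f unfolding tempered_dist_def by blast
  with c zero show ?thesis by simp
qed

text \<open>
  Averaging the coherent states of centre \<open>m\<close> over all frequencies, with a Gaussian weight, multiplies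
  their Gaussian by a further one and thereby makes it narrower.
\<close>

lemma tempered_dist_narrow_gaussian:
  fixes k :: "('a::euclidean_space \<Rightarrow> complex) \<Rightarrow> complex"
  assumes k: "tempered_dist k" and zero: "\<And>m u. k (coherent_state m u) = 0" and \<epsilon>: "0 < \<epsilon>" "\<epsilon> \<le> 1/2"
  shows "k (\<lambda>x. gaussian ((x - m) /\<^sub>R \<epsilon>)) = 0"
proof -
  define q where "q = inverse \<epsilon>"
  have "2\<^sup>2 \<le> q\<^sup>2" using \<epsilon> unfolding q_def by (intro power_mono) (simp_all add: field_simps)
  then have q2: "q\<^sup>2 - 2 > 0" by simp
  \<comment> \<open>A Gaussian weight of parameter s contributes \<open>1 / s\<^sup>2\<close> to the exponent 2 of the coherent state.\<close>
  define s where "s = 1 / sqrt (q\<^sup>2 - 2)"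
  have s: "s > 0" using q2 by (simp add: s_def)
  have sq: "(sqrt 2)\<^sup>2 + (inverse s)\<^sup>2 = q\<^sup>2" using q2 by (simp add: s_def)
  define c :: "'a \<Rightarrow> complex" where "c u = gaussian (s *\<^sub>R u) * cis (- 2 * pi * (u \<bullet> m))" for u
  have cS: "c \<in> schwartz"
    unfolding c_def[abs_def] using schwartz_gaussian_affine[of s 0] s by (intro schwartz_modulation) simp
  define g :: "'a \<Rightarrow> complex" where "g x = gaussian (sqrt 2 *\<^sub>R (x - m))" for x
  have gS: "g \<in> schwartz" unfolding g_def[abs_def] by (intro schwartz_gaussian_affine) simp
  have "k (\<lambda>x. LINT u|lborel. c u * (g x * cis (2 * pi * (x \<bullet> u)))) = 0"
  proof (rule tempered_dist_superposition[OF k tempered_family_modulation[OF gS] _ borel_measurable_schwartz[OF cS] schwartz_rapidly_decreasing[OF cS]])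
    show "k (\<lambda>x. g x * cis (2 * pi * (x \<bullet> u))) = 0" for u
      using zero[of m u] unfolding g_def coherent_state_def[abs_def] .
  qed
  moreover have "(LINT u|lborel. c u * (g x * cis (2 * pi * (x \<bullet> u)))) = of_real (1 / s ^ DIM('a)) * gaussian ((x - m) /\<^sub>R \<epsilon>)" for x
  proof -
    have "c u * (g x * cis (2 * pi * (x \<bullet> u))) = g x * (gaussian (s *\<^sub>R u) * cis (2 * pi * (u \<bullet> (x - m))))" for u
    proof -
      have "cis (- 2 * pi * (u \<bullet> m)) * cis (2 * pi * (x \<bullet> u)) = cis (2 * pi * (u \<bullet> (x - m)))"
        unfolding cis_mult by (rule arg_cong[of _ _ cis]) (simp add: inner_diff_right right_diff_distrib inner_commute)
      then show ?thesis unfolding c_def by (simp only: mult_ac)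
    qed
    then have "(LINT u|lborel. c u * (g x * cis (2 * pi * (x \<bullet> u)))) = g x * (of_real (1 / s ^ DIM('a)) * gaussian ((x - m) /\<^sub>R s))"
      by (simp only: integral_mult_right_zero fourier_gaussian_scaled[OF s])
    also have "\<dots> = of_real (1 / s ^ DIM('a)) * (gaussian (sqrt 2 *\<^sub>R (x - m)) * gaussian (inverse s *\<^sub>R (x - m)))"
      by (simp only: g_def mult_ac)
    also have "gaussian (sqrt 2 *\<^sub>R (x - m)) * gaussian (inverse s *\<^sub>R (x - m)) = gaussian ((x - m) /\<^sub>R \<epsilon>)"
      using gaussian_mult[OF sq] by (simp only: q_def)
    finally show ?thesis .
  qed
  ultimately have "k (\<lambda>x. of_real (1 / s ^ DIM('a)) * gaussian ((x - m) /\<^sub>R \<epsilon>)) = 0" by (simp only:)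
  then show ?thesis
    using s \<epsilon> schwartz_gaussian_affine[of "inverse \<epsilon>" m]
    by - (rule tempered_dist_scale_zero[OF k, of _ "of_real (1 / s ^ DIM('a))"], simp_all)
qed

text \<open>
  Averaging the narrow Gaussians over their centres with weight \<open>\<Psi>\<close> gives the convolution of \<open>\<Psi>\<close> with
  a Gaussian.
\<close>

lemma tempered_dist_mollification:
  fixes k :: "('a::euclidean_space \<Rightarrow> complex) \<Rightarrow> complex"
  assumes k: "tempered_dist k" and zero: "\<And>m u. k (coherent_state m u) = 0" and \<epsilon>: "0 < \<epsilon>" "\<epsilon> \<le> 1/2" and \<Psi>: "\<Psi> \<in> schwartz"
  shows "k (\<lambda>x. LINT z|lborel. gaussian z * \<Psi> (x + (- \<epsilon>) *\<^sub>R z)) = 0"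
proof -
  define h :: "'a \<Rightarrow> complex" where "h x = gaussian (x /\<^sub>R \<epsilon>)" for x
  have hS: "h \<in> schwartz" unfolding h_def[abs_def] using schwartz_gaussian_affine[of "inverse \<epsilon>" 0] \<epsilon> by simp
  have [measurable]: "h \<in> borel_measurable borel" "\<Psi> \<in> borel_measurable borel" by (intro borel_measurable_schwartz hS \<Psi>)+
  have "k (\<lambda>x. LINT t|lborel. \<Psi> t * h (x + (- 1) *\<^sub>R t)) = 0"
  proof (rule tempered_dist_superposition[OF k tempered_family_translate[OF hS] _ borel_measurable_schwartz[OF \<Psi>] schwartz_rapidly_decreasing[OF \<Psi>]])
    show "k (\<lambda>x. h (x + (- 1) *\<^sub>R t)) = 0" for t
      using tempered_dist_narrow_gaussian[OF k zero \<epsilon>, of t] by (simp add: h_def)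
  qed
  moreover have "(LINT t|lborel. \<Psi> t * h (x + (- 1) *\<^sub>R t)) = of_real (\<epsilon> ^ DIM('a)) * (LINT z|lborel. gaussian z * \<Psi> (x + (- \<epsilon>) *\<^sub>R z))" for x
  proof -
    have "(LINT z|lborel. \<Psi> (x + (- \<epsilon>) *\<^sub>R z) * h (x + (- 1) *\<^sub>R (x + (- \<epsilon>) *\<^sub>R z))) = (1 / \<bar>- \<epsilon>\<bar> ^ DIM('a)) *\<^sub>R (LINT t|lborel. \<Psi> t * h (x + (- 1) *\<^sub>R t))"
      using \<epsilon> by (intro lborel_integral_affine(1)[of "\<lambda>t. \<Psi> t * h (x + (- 1) *\<^sub>R t)"]) auto
    moreover have "\<Psi> (x + (- \<epsilon>) *\<^sub>R z) * h (x + (- 1) *\<^sub>R (x + (- \<epsilon>) *\<^sub>R z)) = gaussian z * \<Psi> (x + (- \<epsilon>) *\<^sub>R z)" for z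
      using \<epsilon> by (simp add: h_def mult.commute)
    ultimately have "(LINT z|lborel. gaussian z * \<Psi> (x + (- \<epsilon>) *\<^sub>R z)) = (1 / \<bar>- \<epsilon>\<bar> ^ DIM('a)) *\<^sub>R (LINT t|lborel. \<Psi> t * h (x + (- 1) *\<^sub>R t))"
      by (simp only:)
    then show ?thesis using \<epsilon> by (simp add: scaleR_conv_of_real)
  qed
  ultimately have "k (\<lambda>x. of_real (\<epsilon> ^ DIM('a)) * (LINT z|lborel. gaussian z * \<Psi> (x + (- \<epsilon>) *\<^sub>R z))) = 0" by (simp only:)
  then show ?thesis
    using \<epsilon> tempered_family_superposition(1)[OF tempered_family_translate[OF \<Psi>] borel_measurable_schwartz[OF schwartz_gaussian_pi]
       schwartz_rapidly_decreasing[OF schwartz_gaussian_pi], of "- \<epsilon>"]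
    by - (rule tempered_dist_scale_zero[OF k, of _ "of_real (\<epsilon> ^ DIM('a))"], simp_all)
qed

text \<open>
  The mollifications of \<open>\<Psi>\<close> converge to \<open>\<Psi>\<close> in every seminorm, at a rate proportional to their width.
\<close>

lemma coherent_states_total:
  fixes k :: "('a::euclidean_space \<Rightarrow> complex) \<Rightarrow> complex"
  assumes k: "tempered_dist k" and zero: "\<And>m u. k (coherent_state m u) = 0" and \<Psi>: "\<Psi> \<in> schwartz"
  shows "k \<Psi> = 0"
proof -
  define \<epsilon> where "\<epsilon> i = inverse (real (Suc i)) / 2" for i
  have \<epsilon>: "0 < \<epsilon> i" "\<epsilon> i \<le> 1/2" for i by (simp_all add: \<epsilon>_def field_simps)
  have \<epsilon>0: "\<epsilon> \<longlonglongrightarrow> 0" unfolding \<epsilon>_def using tendsto_divide[OF LIMSEQ_inverse_real_of_nat tendsto_const[of 2]] by simp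
  note g = borel_measurable_schwartz[OF schwartz_gaussian_pi] schwartz_rapidly_decreasing[OF schwartz_gaussian_pi]
  define \<Psi>' where "\<Psi>' i x = (LINT z|lborel. gaussian z * \<Psi> (x + (- \<epsilon> i) *\<^sub>R z))" for i x
  note S = tempered_family_superposition[OF tempered_family_translate[OF \<Psi>] g]
  show ?thesis
  proof (rule tempered_dist_zero_limit[OF k \<Psi>, of \<Psi>'])
    show "\<Psi>' i \<in> schwartz" for i unfolding \<Psi>'_def[abs_def] by (rule S(1))
    show "k (\<Psi>' i) = 0" for i
      unfolding \<Psi>'_def[abs_def] by (rule tempered_dist_mollification[OF k zero \<epsilon> \<Psi>])
    fix N
    define L where "L = {bs :: 'a list. set bs \<subseteq> Basis \<and> length bs \<le> N}"
    have L: "finite L" unfolding L_def by (rule finite_lists_length_le) simp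
    have "\<forall>bs. \<exists>B. bs \<in> L \<longrightarrow> 0 \<le> B \<and> (\<forall>u v x. (1 + norm x) ^ N * cmod (derivs bs \<Psi> (x + u) - derivs bs \<Psi> (x + v)) \<le> B * (1 + norm u + norm v) ^ N * norm (u - v))"
      using schwartz_lipschitz_translate[OF schwartz_foldr[OF \<Psi>]] unfolding L_def by blast
    then obtain B where B0: "\<And>bs. bs \<in> L \<Longrightarrow> 0 \<le> B bs" and B: "\<And>bs u v x. bs \<in> L \<Longrightarrow>
      (1 + norm x) ^ N * cmod (derivs bs \<Psi> (x + u) - derivs bs \<Psi> (x + v)) \<le> B bs * (1 + norm u + norm v) ^ N * norm (u - v)"
      by metis
    define B' where "B' = (\<Sum>bs\<in>L. B bs)"
    have B': "B' \<ge> 0" unfolding B'_def by (intro sum_nonneg B0)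
    have BB: "B bs \<le> B'" if "bs \<in> L" for bs unfolding B'_def using L that B0 by (intro member_le_sum) auto
    define I where "I = (LINT z::'a|lborel. cmod (gaussian z) * (B' * (1 + norm z) ^ (N + 1)))"
    have le: "(1 + norm x) ^ N * cmod (derivs bs \<Psi> x - derivs bs (\<Psi>' i) x) \<le> \<epsilon> i * I"
      if bs: "set bs \<subseteq> Basis" "length bs \<le> N" for i bs x
    proof -
      let ?F = "derivs bs \<Psi>"
      have bsL: "bs \<in> L" using bs by (simp add: L_def)
      have D: "derivs bs (\<Psi>' i) x = (LINT z|lborel. gaussian z * ?F (x + (- \<epsilon> i) *\<^sub>R z))"
        unfolding \<Psi>'_def[abs_def] S(2)[OF bs(1)] foldr_partial_deriv_translate[OF \<Psi> bs(1)] ..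
      have i1: "integrable lborel (\<lambda>z. gaussian z * ?F (x + (- \<epsilon> i) *\<^sub>R z))"
        using S(3)[OF bs(1), of "- \<epsilon> i" x] unfolding foldr_partial_deriv_translate[OF \<Psi> bs(1)] .
      have i2: "integrable lborel (\<lambda>z::'a. gaussian z * ?F x)"
        by (intro integrable_mult_left integrable_schwartz schwartz_gaussian_pi)
      have "?F x = (LINT z::'a|lborel. gaussian z * ?F x)"
        unfolding integral_mult_left_zero integral_gaussian by simp
      then have "?F x - derivs bs (\<Psi>' i) x = (LINT z|lborel. gaussian z * (?F x - ?F (x + (- \<epsilon> i) *\<^sub>R z)))"
        unfolding D right_diff_distrib Bochner_Integration.integral_diff[OF i2 i1] by (simp only:)
      then have "(1 + norm x) ^ N * cmod (?F x - derivs bs (\<Psi>' i) x)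
          = cmod (of_real ((1 + norm x) ^ N) * (LINT z|lborel. gaussian z * (?F x - ?F (x + (- \<epsilon> i) *\<^sub>R z))))"
        by (simp add: norm_mult del: of_real_power of_real_add)
      also have "\<dots> = cmod (LINT z|lborel. of_real ((1 + norm x) ^ N) * (gaussian z * (?F x - ?F (x + (- \<epsilon> i) *\<^sub>R z))))"
        unfolding integral_mult_right_zero ..
      also have "\<dots> \<le> (LINT z::'a|lborel. \<epsilon> i * (cmod (gaussian z) * (B' * (1 + norm z) ^ (N + 1))))"
      proof (rule norm_lebesgue_integral_le)
        show "integrable lborel (\<lambda>z::'a. \<epsilon> i * (cmod (gaussian z) * (B' * (1 + norm z) ^ (N + 1))))"
          by (intro integrable_mult_right integrable_rapidly_decreasing_weight g)
        fix z :: 'a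
        have "(1 + norm x) ^ N * cmod (?F (x + 0) - ?F (x + (- \<epsilon> i) *\<^sub>R z)) \<le> B bs * (1 + norm (0::'a) + norm ((- \<epsilon> i) *\<^sub>R z)) ^ N * norm (0 - (- \<epsilon> i) *\<^sub>R z)"
          by (rule B[OF bsL])
        also have "\<dots> = B bs * (1 + \<epsilon> i * norm z) ^ N * (\<epsilon> i * norm z)" using \<epsilon>(1)[of i] by simp
        also have "\<dots> \<le> B' * (1 + norm z) ^ N * (\<epsilon> i * (1 + norm z))"
        proof -
          have "\<epsilon> i * norm z \<le> 1 * norm z" using \<epsilon>[of i] by (intro mult_right_mono) auto
          then show ?thesis using \<epsilon>[of i] B' by (intro mult_mono BB bsL power_mono) auto
        qed
        finally have 1: "(1 + norm x) ^ N * cmod (?F x - ?F (x + (- \<epsilon> i) *\<^sub>R z)) \<le> B' * (1 + norm z) ^ N * (\<epsilon> i * (1 + norm z))" by simp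
        have "cmod (of_real ((1 + norm x) ^ N) * (gaussian z * (?F x - ?F (x + (- \<epsilon> i) *\<^sub>R z))))
            = cmod (gaussian z) * ((1 + norm x) ^ N * cmod (?F x - ?F (x + (- \<epsilon> i) *\<^sub>R z)))"
          by (simp add: norm_mult mult_ac del: of_real_power of_real_add)
        also have "\<dots> \<le> cmod (gaussian z) * (B' * (1 + norm z) ^ N * (\<epsilon> i * (1 + norm z)))" by (intro mult_left_mono 1) simp
        also have "\<dots> = \<epsilon> i * (cmod (gaussian z) * (B' * (1 + norm z) ^ (N + 1)))" by (simp only: power_add power_one_right mult_ac)
        finally show "cmod (of_real ((1 + norm x) ^ N) * (gaussian z * (?F x - ?F (x + (- \<epsilon> i) *\<^sub>R z)))) \<le> \<epsilon> i * (cmod (gaussian z) * (B' * (1 + norm z) ^ (N + 1)))" .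
      qed
      also have "\<dots> = \<epsilon> i * I" unfolding I_def integral_mult_right_zero ..
      finally show ?thesis .
    qed
    have "(\<lambda>i. \<epsilon> i * I) \<longlonglongrightarrow> 0 * I" by (intro tendsto_mult_right \<epsilon>0)
    then have "(\<lambda>i. \<epsilon> i * I) \<longlonglongrightarrow> 0" by simp
    with le show "\<exists>e. e \<longlonglongrightarrow> 0 \<and> (\<forall>i bs x. set bs \<subseteq> Basis \<longrightarrow> length bs \<le> N \<longrightarrow>
      (1 + norm x) ^ N * cmod (derivs bs \<Psi> x - derivs bs (\<Psi>' i) x) \<le> e i)"
      by blast
  qed
qed

lemma coherent_state_Pair:
  "coherent_state (m1, m2) (u1, u2) (z, w) = coherent_state m1 u1 z * coherent_state m2 u2 w"
proof -
  have "gaussian (sqrt 2 *\<^sub>R ((z, w) - (m1, m2))) = gaussian (sqrt 2 *\<^sub>R (z - m1)) * gaussian (sqrt 2 *\<^sub>R (w - m2))"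
    by (simp add: gaussian_def norm_Pair exp_add[symmetric] distrib_left flip: of_real_mult)
  moreover have "cis (2 * pi * ((z, w) \<bullet> (u1, u2))) = cis (2 * pi * (z \<bullet> u1)) * cis (2 * pi * (w \<bullet> u2))"
    by (simp add: cis_mult distrib_left)
  ultimately show ?thesis unfolding coherent_state_def by (simp only: mult_ac)
qed

text \<open>
  Two Gaussians with centres \<open>a + D / 2\<close> and \<open>a - D / 2\<close> and frequencies \<open>r + \<alpha> / 2\<close> and \<open>r - \<alpha> / 2\<close>
  have a cross-Wigner distribution concentrated at the mean point \<open>(a, r)\<close> that oscillates
  according to the differences \<open>\<alpha>\<close> and \<open>D\<close>. Every coherent state arises in this way.
\<close>

lemma coherent_state_cross_wigner:
  fixes m u :: "'a::euclidean_space \<times> 'a"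
  obtains f g \<gamma> where "f \<in> schwartz" "g \<in> schwartz" "\<gamma> \<noteq> 0" "\<And>w. cross_wigner f g w = \<gamma> * coherent_state m u w"
proof -
  obtain a r where m: "m = (a, r)" by (cases m)
  obtain \<alpha> \<beta> where u: "u = (\<alpha>, \<beta>)" by (cases u)
  \<comment> \<open>The frequency variable enters the phase through \<open>- (\<xi> \<bullet> D)\<close>.\<close>
  define D where "D = - \<beta>"
  define f where "f t = gaussian (1 *\<^sub>R (t - (a + D /\<^sub>R 2))) * cis (2 * pi * (t \<bullet> (r + \<alpha> /\<^sub>R 2)))" for t
  define g where "g t = gaussian (1 *\<^sub>R (t - (a - D /\<^sub>R 2))) * cis (2 * pi * (t \<bullet> (r - \<alpha> /\<^sub>R 2)))" for t
  define \<gamma> where "\<gamma> = complex_of_real (sqrt 2 ^ DIM('a)) * cis (2 * pi * (D \<bullet> r))"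
  have fS: "f \<in> schwartz" unfolding f_def[abs_def] by (intro schwartz_modulation schwartz_gaussian_affine) simp
  have gS: "g \<in> schwartz" unfolding g_def[abs_def] by (intro schwartz_modulation schwartz_gaussian_affine) simp
  have W: "cross_wigner f g (x, \<xi>) = \<gamma> * coherent_state m u (x, \<xi>)" for x \<xi>
  proof -
    define s where "s = 1 / sqrt 2"
    have s: "s > 0" by (simp add: s_def)
    define K where "K v = gaussian (s *\<^sub>R v) * cis (2 * pi * (v \<bullet> (r - \<xi>)))" for v
    have K_meas: "K \<in> borel_measurable borel"
      unfolding K_def[abs_def] using schwartz_gaussian_affine[of s 0] s by (intro borel_measurable_schwartz schwartz_modulation) simp
    define A where "A = gaussian (sqrt 2 *\<^sub>R (x - a)) * cis (2 * pi * (x \<bullet> \<alpha>)) * cis (2 * pi * (D \<bullet> (r - \<xi>)))"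
    have "f (x + y /\<^sub>R 2) * cnj (g (x - y /\<^sub>R 2)) * cis (- 2 * pi * (y \<bullet> \<xi>)) = A * K (y + - D)" for y
    proof -
      have e1: "x + y /\<^sub>R 2 - (a + D /\<^sub>R 2) = (x - a) + (y - D) /\<^sub>R 2" "x - y /\<^sub>R 2 - (a - D /\<^sub>R 2) = (x - a) - (y - D) /\<^sub>R 2"
        by (simp_all add: scaleR_diff_right)
      have n: "(norm (x + y /\<^sub>R 2 - (a + D /\<^sub>R 2)))\<^sup>2 + (norm (x - y /\<^sub>R 2 - (a - D /\<^sub>R 2)))\<^sup>2
          = (norm (sqrt 2 *\<^sub>R (x - a)))\<^sup>2 + (norm (s *\<^sub>R (y - D)))\<^sup>2"
        unfolding e1 parallelogram_law by (simp add: s_def power_mult_distrib power_divide)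
      have G: "gaussian (1 *\<^sub>R (x + y /\<^sub>R 2 - (a + D /\<^sub>R 2))) * cnj (gaussian (1 *\<^sub>R (x - y /\<^sub>R 2 - (a - D /\<^sub>R 2))))
          = gaussian (sqrt 2 *\<^sub>R (x - a)) * gaussian (s *\<^sub>R (y - D))"
        unfolding gaussian_def complex_cnj_complex_of_real of_real_mult[symmetric] exp_add[symmetric] distrib_left[symmetric] scaleR_one n ..
      have C: "cis (2 * pi * ((x + y /\<^sub>R 2) \<bullet> (r + \<alpha> /\<^sub>R 2))) * cnj (cis (2 * pi * ((x - y /\<^sub>R 2) \<bullet> (r - \<alpha> /\<^sub>R 2)))) * cis (- 2 * pi * (y \<bullet> \<xi>))
          = cis (2 * pi * (x \<bullet> \<alpha>)) * cis (2 * pi * (D \<bullet> (r - \<xi>))) * cis (2 * pi * ((y - D) \<bullet> (r - \<xi>)))"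
        unfolding cis_cnj cis_mult
        by (rule arg_cong[of _ _ cis])
           (simp add: inner_add_left inner_add_right inner_diff_left inner_diff_right algebra_simps)
      have "f (x + y /\<^sub>R 2) * cnj (g (x - y /\<^sub>R 2)) * cis (- 2 * pi * (y \<bullet> \<xi>))
         = (gaussian (1 *\<^sub>R (x + y /\<^sub>R 2 - (a + D /\<^sub>R 2))) * cnj (gaussian (1 *\<^sub>R (x - y /\<^sub>R 2 - (a - D /\<^sub>R 2)))))
          * (cis (2 * pi * ((x + y /\<^sub>R 2) \<bullet> (r + \<alpha> /\<^sub>R 2))) * cnj (cis (2 * pi * ((x - y /\<^sub>R 2) \<bullet> (r - \<alpha> /\<^sub>R 2)))) * cis (- 2 * pi * (y \<bullet> \<xi>)))"
        unfolding f_def g_def complex_cnj_mult by (simp only: mult_ac)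
      also have "\<dots> = A * K (y + - D)"
        unfolding G C A_def K_def add_uminus_conv_diff by (simp only: mult_ac)
      finally show ?thesis .
    qed
    then have "cross_wigner f g (x, \<xi>) = A * (LINT y|lborel. K (y + - D))"
      unfolding cross_wigner_eq fst_conv snd_conv by (simp only: integral_mult_right_zero)
    also have "(LINT y|lborel. K (y + - D)) = of_real (1 / s ^ DIM('a)) * gaussian ((r - \<xi>) /\<^sub>R s)"
      unfolding lborel_integral_translate(1)[OF K_meas] unfolding K_def by (rule fourier_gaussian_scaled[OF s])
    also have "gaussian ((r - \<xi>) /\<^sub>R s) = gaussian (sqrt 2 *\<^sub>R (\<xi> - r))"
      by (simp add: s_def gaussian_def norm_minus_commute)
    also have "1 / s ^ DIM('a) = sqrt 2 ^ DIM('a)" by (simp add: s_def power_divide)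
    also have "A = gaussian (sqrt 2 *\<^sub>R (x - a)) * (cis (2 * pi * (D \<bullet> r)) * (cis (2 * pi * (x \<bullet> \<alpha>)) * cis (2 * pi * (\<xi> \<bullet> \<beta>))))"
    proof -
      have "cis (2 * pi * (x \<bullet> \<alpha>)) * cis (2 * pi * (D \<bullet> (r - \<xi>))) = cis (2 * pi * (D \<bullet> r)) * (cis (2 * pi * (x \<bullet> \<alpha>)) * cis (2 * pi * (\<xi> \<bullet> \<beta>)))"
        unfolding cis_mult by (rule arg_cong[of _ _ cis]) (simp add: D_def inner_diff_right inner_commute algebra_simps)
      then show ?thesis unfolding A_def by (simp only: mult.assoc)
    qed
    finally show ?thesis
      unfolding m u coherent_state_Pair unfolding coherent_state_def \<gamma>_def by (simp only: mult_ac)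
  qed
  show ?thesis
  proof (rule that[OF fS gS])
    show "\<gamma> \<noteq> 0" by (simp add: \<gamma>_def)
    show "cross_wigner f g w = \<gamma> * coherent_state m u w" for w using W by (cases w) simp
  qed
qed

text \<open>
  A coherent state on the product is a tensor product of two coherent states, and the second factor
  is a multiple of a cross-Wigner distribution. So the difference of two kernels vanishes on all
  coherent states.
\<close>

lemma wigner_kernel_unique:
  fixes k k' :: "(('a::euclidean_space \<times> 'a) \<times> ('a \<times> 'a) \<Rightarrow> complex) \<Rightarrow> complex"
  assumes k: "tempered_dist k" "wigner_represents T k" and k': "tempered_dist k'" "wigner_represents T k'"
    and \<Psi>: "\<Psi> \<in> schwartz"
  shows "k' \<Psi> = k \<Psi>"
proof -
  define \<kappa> where "\<kappa> \<phi> = k' \<phi> - k \<phi>" for \<phi>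
  have \<kappa>: "tempered_dist \<kappa>"
  proof -
    obtain C N where C: "\<And>\<phi>. \<phi> \<in> schwartz \<Longrightarrow> cmod (k \<phi>) \<le> C * schwartz_norm N \<phi>"
      using k(1) unfolding tempered_dist_def by blast
    obtain C' N' where C': "\<And>\<phi>. \<phi> \<in> schwartz \<Longrightarrow> cmod (k' \<phi>) \<le> C' * schwartz_norm N' \<phi>"
      using k'(1) unfolding tempered_dist_def by blast
    have mono: "schwartz_norm n \<phi> \<le> schwartz_norm (n + n') \<phi>" if \<phi>: "\<phi> \<in> schwartz" for n n' and \<phi> :: "('a \<times> 'a) \<times> ('a \<times> 'a) \<Rightarrow> complex"
    proof -
      have *: "(1 + norm x) ^ n * cmod (multi_deriv \<alpha> \<phi> x) \<le> schwartz_norm (n + n') \<phi>" if \<alpha>: "multi_order \<alpha> \<le> n" for \<alpha> x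
      proof -
        have "(1 + norm x) ^ n * cmod (multi_deriv \<alpha> \<phi> x) \<le> (1 + norm x) ^ (n + n') * cmod (multi_deriv \<alpha> \<phi> x)"
          by (intro mult_right_mono power_increasing) auto
        also have "\<dots> \<le> schwartz_norm (n + n') \<phi>"
          using cSUP_upper[OF _ schwartz_norm_bdd[OF \<phi>], of "(\<alpha>, x)" "n + n'"] \<alpha> by (simp add: schwartz_norm_def)
        finally show ?thesis .
      qed
      have ne: "((\<lambda>_. 0), 0) \<in> {\<alpha>. multi_order \<alpha> \<le> n} \<times> UNIV" by (simp add: multi_order_def)
      show ?thesis
        unfolding schwartz_norm_def[of n] by (rule cSUP_least) (use * ne in auto)
    qed
    have "cmod (\<kappa> \<phi>) \<le> (\<bar>C'\<bar> + \<bar>C\<bar>) * schwartz_norm (N + N') \<phi>" if \<phi>: "\<phi> \<in> schwartz" for \<phi>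
    proof -
      have "C' * schwartz_norm N' \<phi> \<le> \<bar>C'\<bar> * schwartz_norm (N + N') \<phi>"
        using mono[OF \<phi>, of N' N] by (intro mult_mono schwartz_norm_nonneg \<phi>) (auto simp: add.commute)
      moreover have "C * schwartz_norm N \<phi> \<le> \<bar>C\<bar> * schwartz_norm (N + N') \<phi>"
        using mono[OF \<phi>, of N N'] by (intro mult_mono schwartz_norm_nonneg \<phi>) auto
      ultimately show ?thesis
        using C[OF \<phi>] C'[OF \<phi>] norm_triangle_ineq4[of "k' \<phi>" "k \<phi>"] unfolding \<kappa>_def distrib_right by linarith
    qed
    then show ?thesis
      using k(1) k'(1) unfolding tempered_dist_def \<kappa>_def by (auto simp: right_diff_distrib)
  qed
  have "\<kappa> (coherent_state M U) = 0" for M U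
  proof -
    obtain m1 m2 u1 u2 where MU: "M = (m1, m2)" "U = (u1, u2)" by (metis surj_pair)
    obtain f g \<gamma> where fg: "f \<in> schwartz" "g \<in> schwartz" and \<gamma>: "\<gamma> \<noteq> 0"
      and W: "\<And>w. cross_wigner f g w = \<gamma> * coherent_state m2 u2 w"
      by (rule coherent_state_cross_wigner[of m2 u2]) (rule that)
    have eq: "(\<lambda>(z, w). coherent_state m1 u1 z * cross_wigner f g w) = (\<lambda>p. \<gamma> * coherent_state M U p)"
      unfolding W MU by (auto simp: fun_eq_iff coherent_state_Pair)
    have "k (\<lambda>(z, w). coherent_state m1 u1 z * cross_wigner f g w) = k' (\<lambda>(z, w). coherent_state m1 u1 z * cross_wigner f g w)"
      using k(2) k'(2) fg schwartz_coherent_state[of m1 u1] unfolding wigner_represents_def by metis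
    then have "\<kappa> (\<lambda>p. \<gamma> * coherent_state M U p) = 0" unfolding eq \<kappa>_def by simp
    then show ?thesis by (rule tempered_dist_scale_zero[OF \<kappa> schwartz_coherent_state \<gamma>])
  qed
  from coherent_states_total[OF \<kappa> this \<Psi>] show ?thesis by (simp add: \<kappa>_def)
qed

section \<open>The Wigner kernel of a Gelfand-Shilov multiplier\<close>

theorem theorem4p1:
  fixes \<sigma> :: "'a::euclidean_space \<Rightarrow> complex"
  assumes "gelfand_shilov_half \<sigma>"
  shows "\<exists>a :: 'a \<times> 'a \<Rightarrow> complex.
    smooth a \<and>
    (\<exists>C>0. \<exists>\<epsilon>>0. \<forall>s \<xi>.
       cmod (a (s, \<xi>)) \<le> C * exp (- \<epsilon> * (norm \<xi>)\<^sup>2) * exp (- \<epsilon> * (norm s)\<^sup>2)) \<and>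
    is_wigner_kernel (\<lambda>f. regular_dist (fourier_multiplier \<sigma> f)) (delta_kernel a)"
proof -
  obtain C \<epsilon> where C: "C > 0" and \<epsilon>: "\<epsilon> > 0" and \<sigma>: "\<sigma> \<in> schwartz"
    and bound: "\<And>n b \<xi>. b \<in> Basis \<Longrightarrow> cmod (derivs (replicate n b) \<sigma> \<xi>) \<le> C ^ (n + 1) * sqrt (fact n) * exp (- \<epsilon> * (norm \<xi>)\<^sup>2)"
    by (rule gelfand_shilov_half_schwartz[OF assms]) (rule that)
  define r where "r = inv_fourier \<sigma>"
  have r: "r \<in> schwartz" unfolding r_def by (rule schwartz_inv_fourier[OF \<sigma>])
  obtain K \<delta> where \<delta>: "\<delta> > 0" and decay: "\<And>x. cmod (inv_fourier \<sigma> x) \<le> K * exp (- \<delta> * (norm x)\<^sup>2)"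
    by (rule inv_fourier_gaussian_decay[OF \<sigma> C \<epsilon>], erule bound) (rule that)
  have decay_r: "cmod (r x) \<le> K * exp (- \<delta> * (norm x)\<^sup>2)" for x unfolding r_def by (rule decay)
  have decay_\<sigma>: "cmod (\<sigma> \<xi>) \<le> C * exp (- \<epsilon> * (norm \<xi>)\<^sup>2)" for \<xi>
    using bound[of "SOME b. b \<in> Basis" 0 \<xi>] by (simp add: SOME_Basis)
  define a where "a = cross_wigner r r"
  obtain A1 where A1: "\<And>x \<xi>. cmod (a (x, \<xi>)) \<le> A1 * exp (- 2 * \<delta> * (norm x)\<^sup>2)"
    unfolding a_def using cross_wigner_decay_position[OF decay_r decay_r \<delta>] by blast
  obtain A2 where A2: "\<And>x \<xi>. cmod (a (x, \<xi>)) \<le> A2 * exp (- 2 * \<epsilon> * (norm \<xi>)\<^sup>2)"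
    unfolding a_def r_def using cross_wigner_decay_frequency[OF \<sigma> \<sigma> decay_\<sigma> decay_\<sigma> \<epsilon>] by blast
  define A where "A = max 1 (max A1 A2)"
  define \<eta> where "\<eta> = min \<delta> \<epsilon>"
  have \<eta>: "\<eta> > 0" "\<eta> \<le> \<delta>" "\<eta> \<le> \<epsilon>" using \<delta> \<epsilon> by (auto simp: \<eta>_def)
  have A: "A > 0" "A1 \<le> A" "A2 \<le> A" by (auto simp: A_def)
  have decay: "cmod (a (s, \<xi>)) \<le> A * exp (- \<eta> * (norm \<xi>)\<^sup>2) * exp (- \<eta> * (norm s)\<^sup>2)" for s \<xi>
  \<comment> \<open>Multiplying the two one-sided bounds and taking the square root gives decay in both variables.\<close>
  proof (rule power2_le_imp_le)
    have "cmod (a (s, \<xi>)) \<le> A * exp (- 2 * \<eta> * (norm s)\<^sup>2)"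
      using A \<eta> by (intro order_trans[OF A1] mult_mono) (auto intro!: mult_right_mono)
    moreover have "cmod (a (s, \<xi>)) \<le> A * exp (- 2 * \<eta> * (norm \<xi>)\<^sup>2)"
      using A \<eta> by (intro order_trans[OF A2] mult_mono) (auto intro!: mult_right_mono)
    ultimately have "(cmod (a (s, \<xi>)))\<^sup>2 \<le> (A * exp (- 2 * \<eta> * (norm s)\<^sup>2)) * (A * exp (- 2 * \<eta> * (norm \<xi>)\<^sup>2))"
      unfolding power2_eq_square using A by (intro mult_mono) auto
    also have "\<dots> = (A * exp (- \<eta> * (norm \<xi>)\<^sup>2) * exp (- \<eta> * (norm s)\<^sup>2))\<^sup>2"
      by (simp add: power2_eq_square[of "_ * _"] power2_eq_square[of A] exp_add[symmetric] mult_ac)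
    finally show "(cmod (a (s, \<xi>)))\<^sup>2 \<le> (A * exp (- \<eta> * (norm \<xi>)\<^sup>2) * exp (- \<eta> * (norm s)\<^sup>2))\<^sup>2" .
  qed (use A in auto)
  have smooth: "smooth a" unfolding a_def by (rule smooth_cross_wigner[OF r r])
  obtain B where B: "\<And>p. cmod (a p) \<le> B" unfolding a_def using cross_wigner_bounded[OF r r] by metis
  have tempered: "tempered_dist (delta_kernel a)"
    by (rule tempered_delta_kernel[OF smooth_continuous_on[OF smooth] B])
  have repr: "wigner_represents (\<lambda>f. regular_dist (fourier_multiplier \<sigma> f)) (delta_kernel a)"
    unfolding a_def r_def by (rule wigner_represents_fourier_multiplier[OF \<sigma>])
  have "is_wigner_kernel (\<lambda>f. regular_dist (fourier_multiplier \<sigma> f)) (delta_kernel a)"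
    unfolding is_wigner_kernel_def
    using continuous_linear_op_fourier_multiplier[OF \<sigma>] tempered repr wigner_kernel_unique[OF tempered repr] by blast
  with smooth decay A(1) \<eta>(1) show ?thesis by blast
qed

end
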